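(* Let $1<p<\infty$, $n\ge1$, and set $a=\frac{n+p-2}{2(p-1)}$. Let $$G_p(x,t)=t^{-\frac{n+p-2}{2(p-1)}}\exp\left(-\frac{|x|^2}{4(p-1)t}\right),\qquad (x,t)\in\mathbb R^n\times(0,\infty).$$ (i) The function $G_p$ is a positive viscosity solution of $$u_t=\Delta u+(p-2)|\nabla u|^{-2}\nabla^2u(\nabla u,\nabla u)$$ on $\mathbb R^n\times(0,\infty)$ and, with $v=\log G_p$, at every $(x,t)\in\mathbb R^n\times(0,\infty)$, $$(p-1)|\nabla v|^2-v_t=\frac{n+p-2}{2(p-1)t}.$$ (ii) Let $a'\ge0$ be such that for every closed Riemannian manifold $\mathbb M$ of dimension $n$ with $\operatorname{Ric}\ge0$ and every positive viscosity solution $u$ of the equation in (i) in $\mathbb M\times(0,\infty)$, continuous up to $t=0$, with $u(\cdot,0)\in C^\infty(\mathbb M)$ and $u(\cdot,0)>0$, the function $v=\log u$ satisfies $$(p-1)|\nabla v|^2-v_t\le\frac{a'}{t}$$ on $\mathbb M\times(0,\infty)$, in the sense that $v$ is a viscosity supersolution of $\phi_t-(p-1)|\nabla\phi|^2+\frac{a'}{t}=0$. Then $a'\ge a$.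
   Context: Closed means compact without boundary. Below, $\mathbb M$ is a Riemannian manifold ($\mathbb M=\mathbb R^n$ in part (i)). Viscosity solutions of the normalized parabolic $p$-Laplacian equation. For $x\in\mathbb M$, $q\in T_x\mathbb M\setminus\{0\}$ and $X\in\operatorname{Sym}(T_x\mathbb M)$ set $F(q,X)=\operatorname{tr}X+(p-2)X(\hat q,\hat q)$, $\hat q=q/|q|$, and let $F^*$, $F_*$ be the upper and lower semicontinuous envelopes of $F$, extended to $q=0$. Thus $F^*(0,X)=\operatorname{tr}X+(p-2)\lambda_{\max}(X)$ and $F_*(0,X)=\operatorname{tr}X+(p-2)\lambda_{\min}(X)$ if $p\ge2$, with $\lambda_{\max}$ and $\lambda_{\min}$ interchanged if $1<p<2$. An upper semicontinuous function $u$ on $\mathbb M\times(0,T)$ is a viscosity subsolution if, whenever $\varphi$ of class $C^{2,1}$ ($C^2$ in $x$, $C^1$ in $t$) touches $u$ from above at $(x_0,t_0)$, one has $\varphi_t(x_0,t_0)\le F^*(\nabla\varphi(x_0,t_0),\nabla^2\varphi(x_0,t_0))$. A lower semicontinuous function $u$ is a viscosity supersolution if, whenever $\varphi\in C^{2,1}$ touches $u$ from below at $(x_0,t_0)$, one has $\varphi_t(x_0,t_0)\ge F_*(\nabla\varphi(x_0,t_0),\nabla^2\varphi(x_0,t_0))$. A viscosity solution is a continuous function which is both. The same definitions apply with $T=\infty$. Viscosity supersolutions of the first-order equation: $v$ is a viscosity supersolution of $\phi_t-(p-1)|\nabla\phi|^2+\frac{a'}{t}=0$ if, whenever a $C^1$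 function $\varphi$ touches $v$ from below at $(x_0,t_0)$, $t_0>0$, one has $\varphi_t-(p-1)|\nabla\varphi|^2+\frac{a'}{t_0}\ge0$ at $(x_0,t_0)$. *)

theory Defs
  imports "HOL-Analysis.Analysis"
begin

section \<open>Differentiability classes in Euclidean space\<close>

fun Ck_on :: "nat \<Rightarrow> ('a::real_normed_vector \<Rightarrow> 'b::real_normed_vector) \<Rightarrow> 'a set \<Rightarrow> bool" where
  "Ck_on 0 f S \<longleftrightarrow> continuous_on S f"
| "Ck_on (Suc k) f S \<longleftrightarrow>
     (\<forall>x\<in>S. f differentiable (at x)) \<and> (\<forall>v. Ck_on k (\<lambda>x. frechet_derivative f (at x) v) S)"

text \<open>All uses of \<^const>\<open>Ck_on\<close> are on open sets of finite-dimensional spaces.\<close>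

definition smooth_on :: "('a::real_normed_vector \<Rightarrow> 'b::real_normed_vector) \<Rightarrow> 'a set \<Rightarrow> bool" where
  "smooth_on f S \<longleftrightarrow> (\<forall>k. Ck_on k f S)"

definition partial :: "'n::finite \<Rightarrow> (real^'n \<Rightarrow> real) \<Rightarrow> real^'n \<Rightarrow> real" where
  "partial i f y = frechet_derivative f (at y) (axis i 1)"

definition time_deriv :: "('a \<times> real \<Rightarrow> real) \<Rightarrow> 'a \<Rightarrow> real \<Rightarrow> real" where
  "time_deriv f x t = deriv (\<lambda>s. f (x, s)) t"

text \<open>Class \<open>C\<^sup>2\<^sup>,\<^sup>1\<close>: the derivatives \<open>f\<^sub>t\<close>, \<open>\<nabla>f\<close>, \<open>\<nabla>\<^sup>2f\<close> exist and are jointly continuous on the open set \<open>S\<close>.\<close>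

definition C21_on :: "((real^'n::finite) \<times> real \<Rightarrow> real) \<Rightarrow> ((real^'n) \<times> real) set \<Rightarrow> bool" where
  "C21_on f S \<longleftrightarrow>
     (\<forall>(y, t)\<in>S. (\<lambda>z. f (z, t)) differentiable (at y) \<and>
                 (\<forall>i. partial i (\<lambda>z. f (z, t)) differentiable (at y)) \<and>
                 (\<lambda>s. f (y, s)) differentiable (at t)) \<and>
     continuous_on S f \<and>
     continuous_on S (\<lambda>(y, t). time_deriv f y t) \<and>
     (\<forall>i. continuous_on S (\<lambda>(y, t). partial i (\<lambda>z. f (z, t)) y)) \<and>
     (\<forall>i j. continuous_on S (\<lambda>(y, t). partial i (partial j (\<lambda>z. f (z, t))) y))"


section \<open>Riemannian manifolds\<close>

text \<open>
  A chart \<open>(U, h)\<close> consists of an open set \<open>U\<close> of the manifold and a homeomorphism \<open>h\<close> of \<open>U\<close>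
  onto an open subset of \<open>\<real>\<^sup>n\<close>, where \<open>n = CARD('n)\<close>.  The Riemannian metric is recorded by its
  coordinate matrices \<open>(g\<^sub>i\<^sub>j)\<close>, one matrix-valued function on \<open>h ` U\<close> for each chart.
\<close>

type_synonym ('a, 'n) chart = "'a set \<times> ('a \<Rightarrow> real^'n)"

record ('a, 'n) manifold =
  top_of :: "'a topology"
  atlas :: "('a, 'n) chart set"
  metric :: "('a, 'n) chart \<Rightarrow> real^'n \<Rightarrow> real^'n^'n"

abbreviation points :: "('a, 'n::finite) manifold \<Rightarrow> 'a set" where
  "points M \<equiv> topspace (top_of M)"

definition chart_inv :: "('a, 'n::finite) chart \<Rightarrow> real^'n \<Rightarrow> 'a" where
  "chart_inv c = inv_into (fst c) (snd c)"

definition transition :: "('a, 'n::finite) chart \<Rightarrow> ('a, 'n) chart \<Rightarrow> real^'n \<Rightarrow> real^'n" where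
  "transition c d = snd d \<circ> chart_inv c"

definition riemannian_manifold :: "('a, 'n::finite) manifold \<Rightarrow> bool" where
  "riemannian_manifold M \<longleftrightarrow>
     Hausdorff_space (top_of M) \<and> second_countable (top_of M) \<and>
     \<Union>(fst ` atlas M) = points M \<and>
     (\<forall>(U, h)\<in>atlas M.
        openin (top_of M) U \<and> open (h ` U) \<and>
        homeomorphic_map (subtopology (top_of M) U) (top_of_set (h ` U)) h) \<and>
     (\<forall>c\<in>atlas M. \<forall>d\<in>atlas M. smooth_on (transition c d) (snd c ` (fst c \<inter> fst d))) \<and>
     (\<forall>c\<in>atlas M.
        (\<forall>i j. smooth_on (\<lambda>y. metric M c y $ i $ j) (snd c ` fst c)) \<and>
        (\<forall>y\<in>snd c ` fst c. transpose (metric M c y) = metric M c y \<and>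
           (\<forall>\<xi>. \<xi> \<noteq> 0 \<longrightarrow> \<xi> \<bullet> (metric M c y *v \<xi>) > 0))) \<and>
     (\<forall>c\<in>atlas M. \<forall>d\<in>atlas M. \<forall>y\<in>snd c ` (fst c \<inter> fst d). \<forall>\<xi> \<eta>.
        \<xi> \<bullet> (metric M c y *v \<eta>) =
        frechet_derivative (transition c d) (at y) \<xi> \<bullet>
          (metric M d (transition c d y) *v frechet_derivative (transition c d) (at y) \<eta>))"

definition closed_riemannian_manifold :: "('a, 'n::finite) manifold \<Rightarrow> bool" where
  "closed_riemannian_manifold M \<longleftrightarrow> riemannian_manifold M \<and> compact_space (top_of M)"

definition smooth_fun :: "('a, 'n::finite) manifold \<Rightarrow> ('a \<Rightarrow> real) \<Rightarrow> bool" where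
  "smooth_fun M f \<longleftrightarrow> (\<forall>c\<in>atlas M. smooth_on (f \<circ> chart_inv c) (snd c ` fst c))"

definition euclidean_manifold :: "(real^'n::finite, 'n) manifold" where
  "euclidean_manifold = \<lparr>top_of = euclidean, atlas = {(UNIV, \<lambda>x. x)}, metric = (\<lambda>c y. mat 1)\<rparr>"

lemma smooth_on_const: "smooth_on (\<lambda>_. c) S"
proof -
  have "Ck_on k (\<lambda>_. c) S" for k
    by (induction k arbitrary: c) (auto simp: frechet_derivative_const)
  then show ?thesis by (simp add: smooth_on_def)
qed

lemma smooth_on_ident: "smooth_on (\<lambda>x. x) S"
proof -
  have "Ck_on k (\<lambda>x. x) S" for k
    using smooth_on_const[of _ S] by (cases k) (auto simp: frechet_derivative_ident smooth_on_def)
  then show ?thesis by (simp add: smooth_on_def)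
qed

lemma riemannian_manifold_euclidean:
  "riemannian_manifold (euclidean_manifold :: (real^'n::finite, 'n) manifold)"
proof -
  have sc: "second_countable (euclidean :: (real^'n) topology)"
  proof -
    obtain B :: "(real^'n) set set" where B: "countable B" "\<And>C. C \<in> B \<Longrightarrow> open C"
      and U: "\<And>S. open S \<Longrightarrow> \<exists>U. U \<subseteq> B \<and> S = \<Union>U"
      using univ_second_countable by metis
    have "\<exists>V\<in>B. x \<in> V \<and> V \<subseteq> W" if "open W" "x \<in> W" for W x
    proof -
      obtain C where "C \<subseteq> B" "W = \<Union>C"
        using U[OF \<open>open W\<close>] by auto
      then show ?thesis
        using \<open>x \<in> W\<close> by auto
    qed
    then show ?thesis
      unfolding second_countable_def using B by (intro exI[of _ B]) auto
  qed
  have inv: "chart_inv (UNIV, \<lambda>x. x) = (\<lambda>x::real^'n. x)"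
    by (rule ext) (simp add: chart_inv_def inv_f_eq)
  have tr: "transition (UNIV, \<lambda>x. x) (UNIV, \<lambda>x. x) = (\<lambda>x::real^'n. x)"
    by (rule ext) (simp add: transition_def inv)
  have hom: "homeomorphic_map euclidean euclidean (\<lambda>x::real^'n. x)"
    using homeomorphic_map_id[of euclidean euclidean] unfolding id_def by simp
  show ?thesis
    using sc hom
    by (simp add: riemannian_manifold_def euclidean_manifold_def tr smooth_on_const smooth_on_ident
          Hausdorff_space_euclidean)
qed

text \<open>
  By second countability a manifold has at most continuum many points.  So, up to relabelling of
  points, every manifold has its carrier in the type \<^typ>\<open>real\<close> (the topology being an arbitrary
  one, unrelated to that of \<open>\<real>\<close>), and a quantification over all \<open>M :: (real, 'n) manifold\<close> ranges
  over all \<open>n\<close>-dimensional manifolds.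
\<close>

lemma riemannian_manifold_points_lepoll:
  fixes M :: "('a, 'n::finite) manifold"
  assumes "riemannian_manifold M"
  shows "points M \<lesssim> (UNIV :: real set)"
proof -
  have H: "Hausdorff_space (top_of M)" and S: "second_countable (top_of M)"
    using assms by (auto simp: riemannian_manifold_def)
  obtain B where B: "countable B" "\<And>V. V \<in> B \<Longrightarrow> openin (top_of M) V"
    "\<And>U x. openin (top_of M) U \<Longrightarrow> x \<in> U \<Longrightarrow> \<exists>V\<in>B. x \<in> V \<and> V \<subseteq> U"
    using S unfolding second_countable_def by metis
  define e where "e x = to_nat_on B ` {V\<in>B. x \<in> V}" for x
  have "inj_on e (points M)"
  proof (rule inj_onI, rule ccontr)
    fix x y assume xy: "x \<in> points M" "y \<in> points M" "e x = e y" "x \<noteq> y"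
    then obtain U where U: "openin (top_of M) U" "x \<in> U" "y \<notin> U"
      using H unfolding Hausdorff_space_def by (metis disjnt_iff)
    then obtain V where V: "V \<in> B" "x \<in> V" "V \<subseteq> U"
      using B(3) by blast
    have "to_nat_on B V \<in> e y"
      using V xy(3) unfolding e_def by blast
    then obtain W where "W \<in> B" "y \<in> W" "to_nat_on B V = to_nat_on B W"
      unfolding e_def by auto
    with V(1) B(1) have "V = W"
      by (metis inj_on_to_nat_on inj_onD)
    with \<open>y \<in> W\<close> V U show False
      by blast
  qed
  then have "points M \<lesssim> (UNIV :: nat set set)"
    unfolding lepoll_def by blast
  then show ?thesis
    using nat_sets_eqpoll_reals lepoll_trans2 by blast
qed


subsection \<open>Differential operators in coordinates\<close>

text \<open>
  In this subsection \<open>G\<close> is the matrix function \<open>(g\<^sub>i\<^sub>j)\<close> of the metric in a chart and \<open>y\<close> a point of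
  its coordinate domain.  Gradients are given by contravariant components, Hessians by covariant
  components.
\<close>

definition christoffel :: "(real^'n::finite \<Rightarrow> real^'n^'n) \<Rightarrow> 'n \<Rightarrow> 'n \<Rightarrow> 'n \<Rightarrow> real^'n \<Rightarrow> real" where
  "christoffel G k i j y =
     (\<Sum>l\<in>UNIV. matrix_inv (G y) $ k $ l *
        (partial i (\<lambda>z. G z $ j $ l) y + partial j (\<lambda>z. G z $ i $ l) y - partial l (\<lambda>z. G z $ i $ j) y)) / 2"

text \<open>\<open>R(\<partial>\<^sub>i, \<partial>\<^sub>j) \<partial>\<^sub>k = \<Sum>\<^sub>l riemann G l k i j \<partial>\<^sub>l\<close>, where \<open>R(X, Y) = [\<nabla>\<^sub>X, \<nabla>\<^sub>Y] - \<nabla>\<^bsub>[X, Y]\<^esub>\<close>.\<close>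

definition riemann :: "(real^'n::finite \<Rightarrow> real^'n^'n) \<Rightarrow> 'n \<Rightarrow> 'n \<Rightarrow> 'n \<Rightarrow> 'n \<Rightarrow> real^'n \<Rightarrow> real" where
  "riemann G l k i j y =
     partial i (christoffel G l j k) y - partial j (christoffel G l i k) y +
     (\<Sum>m\<in>UNIV. christoffel G l i m y * christoffel G m j k y
               - christoffel G l j m y * christoffel G m i k y)"

definition ricci :: "(real^'n::finite \<Rightarrow> real^'n^'n) \<Rightarrow> 'n \<Rightarrow> 'n \<Rightarrow> real^'n \<Rightarrow> real" where
  "ricci G j k y = (\<Sum>i\<in>UNIV. riemann G i k i j y)"

definition nonneg_ricci :: "('a, 'n::finite) manifold \<Rightarrow> bool" where
  "nonneg_ricci M \<longleftrightarrow> (\<forall>c\<in>atlas M. \<forall>y\<in>snd c ` fst c. \<forall>\<xi>.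
     (\<Sum>j\<in>UNIV. \<Sum>k\<in>UNIV. ricci (metric M c) j k y * \<xi> $ j * \<xi> $ k) \<ge> 0)"

definition grad :: "(real^'n::finite \<Rightarrow> real^'n^'n) \<Rightarrow> (real^'n \<Rightarrow> real) \<Rightarrow> real^'n \<Rightarrow> real^'n" where
  "grad G f y = matrix_inv (G y) *v (\<chi> i. partial i f y)"

definition hessian :: "(real^'n::finite \<Rightarrow> real^'n^'n) \<Rightarrow> (real^'n \<Rightarrow> real) \<Rightarrow> real^'n \<Rightarrow> real^'n^'n" where
  "hessian G f y = (\<chi> i j. partial i (partial j f) y - (\<Sum>k\<in>UNIV. christoffel G k i j y * partial k f y))"


section \<open>The normalized \<open>p\<close>-Laplacian and viscosity solutions\<close>

text \<open>
  \<open>F(q, X)\<close> on a tangent space with inner product matrix \<open>A\<close>, for a vector \<open>q \<noteq> 0\<close> and a symmetric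
  bilinear form \<open>X\<close>; the trace is taken with respect to \<open>A\<close>.
\<close>

definition plap_symbol :: "real \<Rightarrow> ((real^'n)^'n::finite) \<Rightarrow> (real^'n) \<times> (real^'n^'n) \<Rightarrow> real" where
  "plap_symbol p A = (\<lambda>(q, X).
     trace (matrix_inv A ** X) + (p - 2) * (q \<bullet> (X *v q)) / (q \<bullet> (A *v q)))"

definition plap_domain :: "((real^'n::finite) \<times> (real^'n^'n)) set" where
  "plap_domain = {(q, X). q \<noteq> 0 \<and> transpose X = X}"

text \<open>Semicontinuous envelopes of a function \<open>f\<close> defined on a set \<open>D\<close>, at points of the closure of \<open>D\<close>.\<close>

definition usc_envelope :: "'a::topological_space set \<Rightarrow> ('a \<Rightarrow> real) \<Rightarrow> 'a \<Rightarrow> ereal" where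
  "usc_envelope D f z = Limsup (inf (nhds z) (principal D)) (\<lambda>w. ereal (f w))"

definition lsc_envelope :: "'a::topological_space set \<Rightarrow> ('a \<Rightarrow> real) \<Rightarrow> 'a \<Rightarrow> ereal" where
  "lsc_envelope D f z = Liminf (inf (nhds z) (principal D)) (\<lambda>w. ereal (f w))"

definition plap_upper :: "real \<Rightarrow> ((real^'n)^'n::finite) \<Rightarrow> real^'n \<Rightarrow> real^'n^'n \<Rightarrow> ereal" where
  "plap_upper p A q X = usc_envelope plap_domain (plap_symbol p A) (q, X)"

definition plap_lower :: "real \<Rightarrow> ((real^'n)^'n::finite) \<Rightarrow> real^'n \<Rightarrow> real^'n^'n \<Rightarrow> ereal" where
  "plap_lower p A q X = lsc_envelope plap_domain (plap_symbol p A) (q, X)"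

definition usc_map :: "'a topology \<Rightarrow> ('a \<Rightarrow> real) \<Rightarrow> bool" where
  "usc_map X u \<longleftrightarrow> (\<forall>r. openin X {z \<in> topspace X. u z < r})"

definition lsc_map :: "'a topology \<Rightarrow> ('a \<Rightarrow> real) \<Rightarrow> bool" where
  "lsc_map X u \<longleftrightarrow> (\<forall>r. openin X {z \<in> topspace X. u z > r})"

abbreviation spacetime :: "('a, 'n::finite) manifold \<Rightarrow> ('a \<times> real) topology" where
  "spacetime M \<equiv> prod_topology (top_of M) euclideanreal"

definition cylinder :: "('a, 'n::finite) manifold \<Rightarrow> ereal \<Rightarrow> ('a \<times> real) set" where
  "cylinder M T = points M \<times> {t. 0 < t \<and> ereal t < T}"

definition in_chart :: "('a, 'n::finite) chart \<Rightarrow> ('a \<times> real \<Rightarrow> real) \<Rightarrow> (real^'n) \<times> real \<Rightarrow> real" where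
  "in_chart c \<phi> = (\<lambda>(y, t). \<phi> (chart_inv c y, t))"

definition chart_image :: "('a, 'n::finite) chart \<Rightarrow> ('a \<times> real) set \<Rightarrow> ((real^'n) \<times> real) set" where
  "chart_image c N = (\<lambda>(x, t). (snd c x, t)) ` (N \<inter> fst c \<times> UNIV)"

definition C1_fun :: "('a, 'n::finite) manifold \<Rightarrow> ('a \<times> real) set \<Rightarrow> ('a \<times> real \<Rightarrow> real) \<Rightarrow> bool" where
  "C1_fun M N \<phi> \<longleftrightarrow> (\<forall>c\<in>atlas M. Ck_on 1 (in_chart c \<phi>) (chart_image c N))"

definition C21_fun :: "('a, 'n::finite) manifold \<Rightarrow> ('a \<times> real) set \<Rightarrow> ('a \<times> real \<Rightarrow> real) \<Rightarrow> bool" where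
  "C21_fun M N \<phi> \<longleftrightarrow> (\<forall>c\<in>atlas M. C21_on (in_chart c \<phi>) (chart_image c N))"

text \<open>Test functions are defined, and the touching takes place, on an open neighbourhood \<open>N\<close> of the point.\<close>

definition touches_above ::
  "('a, 'n::finite) manifold \<Rightarrow> ereal \<Rightarrow> ('a \<times> real) set \<Rightarrow> ('a \<times> real \<Rightarrow> real) \<Rightarrow> ('a \<times> real \<Rightarrow> real) \<Rightarrow> 'a \<times> real \<Rightarrow> bool" where
  "touches_above M T N \<phi> u z \<longleftrightarrow>
     openin (spacetime M) N \<and> z \<in> N \<and> N \<subseteq> cylinder M T \<and> \<phi> z = u z \<and> (\<forall>w\<in>N. u w \<le> \<phi> w)"

definition touches_below ::
  "('a, 'n::finite) manifold \<Rightarrow> ereal \<Rightarrow> ('a \<times> real) set \<Rightarrow> ('a \<times> real \<Rightarrow> real) \<Rightarrow> ('a \<times> real \<Rightarrow> real) \<Rightarrow> 'a \<times> real \<Rightarrow> bool" where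
  "touches_below M T N \<phi> u z \<longleftrightarrow>
     openin (spacetime M) N \<and> z \<in> N \<and> N \<subseteq> cylinder M T \<and> \<phi> z = u z \<and> (\<forall>w\<in>N. \<phi> w \<le> u w)"

text \<open>Gradient and Hessian of \<open>\<phi>(\<cdot>, t)\<close> at the point \<open>x\<close> in the chart \<open>c\<close>.\<close>

definition grad_at :: "('a, 'n::finite) manifold \<Rightarrow> ('a, 'n) chart \<Rightarrow> ('a \<times> real \<Rightarrow> real) \<Rightarrow> 'a \<Rightarrow> real \<Rightarrow> real^'n" where
  "grad_at M c \<phi> x t = grad (metric M c) (\<lambda>y. in_chart c \<phi> (y, t)) (snd c x)"

definition hessian_at :: "('a, 'n::finite) manifold \<Rightarrow> ('a, 'n) chart \<Rightarrow> ('a \<times> real \<Rightarrow> real) \<Rightarrow> 'a \<Rightarrow> real \<Rightarrow> real^'n^'n" where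
  "hessian_at M c \<phi> x t = hessian (metric M c) (\<lambda>y. in_chart c \<phi> (y, t)) (snd c x)"

definition grad_norm_sq :: "('a, 'n::finite) manifold \<Rightarrow> ('a, 'n) chart \<Rightarrow> ('a \<times> real \<Rightarrow> real) \<Rightarrow> 'a \<Rightarrow> real \<Rightarrow> real" where
  "grad_norm_sq M c \<phi> x t = grad_at M c \<phi> x t \<bullet> (metric M c (snd c x) *v grad_at M c \<phi> x t)"

definition viscosity_subsolution ::
  "real \<Rightarrow> ('a, 'n::finite) manifold \<Rightarrow> ereal \<Rightarrow> ('a \<times> real \<Rightarrow> real) \<Rightarrow> bool" where
  "viscosity_subsolution p M T u \<longleftrightarrow>
     usc_map (subtopology (spacetime M) (cylinder M T)) u \<and>
     (\<forall>N \<phi> x t. touches_above M T N \<phi> u (x, t) \<and> C21_fun M N \<phi> \<longrightarrow>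
        (\<forall>c\<in>atlas M. x \<in> fst c \<longrightarrow>
           ereal (time_deriv \<phi> x t) \<le> plap_upper p (metric M c (snd c x)) (grad_at M c \<phi> x t) (hessian_at M c \<phi> x t)))"

definition viscosity_supersolution ::
  "real \<Rightarrow> ('a, 'n::finite) manifold \<Rightarrow> ereal \<Rightarrow> ('a \<times> real \<Rightarrow> real) \<Rightarrow> bool" where
  "viscosity_supersolution p M T u \<longleftrightarrow>
     lsc_map (subtopology (spacetime M) (cylinder M T)) u \<and>
     (\<forall>N \<phi> x t. touches_below M T N \<phi> u (x, t) \<and> C21_fun M N \<phi> \<longrightarrow>
        (\<forall>c\<in>atlas M. x \<in> fst c \<longrightarrow>
           ereal (time_deriv \<phi> x t) \<ge> plap_lower p (metric M c (snd c x)) (grad_at M c \<phi> x t) (hessian_at M c \<phi> x t)))"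

definition viscosity_solution ::
  "real \<Rightarrow> ('a, 'n::finite) manifold \<Rightarrow> ereal \<Rightarrow> ('a \<times> real \<Rightarrow> real) \<Rightarrow> bool" where
  "viscosity_solution p M T u \<longleftrightarrow>
     continuous_map (subtopology (spacetime M) (cylinder M T)) euclideanreal u \<and>
     viscosity_subsolution p M T u \<and> viscosity_supersolution p M T u"

text \<open>Viscosity supersolutions on \<open>M \<times> (0, \<infinity>)\<close> of \<open>\<phi>\<^sub>t - (p - 1) |\<nabla>\<phi>|\<^sup>2 + a' / t = 0\<close>.\<close>

definition first_order_supersolution ::
  "real \<Rightarrow> real \<Rightarrow> ('a, 'n::finite) manifold \<Rightarrow> ('a \<times> real \<Rightarrow> real) \<Rightarrow> bool" where
  "first_order_supersolution p a' M v \<longleftrightarrow>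
     (\<forall>N \<phi> x t. touches_below M \<infinity> N \<phi> v (x, t) \<and> C1_fun M N \<phi> \<longrightarrow>
        (\<forall>c\<in>atlas M. x \<in> fst c \<longrightarrow>
           time_deriv \<phi> x t - (p - 1) * grad_norm_sq M c \<phi> x t + a' / t \<ge> 0))"

text \<open>The function \<open>G\<^sub>p\<close> on \<open>\<real>\<^sup>n \<times> (0, \<infinity>)\<close>, with \<open>n = CARD('n)\<close>.\<close>

definition Gp :: "real \<Rightarrow> (real^'n::finite) \<times> real \<Rightarrow> real" where
  "Gp p = (\<lambda>(x, t).
     t powr (- ((real CARD('n) + p - 2) / (2 * (p - 1)))) * exp (- ((norm x)\<^sup>2 / (4 * (p - 1) * t))))"

end

theory Submission
  imports Defs
begin

text \<open>
  Part (i) is a computation. On radial functions the normalized \<open>p\<close>-Laplacian is the linear operator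
  \<open>(p - 1) u\<^sub>r\<^sub>r + (n - 1) u\<^sub>r / r\<close>, and \<open>G\<^sub>p\<close> is its Gaussian. At the origin the gradient vanishes, but
  there the Hessian of a radial function is a multiple of the identity, so that the symbol has the
  same value in every direction. A function that solves the equation pointwise in this sense is a
  viscosity solution (\<open>viscosity_solution_if_classical\<close>): at a touching point gradients and time
  derivatives agree and Hessians are ordered, the symbol is monotone in the Hessian, and its value in
  any direction parallel to the gradient lies between the two envelopes.

  For part (ii) the manifold is the round sphere \<open>S\<^sup>n\<close>, because the equation is linear on zonal
  functions too. In terms of \<open>s = (1 + cos r) / 2\<close>, with \<open>r\<close> the distance from a pole, it becomes
  \<open>u\<^sub>t = L u\<close> with the Jacobi operator \<open>L = \<kappa> (s (1 - s) d\<^sup>2/ds\<^sup>2 + a (1 - 2 s) d/ds)\<close>, \<open>\<kappa> = p - 1\<close>.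
  This is where \<open>a\<close> comes from: \<open>L\<close> is the radial Laplacian, sped up by \<open>\<kappa>\<close>, of a sphere of the
  fractional dimension \<open>2 a\<close>, whose heat kernel has the size \<open>t\<^bsup>-a\<^esup>\<close> at the pole for small \<open>t\<close>.

  Since \<open>L s\<^sup>k\<close> is a nonnegative multiple of \<open>s\<^bsup>k-1\<^esup>\<close> minus a nonnegative multiple of \<open>s\<^sup>k\<close>, the initial
  datum \<open>s\<^sup>m\<close>, a bump of width \<open>m\<^bsup>-1/2\<^esup>\<close> at the pole, evolves as \<open>\<Sum>k\<le>m. c\<^sub>k(t) s\<^sup>k\<close> where the
  coefficients flow downwards from \<open>m\<close> and stay nonnegative (\<open>death_chain_exists\<close>). So the solutions
  are explicit and visibly positive, after adding a constant \<open>\<delta> > 0\<close> that keeps them away from \<open>0\<close> at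
  the antipode.

  At the pole the gradient vanishes, and there the differential inequality with \<open>a'\<close> reads
  \<open>\<kappa> a Q \<le> (a' / t) S\<close> as \<open>\<delta>\<close> tends to \<open>0\<close>, where \<open>S = \<Sum> c\<^sub>k\<close>, \<open>Q = \<Sum> k c\<^sub>k\<close> and \<open>S' = - \<kappa> a Q\<close>
  (\<open>first_order_inequality_at_pole\<close>). Hence \<open>S t\<^bsup>a'\<^esup>\<close> increases. Since \<open>Q \<le> m S\<close>, the value \<open>S(1/m)\<close> is
  bounded below uniformly in \<open>m\<close>, and so \<open>S(1) \<ge> const m\<^bsup>-a'\<^esup>\<close>. On the other hand \<open>L\<close> has a reversible
  measure, the total mass of the solution is conserved, and the mass of \<open>s\<^sup>m\<close> is at most
  \<open>const m\<^bsup>-a\<^esup>\<close>. At time \<open>1\<close> the inequality bounds the mean \<open>Q / S\<close> of \<open>k\<close>, so most of the coefficient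
  sum sits on boundedly many \<open>k\<close>, and \<open>S(1)\<close> is comparable with the mass. Therefore
  \<open>m\<^bsup>-a'\<^esup> \<le> const m\<^bsup>-a\<^esup>\<close> for all \<open>m\<close>, which forces \<open>a' \<ge> a\<close> (\<open>death_chain_decay\<close>).
\<close>

section \<open>Second derivatives at a point\<close>

lemma has_real_derivative_along_line:
  fixes g :: "'a::real_normed_vector \<Rightarrow> real"
  assumes "(g has_derivative D) (at (y + b *\<^sub>R u))"
  shows "((\<lambda>b. g (y + b *\<^sub>R u)) has_real_derivative D u) (at b)"
proof -
  have "((\<lambda>b. y + b *\<^sub>R u) has_derivative (\<lambda>k. k *\<^sub>R u)) (at b)"
    by (auto intro!: derivative_eq_intros)
  from has_derivative_compose[OF this assms] show ?thesis
    unfolding has_field_derivative_def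
    using linear_scale[OF has_derivative_linear[OF assms]]
    by (simp add: mult.commute[of _ "D u"])
qed

text \<open>
  Along the direction \<open>u\<close>, the mean value theorem turns the second difference into \<open>h\<close> times an
  increment of the derivative \<open>Dg _ u\<close> over a step of size \<open>h\<close>, which differentiability of \<open>Dg _ u\<close>
  at \<open>y\<close> evaluates up to \<open>o(h)\<close>. The second difference is symmetric in \<open>u\<close> and \<open>v\<close>, and this yields
  the symmetry of second derivatives below.
\<close>
lemma second_difference_limit:
  fixes g :: "'a::real_normed_vector \<Rightarrow> real"
  assumes d: "d > 0"
    and g: "\<And>z. z \<in> ball y d \<Longrightarrow> (g has_derivative Dg z) (at z)"
    and D2: "((\<lambda>z. Dg z u) has_derivative D) (at y)"
  shows "((\<lambda>h. (g (y + h *\<^sub>R u + h *\<^sub>R v) - g (y + h *\<^sub>R u) - g (y + h *\<^sub>R v) + g y) / h\<^sup>2)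
           \<longlongrightarrow> D v) (at_right 0)"
proof (rule tendstoI)
  fix \<epsilon> :: real assume "\<epsilon> > 0"
  define K where "K = 2 * norm u + norm v + 1"
  have K: "K > 0" by (simp add: K_def add_nonneg_pos)
  define e where "e = \<epsilon> / (2 * K)"
  have e: "e > 0" using \<open>\<epsilon> > 0\<close> K by (simp add: e_def)
  have lin: "bounded_linear D" using D2 by (rule has_derivative_bounded_linear)
  obtain d' where d': "d' > 0"
    and err: "\<And>z. norm (z - y) < d' \<Longrightarrow> norm (Dg z u - Dg y u - D (z - y)) \<le> e * norm (z - y)"
    using D2 e unfolding has_derivative_at_alt by blast
  define r where "r = min d d' / K"
  have r: "r > 0" using d d' K by (simp add: r_def)
  have "dist ((g (y + h *\<^sub>R u + h *\<^sub>R v) - g (y + h *\<^sub>R u) - g (y + h *\<^sub>R v) + g y) / h\<^sup>2) (D v) < \<epsilon>"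
    if h: "0 < h" "h < r" for h
  proof -
    have hK: "h * K < min d d'" using h K by (simp add: r_def field_simps)
    have small: "norm (b *\<^sub>R u + c *\<^sub>R v) < min d d'" if "0 \<le> b" "b \<le> h" "0 \<le> c" "c \<le> h" for b c
    proof -
      have "norm (b *\<^sub>R u + c *\<^sub>R v) \<le> b * norm u + c * norm v"
        using norm_triangle_ineq[of "b *\<^sub>R u" "c *\<^sub>R v"] that by simp
      also have "\<dots> \<le> h * norm u + h * norm v"
        using that by (intro add_mono mult_right_mono) auto
      also have "\<dots> \<le> h * K"
        using h by (simp add: K_def algebra_simps)
      finally show ?thesis using hK by simp
    qed
    define \<psi> where "\<psi> b = g (y + b *\<^sub>R u + h *\<^sub>R v) - g (y + b *\<^sub>R u)" for b
    have der: "(\<psi> has_real_derivative (Dg (y + b *\<^sub>R u + h *\<^sub>R v) u - Dg (y + b *\<^sub>R u) u)) (at b)"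
      if b: "0 \<le> b" "b \<le> h" for b
    proof -
      have ball: "y + w \<in> ball y d" if "norm w < min d d'" for w
        using that by (simp add: dist_norm)
      have i1: "y + b *\<^sub>R u + h *\<^sub>R v \<in> ball y d" "y + b *\<^sub>R u \<in> ball y d"
        using ball[OF small[OF b, of h]] ball[OF small[OF b, of 0]] h by (simp_all add: add.assoc)
      have "((\<lambda>b. g ((y + h *\<^sub>R v) + b *\<^sub>R u)) has_real_derivative Dg (y + b *\<^sub>R u + h *\<^sub>R v) u) (at b)"
        using g[OF i1(1)] by (intro has_real_derivative_along_line) (simp add: ac_simps)
      moreover have "((\<lambda>b. g (y + b *\<^sub>R u)) has_real_derivative Dg (y + b *\<^sub>R u) u) (at b)"
        by (intro has_real_derivative_along_line g i1)
      ultimately show ?thesis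
        unfolding \<psi>_def by (auto intro!: DERIV_diff simp: ac_simps)
    qed
    obtain b where b: "0 < b" "b < h"
      and mv: "\<psi> h - \<psi> 0 = (h - 0) * (Dg (y + b *\<^sub>R u + h *\<^sub>R v) u - Dg (y + b *\<^sub>R u) u)"
      using MVT2[OF h(1), of \<psi> "\<lambda>b. Dg (y + b *\<^sub>R u + h *\<^sub>R v) u - Dg (y + b *\<^sub>R u) u"] der by auto
    have e1: "norm (Dg (y + b *\<^sub>R u + h *\<^sub>R v) u - Dg y u - D (b *\<^sub>R u + h *\<^sub>R v)) \<le> e * norm (b *\<^sub>R u + h *\<^sub>R v)"
      using err[of "y + b *\<^sub>R u + h *\<^sub>R v"] small[of b h] b h by (simp add: add.assoc)
    have e2: "norm (Dg (y + b *\<^sub>R u) u - Dg y u - D (b *\<^sub>R u)) \<le> e * norm (b *\<^sub>R u)"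
      using err[of "y + b *\<^sub>R u"] small[of b 0] b h by simp
    have Dl: "D (b *\<^sub>R u + h *\<^sub>R v) = D (b *\<^sub>R u) + h * D v"
      using linear_add[OF bounded_linear.linear[OF lin]] linear_scale[OF bounded_linear.linear[OF lin]] by simp
    have nb: "norm (b *\<^sub>R u + h *\<^sub>R v) + norm (b *\<^sub>R u) < h * K"
    proof -
      have "norm (b *\<^sub>R u + h *\<^sub>R v) + norm (b *\<^sub>R u) \<le> 2 * (b * norm u) + h * norm v"
        using norm_triangle_ineq[of "b *\<^sub>R u" "h *\<^sub>R v"] b h by simp
      also have "\<dots> \<le> 2 * (h * norm u) + h * norm v"
        using b by (intro add_mono mult_left_mono mult_right_mono) auto
      also have "\<dots> < h * K" using h by (simp add: K_def algebra_simps)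
      finally show ?thesis .
    qed
    have "\<bar>(Dg (y + b *\<^sub>R u + h *\<^sub>R v) u - Dg (y + b *\<^sub>R u) u) - h * D v\<bar>
        \<le> e * norm (b *\<^sub>R u + h *\<^sub>R v) + e * norm (b *\<^sub>R u)"
      using e1 e2 unfolding Dl real_norm_def by linarith
    also have "\<dots> < e * (h * K)"
      using mult_strict_left_mono[OF nb e] by (simp add: distrib_left)
    also have "\<dots> = h * (\<epsilon> / 2)" using K by (simp add: e_def)
    finally have "\<bar>(Dg (y + b *\<^sub>R u + h *\<^sub>R v) u - Dg (y + b *\<^sub>R u) u) - h * D v\<bar> < h * (\<epsilon> / 2)" .
    moreover have "g (y + h *\<^sub>R u + h *\<^sub>R v) - g (y + h *\<^sub>R u) - g (y + h *\<^sub>R v) + g y = \<psi> h - \<psi> 0"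
      by (simp add: \<psi>_def)
    ultimately have "\<bar>(g (y + h *\<^sub>R u + h *\<^sub>R v) - g (y + h *\<^sub>R u) - g (y + h *\<^sub>R v) + g y) / h\<^sup>2 - D v\<bar> * h < h * (\<epsilon> / 2)"
    proof -
      assume *: "\<bar>(Dg (y + b *\<^sub>R u + h *\<^sub>R v) u - Dg (y + b *\<^sub>R u) u) - h * D v\<bar> < h * (\<epsilon> / 2)"
        and **: "g (y + h *\<^sub>R u + h *\<^sub>R v) - g (y + h *\<^sub>R u) - g (y + h *\<^sub>R v) + g y = \<psi> h - \<psi> 0"
      have "\<bar>(\<psi> h - \<psi> 0) / h\<^sup>2 - D v\<bar> * h = \<bar>((\<psi> h - \<psi> 0) / h\<^sup>2 - D v) * h\<bar>"
        using h by (simp add: abs_mult)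
      also have "((\<psi> h - \<psi> 0) / h\<^sup>2 - D v) * h = (Dg (y + b *\<^sub>R u + h *\<^sub>R v) u - Dg (y + b *\<^sub>R u) u) - h * D v"
        unfolding mv using h by (simp add: field_simps power2_eq_square)
      finally show ?thesis using * ** by simp
    qed
    then have "\<bar>(g (y + h *\<^sub>R u + h *\<^sub>R v) - g (y + h *\<^sub>R u) - g (y + h *\<^sub>R v) + g y) / h\<^sup>2 - D v\<bar> < \<epsilon> / 2"
      using h by (simp add: mult.commute)
    then show ?thesis using \<open>\<epsilon> > 0\<close> by (simp add: dist_real_def)
  qed
  then show "\<forall>\<^sub>F h in at_right 0. dist ((g (y + h *\<^sub>R u + h *\<^sub>R v) - g (y + h *\<^sub>R u) - g (y + h *\<^sub>R v) + g y) / h\<^sup>2) (D v) < \<epsilon>"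
    unfolding eventually_at_right_field using r by auto
qed

lemma second_derivative_symmetric:
  fixes g :: "'a::real_normed_vector \<Rightarrow> real"
  assumes d: "d > 0"
    and g: "\<And>z. z \<in> ball y d \<Longrightarrow> (g has_derivative Dg z) (at z)"
    and "((\<lambda>z. Dg z u) has_derivative Du) (at y)"
    and "((\<lambda>z. Dg z v) has_derivative Dv) (at y)"
  shows "Du v = Dv u"
proof -
  have "((\<lambda>h. (g (y + h *\<^sub>R v + h *\<^sub>R u) - g (y + h *\<^sub>R v) - g (y + h *\<^sub>R u) + g y) / h\<^sup>2)
           \<longlongrightarrow> Du v) (at_right 0)"
    using second_difference_limit[OF d g assms(3), of v] by (simp add: algebra_simps)
  then show ?thesis
    using second_difference_limit[OF d g assms(4), of u] tendsto_unique trivial_limit_at_right_real by blast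
qed

text \<open>
  If the second derivative along \<open>v\<close> were negative, the first one would be negative right after the
  critical point \<open>y\<close>, and \<open>g\<close> would fall below its minimum.
\<close>
lemma second_derivative_test:
  fixes g :: "'a::real_normed_vector \<Rightarrow> real"
  assumes d: "d > 0"
    and g: "\<And>z. z \<in> ball y d \<Longrightarrow> (g has_derivative Dg z) (at z)"
    and D2: "((\<lambda>z. Dg z v) has_derivative D) (at y)"
    and min: "\<And>z. z \<in> ball y d \<Longrightarrow> g y \<le> g z"
  shows "D v \<ge> 0"
proof (rule ccontr)
  assume neg: "\<not> D v \<ge> 0"
  have y: "y \<in> ball y d" using d by simp
  have zero: "Dg y = (\<lambda>_. 0)"
    by (rule differential_zero_maxmin[OF y open_ball g[OF y]]) (use min in blast)
  define \<gamma> where "\<gamma> b = Dg (y + b *\<^sub>R v) v" for b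
  have "(\<gamma> has_real_derivative D v) (at 0)"
    unfolding \<gamma>_def by (rule has_real_derivative_along_line) (use D2 in simp)
  moreover have "\<gamma> 0 = 0" by (simp add: \<gamma>_def zero)
  ultimately obtain r where r: "r > 0" "\<And>b. 0 < b \<Longrightarrow> b < r \<Longrightarrow> \<gamma> b < 0"
    using DERIV_neg_dec_right[of \<gamma> "D v" 0] neg by auto
  \<comment> \<open>a step along \<open>v\<close> that stays in the ball and in the range where \<open>\<gamma>\<close> is negative\<close>
  define b where "b = min (r / 2) (d / (2 * (norm v + 1)))"
  have nv: "norm v + 1 > 0" by (simp add: add_nonneg_pos)
  have b: "0 < b" "b < r" "b * norm v < d"
  proof -
    show "0 < b" using r d nv by (simp add: b_def)
    have "b \<le> r / 2" unfolding b_def by (rule min.cobounded1)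
    then show "b < r" using r by linarith
    have "b * norm v \<le> d / (2 * (norm v + 1)) * norm v" by (intro mult_right_mono) (auto simp: b_def)
    also have "\<dots> < d" using d nv by (simp add: field_simps add_strict_increasing2)
    finally show "b * norm v < d" .
  qed
  have inb: "y + c *\<^sub>R v \<in> ball y d" if "0 \<le> c" "c \<le> b" for c
  proof -
    have "c * norm v \<le> b * norm v" using that by (intro mult_right_mono) auto
    then show ?thesis using b that by (simp add: dist_norm)
  qed
  have "((\<lambda>c. g (y + c *\<^sub>R v)) has_real_derivative \<gamma> c) (at c)" if "0 \<le> c" "c \<le> b" for c
    unfolding \<gamma>_def by (intro has_real_derivative_along_line g inb that)
  then obtain c where c: "0 < c" "c < b" "g (y + b *\<^sub>R v) - g (y + 0 *\<^sub>R v) = (b - 0) * \<gamma> c"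
    using MVT2[OF b(1), of "\<lambda>c. g (y + c *\<^sub>R v)" \<gamma>] by auto
  have "\<gamma> c < 0" using r c b by auto
  then have "b * \<gamma> c < 0" using b(1) by (simp add: mult_pos_neg)
  then have "g (y + b *\<^sub>R v) < g y" using c(3) by simp
  then show False using min[OF inb[of b]] b(1) by simp
qed

lemma has_derivative_partials:
  fixes f :: "real^'n::finite \<Rightarrow> real"
  assumes "f differentiable (at y)"
  shows "(f has_derivative (\<lambda>h. \<Sum>i\<in>UNIV. h $ i * partial i f y)) (at y)"
proof -
  have D: "(f has_derivative frechet_derivative f (at y)) (at y)"
    using assms frechet_derivative_works by blast
  have "frechet_derivative f (at y) h = (\<Sum>i\<in>UNIV. h $ i * partial i f y)" for h
  proof -
    have "frechet_derivative f (at y) h = frechet_derivative f (at y) (\<Sum>i\<in>UNIV. h $ i *\<^sub>R axis i 1)"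
      using basis_expansion[of h] by (simp add: scalar_mult_eq_scaleR)
    also have "\<dots> = (\<Sum>i\<in>UNIV. h $ i * partial i f y)"
      using has_derivative_linear[OF D] by (simp add: linear_sum linear_scale partial_def)
    finally show ?thesis .
  qed
  then have "frechet_derivative f (at y) = (\<lambda>h. \<Sum>i\<in>UNIV. h $ i * partial i f y)" by blast
  then show ?thesis using D by simp
qed

lemma partial_eqI:
  assumes "(f has_derivative D) (at y)"
  shows "partial i f y = D (axis i 1)"
  unfolding partial_def using frechet_derivative_at[OF assms] by simp

lemma sum_axis_mult: "(\<Sum>i\<in>UNIV. axis k (1::real) $ i * f i) = f k"
  by (simp add: axis_def if_distrib if_distribR cong: if_cong)

text \<open>
  The regularity in \<open>x\<close> that a test function of class \<open>C\<^sup>2\<^sup>,\<^sup>1\<close> and an explicit solution have in common.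
\<close>
definition twice_differentiable_at :: "(real^'n::finite \<Rightarrow> real) \<Rightarrow> real^'n \<Rightarrow> bool" where
  "twice_differentiable_at f y \<longleftrightarrow>
     (\<forall>\<^sub>F z in nhds y. f differentiable (at z)) \<and> (\<forall>i. partial i f differentiable (at y))"

lemma partial_commute:
  assumes "twice_differentiable_at f y"
  shows "partial i (partial j f) y = partial j (partial i f) y"
proof -
  obtain d where d: "d > 0" "\<And>z. z \<in> ball y d \<Longrightarrow> f differentiable (at z)"
    using assms unfolding twice_differentiable_at_def eventually_nhds_metric by (metis dist_commute mem_ball)
  let ?D = "\<lambda>z h. \<Sum>i\<in>UNIV. h $ i * partial i f z"
  let ?D2 = "\<lambda>k h. \<Sum>i\<in>UNIV. h $ i * partial i (partial k f) y"
  have D2: "((\<lambda>z. ?D z (axis k 1)) has_derivative ?D2 k) (at y)" for k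
    using assms unfolding twice_differentiable_at_def sum_axis_mult by (intro has_derivative_partials) auto
  have "?D2 i (axis j 1) = ?D2 j (axis i 1)"
    by (rule second_derivative_symmetric[OF d(1) has_derivative_partials[OF d(2)] D2 D2])
  then show ?thesis by (simp add: sum_axis_mult)
qed

text \<open>
  The envelopes of the symbol are limits over symmetric matrices; this puts the Hessian of a test
  function into the closure of their domain.
\<close>
lemma hessian_symmetric:
  assumes "twice_differentiable_at f y" and G: "\<And>z i j. G z $ i $ j = G z $ j $ i"
  shows "transpose (hessian G f y) = hessian G f y"
proof -
  have "christoffel G k j i y = christoffel G k i j y" for i j k
    unfolding christoffel_def G[of _ j i] by (simp add: add.commute)
  then show ?thesis
    by (simp add: transpose_def hessian_def vec_eq_iff partial_commute[OF assms(1)])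
qed

lemma bilinear_form_sum: "v \<bullet> (Y *v w) = (\<Sum>i\<in>UNIV. \<Sum>j\<in>UNIV. v $ i * w $ j * Y $ i $ j)"
  for v w :: "real^'n::finite"
  by (simp add: inner_vec_def matrix_vector_mult_def sum_distrib_left ac_simps)

text \<open>
  The gradients agree, so the Christoffel terms of the two Hessians cancel and the difference of the
  Hessians is the Euclidean Hessian of \<open>g - f\<close> at a minimum.
\<close>
lemma space_derivatives_at_touching:
  assumes f: "twice_differentiable_at f y" and g: "twice_differentiable_at g y"
    and le: "\<forall>\<^sub>F z in nhds y. f z \<le> g z" and eq: "f y = g y"
  shows "partial i f y = partial i g y"
    and "v \<bullet> ((hessian G g y - hessian G f y) *v v) \<ge> 0"
proof -
  have "\<forall>\<^sub>F z in nhds y. f differentiable (at z) \<and> g differentiable (at z) \<and> f z \<le> g z"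
    using f g le unfolding twice_differentiable_at_def by (simp add: eventually_conj_iff)
  then obtain d where d: "d > 0" "\<And>z. z \<in> ball y d \<Longrightarrow> f differentiable (at z)"
    "\<And>z. z \<in> ball y d \<Longrightarrow> g differentiable (at z)" "\<And>z. z \<in> ball y d \<Longrightarrow> f z \<le> g z"
    unfolding eventually_nhds_metric by (auto simp: dist_commute)
  let ?D = "\<lambda>z h. (\<Sum>i\<in>UNIV. h $ i * partial i g z) - (\<Sum>i\<in>UNIV. h $ i * partial i f z)"
  have D: "((\<lambda>z. g z - f z) has_derivative ?D z) (at z)" if "z \<in> ball y d" for z
    using d that by (intro has_derivative_diff has_derivative_partials) auto
  have y: "y \<in> ball y d" using d by simp
  have "?D y = (\<lambda>_. 0)"
    by (rule differential_zero_maxmin[OF y open_ball D[OF y]]) (use d eq in auto)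
  then have "?D y (axis i 1) = 0" for i by metis
  then show p: "partial i f y = partial i g y" for i by (simp add: sum_axis_mult)
  let ?D2 = "\<lambda>h. (\<Sum>i\<in>UNIV. v $ i * (\<Sum>j\<in>UNIV. h $ j * partial j (partial i g) y))
    - (\<Sum>i\<in>UNIV. v $ i * (\<Sum>j\<in>UNIV. h $ j * partial j (partial i f) y))"
  have "((\<lambda>z. ?D z v) has_derivative ?D2) (at y)"
    using f g unfolding twice_differentiable_at_def
    by (intro has_derivative_diff has_derivative_sum has_derivative_mult_right has_derivative_partials) auto
  then have "0 \<le> ?D2 v"
    using second_derivative_test[where g = "\<lambda>z. g z - f z" and Dg = ?D and v = v and D = ?D2, OF d(1) D]
      d(4) eq by simp
  also have "?D2 v = (\<Sum>i\<in>UNIV. \<Sum>j\<in>UNIV. v $ j * v $ i * (partial j (partial i g) y - partial j (partial i f) y))"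
    by (simp add: sum_distrib_left sum_subtractf algebra_simps)
  also have "\<dots> = (\<Sum>i\<in>UNIV. \<Sum>j\<in>UNIV. v $ i * v $ j * (partial i (partial j g) y - partial i (partial j f) y))"
    by (rule sum.swap)
  also have "\<dots> = v \<bullet> ((hessian G g y - hessian G f y) *v v)"
    unfolding bilinear_form_sum by (simp add: hessian_def p)
  finally show "v \<bullet> ((hessian G g y - hessian G f y) *v v) \<ge> 0" .
qed

section \<open>The symbol of the normalized p-Laplacian and its envelopes\<close>

lemma plap_symbol_scale:
  assumes "k \<noteq> 0"
  shows "plap_symbol p A (k *\<^sub>R e, X) = plap_symbol p A (e, X)"
  using assms by (simp add: plap_symbol_def matrix_vector_mult_scaleR mult.left_commute
      mult_divide_mult_cancel_left_if flip: mult.assoc)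

text \<open>
  The symbol is homogeneous of degree \<open>0\<close> in the gradient variable, hence constant on the line through
  \<open>e\<close> without \<open>0\<close>. That line has points of the domain arbitrarily close to \<open>k e\<close>, also when \<open>k = 0\<close>. In this
  way both envelopes are estimated at zero and nonzero gradients simultaneously.
\<close>
lemma plap_domain_near_ray:
  assumes e: "e \<noteq> 0" and X: "transpose X = X"
    and P: "eventually P (inf (nhds (k *\<^sub>R e, X)) (principal plap_domain))"
  shows "\<exists>z. P z \<and> plap_symbol p A z = plap_symbol p A (e, X)"
proof -
  have "((\<lambda>h. ((k + h) *\<^sub>R e, X)) \<longlongrightarrow> ((k + 0) *\<^sub>R e, X)) (at 0)"
    by (intro tendsto_intros)
  then have "\<forall>\<^sub>F h in at 0. ((k + h) *\<^sub>R e, X) \<in> plap_domain \<longrightarrow> P ((k + h) *\<^sub>R e, X)"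
    using eventually_compose_filterlim[OF P[unfolded eventually_inf_principal]] by simp
  moreover have "\<forall>\<^sub>F h in at (0::real). k + h \<noteq> 0"
    using eventually_neq_at_within[of "- k" 0 UNIV] by eventually_elim (simp add: add_eq_0_iff)
  ultimately have "\<forall>\<^sub>F h in at (0::real). P ((k + h) *\<^sub>R e, X) \<and> k + h \<noteq> 0"
    by eventually_elim (use e X in \<open>auto simp: plap_domain_def\<close>)
  then obtain h where "P ((k + h) *\<^sub>R e, X)" "k + h \<noteq> 0"
    using eventually_happens'[OF at_neq_bot] by blast
  then show ?thesis using plap_symbol_scale by blast
qed

lemma plap_symbol_le_plap_upper:
  assumes "e \<noteq> 0" "transpose X = X"
  shows "ereal (plap_symbol p A (e, X)) \<le> plap_upper p A (k *\<^sub>R e) X"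
  unfolding plap_upper_def usc_envelope_def
proof (rule Limsup_greatest)
  fix P assume "eventually P (inf (nhds (k *\<^sub>R e, X)) (principal plap_domain))"
  then obtain z where "P z" "plap_symbol p A z = plap_symbol p A (e, X)"
    using plap_domain_near_ray[OF assms] by blast
  then show "ereal (plap_symbol p A (e, X)) \<le> (SUP z\<in>Collect P. ereal (plap_symbol p A z))"
    by (intro SUP_upper2[of z]) auto
qed

lemma plap_lower_le_plap_symbol:
  assumes "e \<noteq> 0" "transpose X = X"
  shows "plap_lower p A (k *\<^sub>R e) X \<le> ereal (plap_symbol p A (e, X))"
  unfolding plap_lower_def lsc_envelope_def
proof (rule Liminf_least)
  fix P assume "eventually P (inf (nhds (k *\<^sub>R e, X)) (principal plap_domain))"
  then obtain z where "P z" "plap_symbol p A z = plap_symbol p A (e, X)"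
    using plap_domain_near_ray[OF assms] by blast
  then show "(INF z\<in>Collect P. ereal (plap_symbol p A z)) \<le> ereal (plap_symbol p A (e, X))"
    by (intro INF_lower2[of z]) auto
qed

lemma mat_vector_mult: "mat l *v v = l *\<^sub>R (v :: real^'n::finite)"
  by (simp add: vec_eq_iff matrix_vector_mult_def mat_def if_distrib[of "\<lambda>x. x * _"] cong: if_cong)

lemma matrix_inv_mat:
  assumes "l \<noteq> 0"
  shows "matrix_inv (mat l :: real^'n^'n::finite) = mat (1 / l)"
proof -
  have mm: "mat a ** mat b = (mat (a * b) :: real^'n^'n)" for a b
    by (simp add: vec_eq_iff matrix_matrix_mult_def mat_def if_distrib[of "\<lambda>x. x * _"] cong: if_cong)
  have "\<exists>A'. mat l ** A' = (mat 1 :: real^'n^'n) \<and> A' ** mat l = mat 1"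
    using assms by (intro exI[of _ "mat (1 / l)"]) (simp add: mm)
  then have "matrix_inv (mat l :: real^'n^'n) ** mat l = mat 1"
    unfolding matrix_inv_def by (rule someI2_ex) simp
  then have "matrix_inv (mat l :: real^'n^'n) ** mat l ** mat (1 / l) = mat (1 / l)"
    by simp
  then show ?thesis using assms by (simp add: mm flip: matrix_mul_assoc)
qed

lemma plap_symbol_conformal:
  assumes "l \<noteq> 0"
  shows "plap_symbol p (mat l) (q, X) = (trace X + (p - 2) * (q \<bullet> (X *v q)) / (q \<bullet> q)) / l"
proof -
  have "mat (1 / l) ** X = (\<chi> i. (1 / l) *\<^sub>R X $ i)"
    by (simp add: vec_eq_iff matrix_matrix_mult_def mat_def if_distrib[of "\<lambda>x. x * _"] cong: if_cong)
  then have "trace (mat (1 / l) ** X) = trace X / l"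
    by (simp add: trace_def sum_divide_distrib)
  then show ?thesis
    using assms by (simp add: plap_symbol_def matrix_inv_mat mat_vector_mult add_divide_distrib mult.commute)
qed

text \<open>
  With \<open>w\<^sub>i\<^sub>j = e\<^sub>j \<epsilon>\<^sub>i - e\<^sub>i \<epsilon>\<^sub>j\<close> for the standard basis \<open>\<epsilon>\<close>, summing \<open>Y(w\<^sub>i\<^sub>j, w\<^sub>i\<^sub>j)\<close> over all \<open>i\<close> and \<open>j\<close>
  gives twice the difference of the two sides.
\<close>
lemma quadratic_form_le_trace:
  fixes Y :: "real^'n^'n::finite"
  assumes "\<And>v. v \<bullet> (Y *v v) \<ge> 0"
  shows "e \<bullet> (Y *v e) \<le> trace Y * (e \<bullet> e)"
proof -
  define w where "w i j = e $ j *\<^sub>R axis i 1 - e $ i *\<^sub>R (axis j 1 :: real^'n)" for i j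
  have ax: "axis i 1 \<bullet> (Y *v axis j 1) = Y $ i $ j" for i j
    by (simp add: inner_axis' matrix_vector_mul_component inner_axis row_def)
  have "w i j \<bullet> (Y *v w i j) = (e $ j)\<^sup>2 * Y $ i $ i + (e $ i)\<^sup>2 * Y $ j $ j
      - e $ i * e $ j * Y $ i $ j - e $ j * e $ i * Y $ j $ i" for i j
    unfolding w_def
    by (simp add: matrix_vector_mult_diff_distrib matrix_vector_mult_scaleR inner_diff_left
        inner_diff_right ax power2_eq_square algebra_simps)
  then have "(\<Sum>i\<in>UNIV. \<Sum>j\<in>UNIV. w i j \<bullet> (Y *v w i j)) =
      (\<Sum>i\<in>UNIV. \<Sum>j\<in>UNIV. (e $ j)\<^sup>2 * Y $ i $ i) + (\<Sum>i\<in>UNIV. \<Sum>j\<in>UNIV. (e $ i)\<^sup>2 * Y $ j $ j)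
      - (\<Sum>i\<in>UNIV. \<Sum>j\<in>UNIV. e $ i * e $ j * Y $ i $ j) - (\<Sum>i\<in>UNIV. \<Sum>j\<in>UNIV. e $ j * e $ i * Y $ j $ i)"
    by (simp add: sum.distrib sum_subtractf)
  also have "(\<Sum>i\<in>UNIV. \<Sum>j\<in>UNIV. e $ j * e $ i * Y $ j $ i) = e \<bullet> (Y *v e)"
    unfolding bilinear_form_sum by (rule sum.swap)
  also have "(\<Sum>i\<in>UNIV. \<Sum>j\<in>UNIV. e $ i * e $ j * Y $ i $ j) = e \<bullet> (Y *v e)"
    unfolding bilinear_form_sum ..
  also have "(\<Sum>i\<in>UNIV. \<Sum>j\<in>UNIV. (e $ j)\<^sup>2 * Y $ i $ i) = trace Y * (e \<bullet> e)"
    by (simp add: trace_def inner_vec_def sum_product power2_eq_square mult.commute)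
  also have "(\<Sum>i\<in>UNIV. \<Sum>j\<in>UNIV. (e $ i)\<^sup>2 * Y $ j $ j) = trace Y * (e \<bullet> e)"
    by (subst mult.commute) (simp add: trace_def inner_vec_def sum_product power2_eq_square)
  finally have "2 * (trace Y * (e \<bullet> e)) - 2 * (e \<bullet> (Y *v e)) = (\<Sum>i\<in>UNIV. \<Sum>j\<in>UNIV. w i j \<bullet> (Y *v w i j))"
    by simp
  also have "\<dots> \<ge> 0" by (intro sum_nonneg assms)
  finally show ?thesis by simp
qed

text \<open>
  Degenerate ellipticity: for the nonnegative form \<open>Y = Z - X\<close> the quotient \<open>Y(e, e) / |e|\<^sup>2\<close> is at most
  the trace of \<open>Y\<close>, and its coefficient \<open>p - 2\<close> exceeds \<open>- 1\<close>.
\<close>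
lemma plap_symbol_mono:
  fixes X Z :: "real^'n^'n::finite"
  assumes "1 < p" "l > 0" and e: "e \<noteq> 0"
    and XZ: "\<And>v. v \<bullet> ((Z - X) *v v) \<ge> 0"
  shows "plap_symbol p (mat l) (e, X) \<le> plap_symbol p (mat l) (e, Z)"
proof -
  have ee: "e \<bullet> e > 0" using e by simp
  let ?a = "e \<bullet> ((Z - X) *v e) / (e \<bullet> e)"
  have "?a \<le> trace (Z - X)"
    using quadratic_form_le_trace[of "Z - X" e] XZ ee by (simp add: divide_le_eq)
  moreover have "0 \<le> ?a" using XZ ee by simp
  moreover have "- ?a \<le> (p - 2) * ?a"
    using mult_right_mono[of "-1" "p - 2" ?a] \<open>1 < p\<close> \<open>0 \<le> ?a\<close> by simp
  ultimately have "0 \<le> trace (Z - X) + (p - 2) * ?a" by linarith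
  also have "\<dots> = (trace Z + (p - 2) * (e \<bullet> (Z *v e)) / (e \<bullet> e)) - (trace X + (p - 2) * (e \<bullet> (X *v e)) / (e \<bullet> e))"
    by (simp add: trace_sub matrix_vector_mult_diff_rdistrib inner_diff_right field_simps diff_divide_distrib)
  finally show ?thesis
    using \<open>l > 0\<close> by (simp add: plap_symbol_conformal divide_right_mono)
qed


section \<open>Classical solutions are viscosity solutions\<close>

text \<open>
  Where the gradient is nonzero, \<open>e\<close> is one of its multiples and the equation is the usual one. Where it
  vanishes the symbol is undefined, and it suffices that some direction \<open>e\<close> produces the right value:
  that value lies between the two envelopes.
\<close>
definition classical_solution_at ::
  "real \<Rightarrow> (real^'n::finite \<Rightarrow> real^'n^'n) \<Rightarrow> ((real^'n) \<times> real \<Rightarrow> real) \<Rightarrow> real^'n \<Rightarrow> real \<Rightarrow> bool" where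
  "classical_solution_at p G f y t \<longleftrightarrow>
     twice_differentiable_at (\<lambda>z. f (z, t)) y \<and>
     (\<exists>e k ft. e \<noteq> 0 \<and> grad G (\<lambda>z. f (z, t)) y = k *\<^sub>R e \<and>
        ((\<lambda>s. f (y, s)) has_real_derivative ft) (at t) \<and>
        ft = plap_symbol p (G y) (e, hessian G (\<lambda>z. f (z, t)) y))"

lemma riemannian_manifold_chartD:
  assumes "riemannian_manifold M" "c \<in> atlas M"
  shows "openin (top_of M) (fst c)" "open (snd c ` fst c)" "fst c \<subseteq> points M"
    and "inj_on (snd c) (fst c)"
    and "continuous_map (top_of_set (snd c ` fst c)) (top_of M) (chart_inv c)"
proof -
  obtain U h where c: "c = (U, h)" by (cases c)
  have o: "openin (top_of M) U" "open (h ` U)"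
    and hom: "homeomorphic_map (subtopology (top_of M) U) (top_of_set (h ` U)) h"
    using assms unfolding riemannian_manifold_def c by auto
  have U: "U \<subseteq> points M" using o openin_subset by blast
  obtain g where g: "homeomorphic_maps (subtopology (top_of M) U) (top_of_set (h ` U)) h g"
    using hom homeomorphic_map_maps by blast
  have gh: "\<And>x. x \<in> U \<Longrightarrow> g (h x) = x"
    and cont: "continuous_map (top_of_set (h ` U)) (subtopology (top_of M) U) g"
    using g U unfolding homeomorphic_maps_def by (auto simp: Int_absorb1)
  have inj: "inj_on h U" by (metis gh inj_onI)
  have "continuous_map (top_of_set (h ` U)) (top_of M) g"
    using cont continuous_map_in_subtopology by blast
  moreover have "g y = inv_into U h y" if "y \<in> h ` U" for y
    using that gh inj by auto
  ultimately have "continuous_map (top_of_set (h ` U)) (top_of M) (chart_inv c)"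
    unfolding chart_inv_def c by (auto elim: continuous_map_eq)
  then show "openin (top_of M) (fst c)" "open (snd c ` fst c)" "fst c \<subseteq> points M"
    "inj_on (snd c) (fst c)" "continuous_map (top_of_set (snd c ` fst c)) (top_of M) (chart_inv c)"
    using o U inj by (auto simp: c)
qed

lemma chart_image_eq:
  assumes "riemannian_manifold M" "c \<in> atlas M"
  shows "chart_image c N = {w \<in> (snd c ` fst c) \<times> UNIV. (chart_inv c (fst w), snd w) \<in> N}"
  using riemannian_manifold_chartD(4)[OF assms]
  by (auto simp: chart_image_def chart_inv_def image_iff inv_into_into f_inv_into_f)

lemma open_chart_image:
  assumes "riemannian_manifold M" "c \<in> atlas M" "openin (spacetime M) N"
  shows "open (chart_image c N)"
proof -
  note D = riemannian_manifold_chartD[OF assms(1,2)]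
  let ?W = "snd c ` fst c"
  have "continuous_map (prod_topology (top_of_set ?W) euclideanreal) (spacetime M) (\<lambda>w. (chart_inv c (fst w), snd w))"
    by (intro continuous_map_pairedI continuous_map_compose[OF continuous_map_fst D(5), unfolded o_def] continuous_map_snd)
  then have "openin (prod_topology (top_of_set ?W) euclideanreal) {w \<in> ?W \<times> UNIV. (chart_inv c (fst w), snd w) \<in> N}"
    using assms(3) by (auto simp: continuous_map_def)
  moreover have "prod_topology (top_of_set ?W) euclideanreal = top_of_set (?W \<times> (UNIV :: real set))"
    by (simp add: prod_topology_subtopology)
  ultimately have "openin (top_of_set (?W \<times> (UNIV :: real set))) (chart_image c N)"
    unfolding chart_image_eq[OF assms(1,2)] by simp
  then show ?thesis
    using D(2) by (intro openin_open_trans[OF _ open_Times]) auto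
qed

text \<open>
  Either of \<open>f\<close> and \<open>g\<close> may be the test function, so that subsolutions and supersolutions are treated
  by the same lemma.
\<close>
lemma touching_in_chart:
  assumes M: "riemannian_manifold M" and c: "c \<in> atlas M" "x \<in> fst c"
    and N: "openin (spacetime M) N" "(x, t) \<in> N"
    and le: "\<And>w. w \<in> N \<Longrightarrow> f w \<le> g w" and eq: "f (x, t) = g (x, t)"
    and cl: "classical_solution_at p (metric M c) (in_chart c f) (snd c x) t \<and> C21_fun M N g
           \<or> classical_solution_at p (metric M c) (in_chart c g) (snd c x) t \<and> C21_fun M N f"
  shows "twice_differentiable_at (\<lambda>z. in_chart c f (z, t)) (snd c x)"
    and "twice_differentiable_at (\<lambda>z. in_chart c g (z, t)) (snd c x)"
    and "grad_at M c f x t = grad_at M c g x t"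
    and "v \<bullet> ((hessian_at M c g x t - hessian_at M c f x t) *v v) \<ge> 0"
    and "time_deriv f x t = time_deriv g x t"
proof -
  let ?O = "chart_image c N" and ?y = "snd c x"
  have O: "open ?O" by (rule open_chart_image[OF M c(1) N(1)])
  have inv: "chart_inv c ?y = x"
    using riemannian_manifold_chartD(4)[OF M c(1)] c(2) by (simp add: chart_inv_def)
  have yt: "(?y, t) \<in> ?O" using c N by (force simp: chart_image_def)
  have leO: "in_chart c f w \<le> in_chart c g w" if "w \<in> ?O" for w
    using that le unfolding chart_image_eq[OF M c(1)] in_chart_def by (auto split: prod.splits)
  have eqy: "in_chart c f (?y, t) = in_chart c g (?y, t)"
    using eq inv by (simp add: in_chart_def)
  have evO: "\<forall>\<^sub>F w in nhds (?y, t). w \<in> ?O" using O yt by (rule eventually_nhds_in_open)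
  have evx: "\<forall>\<^sub>F z in nhds ?y. (z, t) \<in> ?O"
    by (rule eventually_compose_filterlim[OF evO]) (intro filterlim_ident tendsto_Pair tendsto_const)
  have evt: "\<forall>\<^sub>F s in nhds t. (?y, s) \<in> ?O"
    by (rule eventually_compose_filterlim[OF evO]) (intro filterlim_ident tendsto_Pair tendsto_const)
  have reg: "twice_differentiable_at (\<lambda>z. in_chart c h (z, t)) ?y \<and>
      (\<exists>d. ((\<lambda>s. in_chart c h (?y, s)) has_real_derivative d) (at t))"
    if "classical_solution_at p (metric M c) (in_chart c h) ?y t \<or> C21_fun M N h" for h
    using that
  proof
    assume "C21_fun M N h"
    then have h: "C21_on (in_chart c h) ?O" using c by (simp add: C21_fun_def)
    have "\<forall>\<^sub>F z in nhds ?y. (\<lambda>z. in_chart c h (z, t)) differentiable (at z)"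
      using evx by eventually_elim (use h in \<open>auto simp: C21_on_def\<close>)
    moreover have "partial i (\<lambda>z. in_chart c h (z, t)) differentiable (at ?y)" for i
      using h yt by (auto simp: C21_on_def)
    moreover have "(\<lambda>s. in_chart c h (?y, s)) differentiable (at t)"
      using h yt by (auto simp: C21_on_def)
    ultimately show ?thesis
      unfolding twice_differentiable_at_def real_differentiable_def by simp
  next
    assume "classical_solution_at p (metric M c) (in_chart c h) ?y t"
    then show ?thesis unfolding classical_solution_at_def by metis
  qed
  have rf: "classical_solution_at p (metric M c) (in_chart c f) ?y t \<or> C21_fun M N f"
    and rg: "classical_solution_at p (metric M c) (in_chart c g) ?y t \<or> C21_fun M N g"
    using cl by blast+
  have f: "twice_differentiable_at (\<lambda>z. in_chart c f (z, t)) ?y"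
    and g: "twice_differentiable_at (\<lambda>z. in_chart c g (z, t)) ?y"
    using reg[OF rf] reg[OF rg] by simp_all
  then show "twice_differentiable_at (\<lambda>z. in_chart c f (z, t)) ?y"
    "twice_differentiable_at (\<lambda>z. in_chart c g (z, t)) ?y" by simp_all
  have "\<forall>\<^sub>F z in nhds ?y. in_chart c f (z, t) \<le> in_chart c g (z, t)"
    using evx by eventually_elim (rule leO)
  note sd = space_derivatives_at_touching[OF f g this eqy]
  show "grad_at M c f x t = grad_at M c g x t"
    by (simp add: grad_at_def grad_def sd(1))
  show "v \<bullet> ((hessian_at M c g x t - hessian_at M c f x t) *v v) \<ge> 0"
    unfolding hessian_at_def by (rule sd(2))
  obtain df dg where df: "((\<lambda>s. in_chart c f (?y, s)) has_real_derivative df) (at t)"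
    and dg: "((\<lambda>s. in_chart c g (?y, s)) has_real_derivative dg) (at t)"
    using reg[OF rf] reg[OF rg] by metis
  have "\<forall>\<^sub>F s in nhds t. in_chart c f (?y, s) \<le> in_chart c g (?y, s)"
    using evt by eventually_elim (rule leO)
  then obtain r where r: "r > 0" "\<And>s. dist s t < r \<Longrightarrow> in_chart c f (?y, s) \<le> in_chart c g (?y, s)"
    unfolding eventually_nhds_metric by blast
  have "dg - df = 0"
    by (rule DERIV_local_min[OF DERIV_diff[OF dg df] r(1)]) (use r eqy in \<open>auto simp: dist_real_def abs_minus_commute\<close>)
  then show "time_deriv f x t = time_deriv g x t"
    using DERIV_imp_deriv[OF df] DERIV_imp_deriv[OF dg] unfolding time_deriv_def
    by (simp add: in_chart_def inv)
qed

text \<open>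
  The time derivative of a test function \<open>\<phi>\<close> equals that of \<open>u\<close>, which is the symbol at \<open>(e, X)\<close> with
  \<open>X\<close> the Hessian of \<open>u\<close>. Ellipticity compares it with the symbol at \<open>(e, X')\<close> with \<open>X'\<close> the Hessian of
  \<open>\<phi>\<close>, and that value is estimated by the envelope because the gradient of \<open>\<phi>\<close> is a multiple of \<open>e\<close>.
\<close>
theorem viscosity_solution_if_classical:
  fixes M :: "('a, 'n::finite) manifold"
  assumes p: "1 < p" and M: "riemannian_manifold M"
    and conf: "\<And>c. c \<in> atlas M \<Longrightarrow> metric M c = (\<lambda>y. mat (l c y))"
    and cont: "continuous_map (subtopology (spacetime M) (cylinder M T)) euclideanreal u"
    and cl: "\<And>c y t. c \<in> atlas M \<Longrightarrow> y \<in> snd c ` fst c \<Longrightarrow> 0 < t \<Longrightarrow> ereal t < T \<Longrightarrow>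
      classical_solution_at p (metric M c) (in_chart c u) y t"
  shows "viscosity_solution p M T u"
proof -
  have lpos: "l c (snd c x) > 0" if "c \<in> atlas M" "x \<in> fst c" for c x
  proof -
    have "\<forall>y\<in>snd c ` fst c. \<forall>\<xi>. \<xi> \<noteq> 0 \<longrightarrow> \<xi> \<bullet> (metric M c y *v \<xi>) > 0"
      using M that unfolding riemannian_manifold_def by blast
    then have "axis undefined 1 \<bullet> (metric M c (snd c x) *v axis undefined (1::real)) > 0"
      using that by (auto simp: axis_eq_0_iff)
    then show ?thesis using conf[OF that(1)] by (simp add: mat_vector_mult inner_axis_axis)
  qed
  have key: "\<exists>e k. e \<noteq> 0 \<and> grad_at M c u x t = k *\<^sub>R e \<and>
      time_deriv u x t = plap_symbol p (metric M c (snd c x)) (e, hessian_at M c u x t)"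
    if c: "c \<in> atlas M" "x \<in> fst c" and t: "0 < t" "ereal t < T" for c x t
  proof -
    have inv: "chart_inv c (snd c x) = x"
      using riemannian_manifold_chartD(4)[OF M c(1)] c(2) by (simp add: chart_inv_def)
    obtain e k ft where *: "e \<noteq> 0" "grad (metric M c) (\<lambda>z. in_chart c u (z, t)) (snd c x) = k *\<^sub>R e"
      "((\<lambda>s. in_chart c u (snd c x, s)) has_real_derivative ft) (at t)"
      "ft = plap_symbol p (metric M c (snd c x)) (e, hessian (metric M c) (\<lambda>z. in_chart c u (z, t)) (snd c x))"
      using cl[OF c(1) imageI[OF c(2)] t] unfolding classical_solution_at_def by blast
    have "time_deriv u x t = ft"
      using DERIV_imp_deriv[OF *(3)] by (simp add: time_deriv_def in_chart_def inv)
    then show ?thesis using * unfolding grad_at_def hessian_at_def by blast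
  qed
  have sym: "transpose (hessian_at M c \<phi> x t) = hessian_at M c \<phi> x t"
    if "c \<in> atlas M" "twice_differentiable_at (\<lambda>z. in_chart c \<phi> (z, t)) (snd c x)" for c \<phi> x t
    unfolding hessian_at_def
    by (rule hessian_symmetric[OF that(2)]) (simp add: conf[OF that(1)] mat_def)
  have "usc_map (subtopology (spacetime M) (cylinder M T)) u" "lsc_map (subtopology (spacetime M) (cylinder M T)) u"
    unfolding usc_map_def lsc_map_def
    using cont openin_continuous_map_preimage[OF cont, of "{..<_}"] openin_continuous_map_preimage[OF cont, of "{_<..}"]
    by (simp_all add: open_openin[symmetric])
  moreover have "ereal (time_deriv \<phi> x t) \<le> plap_upper p (metric M c (snd c x)) (grad_at M c \<phi> x t) (hessian_at M c \<phi> x t)"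
    if touch: "touches_above M T N \<phi> u (x, t)" and \<phi>: "C21_fun M N \<phi>" and c: "c \<in> atlas M" "x \<in> fst c" for N \<phi> x t c
  proof -
    have N: "openin (spacetime M) N" "(x, t) \<in> N" and t: "0 < t" "ereal t < T"
      and le: "\<And>w. w \<in> N \<Longrightarrow> u w \<le> \<phi> w" and eq: "u (x, t) = \<phi> (x, t)"
      using touch by (auto simp: touches_above_def cylinder_def)
    have "classical_solution_at p (metric M c) (in_chart c u) (snd c x) t"
      using cl c t by blast
    then have cl': "classical_solution_at p (metric M c) (in_chart c u) (snd c x) t \<and> C21_fun M N \<phi>
      \<or> classical_solution_at p (metric M c) (in_chart c \<phi>) (snd c x) t \<and> C21_fun M N u" using \<phi> by blast
    note tc = touching_in_chart[OF M c N le eq cl']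
    have td: "time_deriv \<phi> x t = time_deriv u x t" by (rule tc(5)[symmetric])
    obtain e k where e: "e \<noteq> 0" "grad_at M c u x t = k *\<^sub>R e"
      and ft: "time_deriv u x t = plap_symbol p (metric M c (snd c x)) (e, hessian_at M c u x t)"
      using key[OF c t] by blast
    have gd: "grad_at M c \<phi> x t = k *\<^sub>R e" using tc(3) e(2) by simp
    have "time_deriv \<phi> x t \<le> plap_symbol p (metric M c (snd c x)) (e, hessian_at M c \<phi> x t)"
      unfolding td ft unfolding conf[OF c(1)]
      by (rule plap_symbol_mono[OF p lpos[OF c] e(1) tc(4)])
    also have "ereal (plap_symbol p (metric M c (snd c x)) (e, hessian_at M c \<phi> x t))
        \<le> plap_upper p (metric M c (snd c x)) (grad_at M c \<phi> x t) (hessian_at M c \<phi> x t)"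
      unfolding gd by (rule plap_symbol_le_plap_upper[OF e(1) sym[OF c(1) tc(2)]])
    finally show ?thesis by simp
  qed
  moreover have "plap_lower p (metric M c (snd c x)) (grad_at M c \<phi> x t) (hessian_at M c \<phi> x t) \<le> ereal (time_deriv \<phi> x t)"
    if touch: "touches_below M T N \<phi> u (x, t)" and \<phi>: "C21_fun M N \<phi>" and c: "c \<in> atlas M" "x \<in> fst c" for N \<phi> x t c
  proof -
    have N: "openin (spacetime M) N" "(x, t) \<in> N" and t: "0 < t" "ereal t < T"
      and le: "\<And>w. w \<in> N \<Longrightarrow> \<phi> w \<le> u w" and eq: "\<phi> (x, t) = u (x, t)"
      using touch by (auto simp: touches_below_def cylinder_def)
    have "classical_solution_at p (metric M c) (in_chart c u) (snd c x) t"
      using cl c t by blast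
    then have cl': "classical_solution_at p (metric M c) (in_chart c \<phi>) (snd c x) t \<and> C21_fun M N u
      \<or> classical_solution_at p (metric M c) (in_chart c u) (snd c x) t \<and> C21_fun M N \<phi>" using \<phi> by blast
    note tc = touching_in_chart[OF M c N le eq cl']
    have td: "time_deriv \<phi> x t = time_deriv u x t" by (rule tc(5))
    obtain e k where e: "e \<noteq> 0" "grad_at M c u x t = k *\<^sub>R e"
      and ft: "time_deriv u x t = plap_symbol p (metric M c (snd c x)) (e, hessian_at M c u x t)"
      using key[OF c t] by blast
    have gd: "grad_at M c \<phi> x t = k *\<^sub>R e" using tc(3) e(2) by simp
    have "plap_lower p (metric M c (snd c x)) (grad_at M c \<phi> x t) (hessian_at M c \<phi> x t)
        \<le> ereal (plap_symbol p (metric M c (snd c x)) (e, hessian_at M c \<phi> x t))"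
      unfolding gd by (rule plap_lower_le_plap_symbol[OF e(1) sym[OF c(1) tc(1)]])
    also have "plap_symbol p (metric M c (snd c x)) (e, hessian_at M c \<phi> x t) \<le> time_deriv \<phi> x t"
      unfolding td ft unfolding conf[OF c(1)]
      by (rule plap_symbol_mono[OF p lpos[OF c] e(1) tc(4)])
    finally show ?thesis by simp
  qed
  ultimately show ?thesis
    using cont unfolding viscosity_solution_def viscosity_subsolution_def viscosity_supersolution_def by blast
qed

section \<open>Radial functions for rotationally symmetric conformal metrics\<close>

lemma radial_partial:
  fixes z :: "real^'n::finite"
  assumes "(F has_real_derivative d) (at (z \<bullet> z))"
  shows "((\<lambda>z. F (z \<bullet> z)) has_derivative (\<lambda>h. d * (2 * (z \<bullet> h)))) (at z)"
    and "partial i (\<lambda>z. F (z \<bullet> z)) z = 2 * d * z $ i"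
proof -
  have "((\<lambda>z. z \<bullet> z) has_derivative (\<lambda>h. 2 * (z \<bullet> h))) (at z)"
    by (auto intro!: derivative_eq_intros simp: inner_commute)
  from has_derivative_compose[OF this assms[unfolded has_field_derivative_def]]
  show D: "((\<lambda>z. F (z \<bullet> z)) has_derivative (\<lambda>h. d * (2 * (z \<bullet> h)))) (at z)" .
  show "partial i (\<lambda>z. F (z \<bullet> z)) z = 2 * d * z $ i"
    using partial_eqI[OF D] by (simp add: inner_axis)
qed

lemma radial_second_partial:
  fixes y :: "real^'n::finite"
  assumes F: "\<And>r. r \<ge> 0 \<Longrightarrow> (F has_real_derivative F1 r) (at r)"
    and F1: "(F1 has_real_derivative d) (at (y \<bullet> y))"
  shows "twice_differentiable_at (\<lambda>z. F (z \<bullet> z)) y"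
    and "partial i (partial j (\<lambda>z. F (z \<bullet> z))) y
           = 4 * d * y $ i * y $ j + (if i = j then 2 * F1 (y \<bullet> y) else 0)"
proof -
  have p: "partial j (\<lambda>z::real^'n. F (z \<bullet> z)) = (\<lambda>z. 2 * (F1 (z \<bullet> z) * z $ j))" for j
    by (rule ext) (simp add: radial_partial(2)[OF F] mult.assoc)
  have D: "(partial j (\<lambda>z. F (z \<bullet> z)) has_derivative
      (\<lambda>h. 2 * (F1 (y \<bullet> y) * h $ j + d * (2 * (y \<bullet> h)) * y $ j))) (at y)" for j
    unfolding p
    by (intro has_derivative_mult_right has_derivative_mult radial_partial(1)[OF F1]
        bounded_linear_imp_has_derivative bounded_linear_vec_nth)
  show "twice_differentiable_at (\<lambda>z. F (z \<bullet> z)) y"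
    unfolding twice_differentiable_at_def
    by (intro conjI allI always_eventually differentiableI[OF D] differentiableI[OF radial_partial(1)[OF F]]) simp
  show "partial i (partial j (\<lambda>z. F (z \<bullet> z))) y
      = 4 * d * y $ i * y $ j + (if i = j then 2 * F1 (y \<bullet> y) else 0)"
    unfolding partial_eqI[OF D] by (simp add: inner_axis) (auto simp: axis_def)
qed

lemma if_zero_mult:
  "(if c then x else 0) * y = (if c then x * y else (0::real))"
  "y * (if c then x else 0) = (if c then y * x else (0::real))"
  by simp_all

lemma sum_if_const: "(\<Sum>m\<in>A. if c then f m else (0::real)) = (if c then sum f A else 0)"
  by simp

lemma sum_matrix_inv_mat:
  fixes f :: "'n::finite \<Rightarrow> real"
  assumes "l \<noteq> 0"
  shows "(\<Sum>j\<in>UNIV. matrix_inv (mat l :: real^'n^'n) $ k $ j * f j) = f k / l"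
  unfolding matrix_inv_mat[OF assms] by (simp add: mat_def if_zero_mult)

text \<open>
  For a metric \<open>e\<^sup>2\<^sup>f \<delta>\<close> the Christoffel symbols are \<open>\<delta>\<^sub>j\<^sub>k f\<^sub>i + \<delta>\<^sub>i\<^sub>k f\<^sub>j - \<delta>\<^sub>i\<^sub>j f\<^sub>k\<close>; here \<open>f\<close> is half the
  logarithm of \<open>L\<close>, whose gradient at \<open>y\<close> is \<open>\<beta> y\<close>.
\<close>
lemma christoffel_radial_conformal:
  fixes y :: "real^'n::finite"
  assumes "(L has_real_derivative d) (at (y \<bullet> y))" and L: "L (y \<bullet> y) \<noteq> 0"
    and \<beta>: "\<beta> = d / L (y \<bullet> y)"
  shows "christoffel (\<lambda>z. mat (L (z \<bullet> z))) k i j y =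
    (if j = k then \<beta> * y $ i else 0) + (if i = k then \<beta> * y $ j else 0) - (if i = j then \<beta> * y $ k else 0)"
proof -
  have p: "partial i (\<lambda>z::real^'n. mat (L (z \<bullet> z)) $ j $ k) y = (if j = k then 2 * d * y $ i else 0)" for i j k
  proof (cases "j = k")
    case True
    then show ?thesis using radial_partial(2)[OF assms(1)] by (simp add: mat_def)
  next
    case False
    then show ?thesis by (simp add: mat_def partial_def)
  qed
  show ?thesis
    unfolding christoffel_def sum_matrix_inv_mat[OF L] \<beta>
    using L by (simp add: p field_simps)
qed

text \<open>
  In polar terms the Hessian of a radial function is \<open>A y y\<^sup>T + B I\<close>: it has the value \<open>A \<rho> + B\<close> in the
  radial direction and \<open>B\<close> in the \<open>n - 1\<close> others, so the symbol is \<open>((p - 1) (A \<rho> + B) + (n - 1) B) / L\<close>.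
  At the origin the two values coincide, and any unit vector may take the place of the radial
  direction.
\<close>
theorem radial_classical_solution:
  fixes f :: "(real^'n::finite) \<times> real \<Rightarrow> real"
  assumes f: "\<And>z. f (z, t) = F (z \<bullet> z)"
    and F: "\<And>r. r \<ge> 0 \<Longrightarrow> (F has_real_derivative dF r) (at r)"
    and dF: "(dF has_real_derivative ddF) (at \<rho>)"
    and \<rho>: "\<rho> = y \<bullet> y"
    and L: "(L has_real_derivative d) (at \<rho>)" "L \<rho> \<noteq> 0" and \<beta>: "\<beta> = d / L \<rho>"
    and ft: "((\<lambda>s. f (y, s)) has_real_derivative
      ((p - 1) * (4 * \<rho> * ddF + 2 * dF \<rho> - 2 * \<beta> * \<rho> * dF \<rho>)
         + (real CARD('n) - 1) * (2 * dF \<rho> + 2 * \<beta> * \<rho> * dF \<rho>)) / L \<rho>) (at t)"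
  shows "classical_solution_at p (\<lambda>z. mat (L (z \<bullet> z))) f y t"
proof -
  let ?G = "\<lambda>z::real^'n. mat (L (z \<bullet> z)) :: real^'n^'n"
  define A B where "A = 4 * ddF - 4 * \<beta> * dF \<rho>" and "B = 2 * dF \<rho> + 2 * \<beta> * \<rho> * dF \<rho>"
  define e :: "real^'n" where "e = (if y = 0 then axis undefined 1 else y)"
  have e: "e \<noteq> 0" by (simp add: e_def axis_eq_0_iff)
  define f1 where "f1 = dF \<rho>"
  have slice: "(\<lambda>z. f (z, t)) = (\<lambda>z. F (z \<bullet> z))" using f by auto
  have p1: "partial i (\<lambda>z. F (z \<bullet> z)) y = 2 * dF \<rho> * y $ i" for i
    unfolding \<rho> by (rule radial_partial(2)[OF F]) simp
  have "grad ?G (\<lambda>z. F (z \<bullet> z)) y = (2 * dF \<rho> / L \<rho>) *\<^sub>R y"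
    using L(2) by (simp add: grad_def p1 matrix_inv_mat mat_vector_mult vec_eq_iff flip: \<rho>)
  also have "\<dots> = (if y = 0 then 0 else 2 * dF \<rho> / L \<rho>) *\<^sub>R e" by (simp add: e_def)
  finally have gr: "grad ?G (\<lambda>z. F (z \<bullet> z)) y = (if y = 0 then 0 else 2 * dF \<rho> / L \<rho>) *\<^sub>R e" .
  have hess: "hessian ?G (\<lambda>z. F (z \<bullet> z)) y $ i $ j = A * y $ i * y $ j + (if i = j then B else 0)" for i j
  proof -
    have ch: "christoffel ?G k i j y =
        (if j = k then \<beta> * y $ i else 0) + (if i = k then \<beta> * y $ j else 0) - (if i = j then \<beta> * y $ k else 0)" for k
      using christoffel_radial_conformal[of L d y] L \<beta> by (simp add: \<rho>)
    have sm: "(\<Sum>k\<in>UNIV. christoffel ?G k i j y * partial k (\<lambda>z. F (z \<bullet> z)) y)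
        = 4 * \<beta> * dF \<rho> * y $ i * y $ j - (if i = j then 2 * \<beta> * dF \<rho> * \<rho> else 0)"
      unfolding ch p1 f1_def[symmetric] unfolding \<rho> inner_vec_def
      by (simp add: if_zero_mult algebra_simps sum.distrib sum_subtractf sum_if_const sum_distrib_left)
    have "hessian ?G (\<lambda>z. F (z \<bullet> z)) y $ i $ j = 4 * ddF * y $ i * y $ j + (if i = j then 2 * dF (y \<bullet> y) else 0)
        - (4 * \<beta> * dF \<rho> * y $ i * y $ j - (if i = j then 2 * \<beta> * dF \<rho> * \<rho> else 0))"
      unfolding hessian_def vec_lambda_beta sm
      by (subst radial_second_partial(2)[OF F dF[unfolded \<rho>]]) auto
    then show ?thesis by (simp add: A_def B_def algebra_simps flip: \<rho>)
  qed
  have tr: "trace (hessian ?G (\<lambda>z. F (z \<bullet> z)) y) = A * \<rho> + real CARD('n) * B"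
    unfolding trace_def hess unfolding \<rho> inner_vec_def by (simp add: sum.distrib sum_distrib_left mult.assoc)
  have "e \<bullet> (hessian ?G (\<lambda>z. F (z \<bullet> z)) y *v e) = (\<Sum>i\<in>UNIV. \<Sum>j\<in>UNIV. e $ i * e $ j * (A * y $ i * y $ j + (if i = j then B else 0)))"
    unfolding bilinear_form_sum hess ..
  also have "\<dots> = A * ((e \<bullet> y) * (e \<bullet> y)) + B * (e \<bullet> e)"
    unfolding inner_vec_def sum_product
    by (simp add: algebra_simps sum.distrib sum_distrib_left if_zero_mult)
  also have "\<dots> = (A * \<rho> + B) * (e \<bullet> e)"
    by (simp add: e_def \<rho> algebra_simps)
  finally have "e \<bullet> (hessian ?G (\<lambda>z. F (z \<bullet> z)) y *v e) / (e \<bullet> e) = A * \<rho> + B"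
    using e by simp
  then have "plap_symbol p (?G y) (e, hessian ?G (\<lambda>z. F (z \<bullet> z)) y)
      = ((A * \<rho> + real CARD('n) * B) + (p - 2) * (A * \<rho> + B)) / L \<rho>"
    using L(2) by (simp add: plap_symbol_conformal tr flip: \<rho> times_divide_eq_right)
  also have "\<dots> = ((p - 1) * (4 * \<rho> * ddF + 2 * dF \<rho> - 2 * \<beta> * \<rho> * dF \<rho>)
         + (real CARD('n) - 1) * (2 * dF \<rho> + 2 * \<beta> * \<rho> * dF \<rho>)) / L \<rho>"
    by (simp add: A_def B_def algebra_simps)
  finally have sym: "\<dots> = plap_symbol p (?G y) (e, hessian ?G (\<lambda>z. F (z \<bullet> z)) y)" by simp
  show ?thesis
    unfolding classical_solution_at_def slice
    using e gr ft sym radial_second_partial(1)[OF F dF[unfolded \<rho>]] by metis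
qed

text \<open>
  This is \<open>Ric = (n - 1) g\<close> in stereographic coordinates. With \<open>b = df\<close> for the conformal exponent \<open>f\<close>,
  the general formula is
  \<open>Ric\<^sub>j\<^sub>k = (2 - n) (\<partial>\<^sub>j b\<^sub>k - b\<^sub>j b\<^sub>k) - \<delta>\<^sub>j\<^sub>k (div b + (n - 2) |b|\<^sup>2)\<close>, and for the stereographic factor
  \<open>\<partial>\<^sub>j b\<^sub>k - b\<^sub>j b\<^sub>k\<close> is a multiple of \<open>\<delta>\<^sub>j\<^sub>k\<close>.
\<close>
lemma ricci_stereographic:
  fixes y :: "real^'n::finite"
  shows "ricci (\<lambda>z. mat (4 / (1 + z \<bullet> z)\<^sup>2)) j k y =
    (if j = k then (real CARD('n) - 1) * 4 / (1 + y \<bullet> y)\<^sup>2 else 0)"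
proof -
  let ?G = "\<lambda>z::real^'n. mat (4 / (1 + z \<bullet> z)\<^sup>2) :: real^'n^'n"
  define \<beta> where "\<beta> r = - 2 / (1 + r)" for r :: real
  have pos: "1 + z \<bullet> z > 0" for z :: "real^'n" by (simp add: add_pos_nonneg)
  have ch: "christoffel ?G k i j z =
      (if j = k then \<beta> (z \<bullet> z) * z $ i else 0) + (if i = k then \<beta> (z \<bullet> z) * z $ j else 0)
      - (if i = j then \<beta> (z \<bullet> z) * z $ k else 0)" for k i j z
  proof (rule christoffel_radial_conformal)
    show "((\<lambda>r. 4 / (1 + r)\<^sup>2) has_real_derivative - 8 / (1 + z \<bullet> z)^3) (at (z \<bullet> z))"
      using pos[of z] by (auto intro!: derivative_eq_intros simp: divide_simps power2_eq_square power3_eq_cube)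
    show "4 / (1 + z \<bullet> z)\<^sup>2 \<noteq> 0" using pos[of z] by simp
    show "\<beta> (z \<bullet> z) = - 8 / (1 + z \<bullet> z)^3 / (4 / (1 + z \<bullet> z)\<^sup>2)"
    proof -
      have "- 2 / w = - 8 / w^3 / (4 / w\<^sup>2)" if "w > 0" for w :: real
        using that by (simp add: field_simps power2_eq_square power3_eq_cube)
      then show ?thesis using pos[of z] by (simp add: \<beta>_def)
    qed
  qed
  define b where "b i = \<beta> (y \<bullet> y) * y $ i" for i
  define D where "D i j = (if i = j then \<beta> (y \<bullet> y) else 0) + b i * b j" for i j
  have db: "((\<lambda>z. \<beta> (z \<bullet> z) * z $ j) has_derivative (\<lambda>h. \<beta> (y \<bullet> y) * h $ j + b j * \<beta> (y \<bullet> y) * (y \<bullet> h))) (at y)" for j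
  proof -
    have "(\<beta> has_real_derivative 2 / (1 + y \<bullet> y)\<^sup>2) (at (y \<bullet> y))"
      unfolding \<beta>_def using pos[of y] by (auto intro!: derivative_eq_intros simp: field_simps power2_eq_square)
    from radial_partial(1)[OF this]
    have "((\<lambda>z. \<beta> (z \<bullet> z) * z $ j) has_derivative (\<lambda>h. \<beta> (y \<bullet> y) * h $ j + 2 / (1 + y \<bullet> y)\<^sup>2 * (2 * (y \<bullet> h)) * y $ j)) (at y)"
      by (intro has_derivative_mult bounded_linear_imp_has_derivative bounded_linear_vec_nth)
    moreover have "2 / (1 + y \<bullet> y)\<^sup>2 * (2 * (y \<bullet> h)) * y $ j = b j * \<beta> (y \<bullet> y) * (y \<bullet> h)" for h
      by (simp add: b_def \<beta>_def power2_eq_square)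
    ultimately show ?thesis by simp
  qed
  have pch: "partial m (christoffel ?G k i j) y = (if j = k then D m i else 0) + (if i = k then D m j else 0) - (if i = j then D m k else 0)"
    for m k i j
  proof -
    have hd: "((\<lambda>z. if c then \<beta> (z \<bullet> z) * z $ j else 0) has_derivative
        (\<lambda>h. if c then \<beta> (y \<bullet> y) * h $ j + b j * \<beta> (y \<bullet> y) * (y \<bullet> h) else 0)) (at y)" for c j
      using db by (cases c) auto
    have "partial m (christoffel ?G k i j) y =
       (if j = k then \<beta> (y \<bullet> y) * axis m 1 $ i + b i * \<beta> (y \<bullet> y) * (y \<bullet> axis m 1) else 0)
       + (if i = k then \<beta> (y \<bullet> y) * axis m 1 $ j + b j * \<beta> (y \<bullet> y) * (y \<bullet> axis m 1) else 0)
       - (if i = j then \<beta> (y \<bullet> y) * axis m 1 $ k + b k * \<beta> (y \<bullet> y) * (y \<bullet> axis m 1) else 0)"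
      unfolding ch by (rule partial_eqI) (intro has_derivative_diff has_derivative_add hd)
    then show ?thesis by (simp add: D_def inner_axis b_def mult.commute) (auto simp: axis_def)
  qed
  define S where "S = (\<Sum>m\<in>UNIV. b m * b m)"
  have chb: "christoffel ?G k i j y = (if j = k then b i else 0) + (if i = k then b j else 0) - (if i = j then b k else 0)" for k i j
    unfolding ch b_def ..
  have q1: "(\<Sum>m\<in>UNIV. christoffel ?G i i m y * christoffel ?G m j k y) = 2 * b j * b k - (if j = k then S else 0)" for i
    unfolding chb S_def
    by (simp add: if_zero_mult algebra_simps sum.distrib sum_subtractf sum_if_const)
  have q2: "(\<Sum>m\<in>UNIV. christoffel ?G i j m y * christoffel ?G m i k y) =
      b j * b k + (if j = i then 2 * b k * b i - (if i = k then S else 0) else 0)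
      - (if k = j then b i * b i else 0) - (if i = j then b i * b k else 0) + (if i = k then b i * b j else 0)" for i
    unfolding chb S_def
    by (simp add: if_zero_mult algebra_simps sum.distrib sum_subtractf sum_if_const)
  have "riemann ?G i k i j y =
      ((if k = i then D i j else 0) + (if j = i then D i k else 0) - (if j = k then D i i else 0)) - D j k
      + ((2 * b j * b k - (if j = k then S else 0)) - (b j * b k + (if j = i then 2 * b k * b i - (if i = k then S else 0) else 0)
      - (if k = j then b i * b i else 0) - (if i = j then b i * b k else 0) + (if i = k then b i * b j else 0)))" for i
    unfolding riemann_def sum_subtractf q1 q2 pch by simp
  then have "ricci ?G j k y = (\<Sum>i\<in>UNIV. ((if k = i then D i j else 0) + (if j = i then D i k else 0) - (if j = k then D i i else 0)) - D j k
      + ((2 * b j * b k - (if j = k then S else 0)) - (b j * b k + (if j = i then 2 * b k * b i - (if i = k then S else 0) else 0)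
      - (if k = j then b i * b i else 0) - (if i = j then b i * b k else 0) + (if i = k then b i * b j else 0))))"
    unfolding ricci_def by simp
  also have "\<dots> = (2 - real CARD('n)) * (D j k - b j * b k) - (if j = k then (\<Sum>i\<in>UNIV. D i i) + (real CARD('n) - 2) * S else 0)"
    by (simp add: sum.distrib sum_subtractf sum_if_const S_def D_def algebra_simps)
  also have "(\<Sum>i\<in>UNIV. D i i) = real CARD('n) * \<beta> (y \<bullet> y) + S"
    by (simp add: D_def sum.distrib S_def)
  also have "D j k - b j * b k = (if j = k then \<beta> (y \<bullet> y) else 0)" by (simp add: D_def)
  also have "S = (\<beta> (y \<bullet> y))\<^sup>2 * (y \<bullet> y)"
  proof -
    have "(\<Sum>m\<in>UNIV. (c * y $ m) * (c * y $ m)) = c\<^sup>2 * (y \<bullet> y)" for c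
      by (simp add: inner_vec_def sum_distrib_left power2_eq_square ac_simps)
    then show ?thesis unfolding S_def b_def by simp
  qed
  finally show ?thesis
    using pos[of y] by (simp add: \<beta>_def divide_simps power2_eq_square) (simp add: algebra_simps)?
qed

section \<open>The function \<open>G\<^sub>p\<close>\<close>

text \<open>
  As a function of \<open>\<rho> = |y|\<^sup>2\<close>, \<open>G\<^sub>p\<close> has logarithmic derivative \<open>b = - 1 / (4 (p - 1) t)\<close>, so the
  spatial part of the equation is polynomial in \<open>b\<close>.
\<close>
lemma Gp_classical:
  fixes y :: "real^'n::finite"
  assumes p: "1 < p" and t: "t > 0"
  shows "classical_solution_at p (\<lambda>y. mat 1) (Gp p) y t"
proof -
  define \<kappa> where "\<kappa> = p - 1"
  define a where "a = (real CARD('n) + p - 2) / (2 * \<kappa>)"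
  define \<rho> where "\<rho> = y \<bullet> y"
  have \<kappa>: "\<kappa> > 0" using p by (simp add: \<kappa>_def)
  have "2 * \<kappa> * a = real CARD('n) + p - 2" using \<kappa> by (simp add: a_def)
  then have n: "real CARD('n) - 1 = \<kappa> * (2 * a - 1)" by (simp add: algebra_simps) (simp add: \<kappa>_def)
  define F where "F r = t powr (- a) * exp (- (r / (4 * \<kappa> * t)))" for r
  define b where "b = - 1 / (4 * \<kappa> * t)"
  have Gp: "Gp p (z, s) = s powr (- a) * exp (- (z \<bullet> z / (4 * \<kappa> * s)))" for z :: "real^'n" and s
    by (simp add: Gp_def a_def \<kappa>_def dot_square_norm)
  have F: "(F has_real_derivative b * F r) (at r)" for r
    unfolding F_def b_def using \<kappa> t by (auto intro!: derivative_eq_intros simp: ac_simps)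
  have D: "((\<lambda>s. Gp p (y, s)) has_real_derivative F \<rho> * (\<rho> / (4 * \<kappa> * t\<^sup>2) - a / t)) (at t)"
    unfolding Gp F_def \<rho>_def using \<kappa> t
    by (auto intro!: derivative_eq_intros simp: powr_diff field_simps power2_eq_square)
  have eq: "F \<rho> * (\<rho> / (4 * \<kappa> * t\<^sup>2) - a / t) =
      ((p - 1) * (4 * \<rho> * (b * (b * F \<rho>)) + 2 * (b * F \<rho>) - 2 * 0 * \<rho> * (b * F \<rho>))
         + (real CARD('n) - 1) * (2 * (b * F \<rho>) + 2 * 0 * \<rho> * (b * F \<rho>))) / 1"
    unfolding n \<kappa>_def[symmetric] b_def using \<kappa> t by (simp add: field_simps power2_eq_square)
  show ?thesis
  proof (rule radial_classical_solution[where F = F and dF = "\<lambda>r. b * F r" and ddF = "b * (b * F \<rho>)"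
        and L = "\<lambda>_. 1" and d = 0 and \<beta> = 0 and \<rho> = \<rho>])
    show "Gp p (z, t) = F (z \<bullet> z)" for z :: "real^'n" by (simp add: Gp F_def)
    show "(F has_real_derivative b * F r) (at r)" for r by (rule F)
    show "((\<lambda>r. b * F r) has_real_derivative b * (b * F \<rho>)) (at \<rho>)" by (rule DERIV_cmult[OF F])
  qed (use D[unfolded eq] in \<open>simp_all only: \<rho>_def DERIV_const div_by_1 one_neq_zero not_False_eq_True\<close>)
qed

lemma viscosity_solution_Gp:
  assumes p: "1 < p"
  shows "viscosity_solution p (euclidean_manifold :: (real^'n::finite, 'n) manifold) \<infinity> (Gp p)"
proof (rule viscosity_solution_if_classical[OF p riemannian_manifold_euclidean])
  show "metric euclidean_manifold c = (\<lambda>y. mat 1)" for c :: "(real^'n, 'n) chart"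
    by (simp add: euclidean_manifold_def)
  have "continuous_on (UNIV \<times> {0<..}) (Gp p :: (real^'n) \<times> real \<Rightarrow> real)"
    unfolding Gp_def case_prod_unfold using p by (intro continuous_intros) auto
  moreover have "cylinder (euclidean_manifold :: (real^'n, 'n) manifold) \<infinity> = UNIV \<times> {0<..}"
    by (auto simp: cylinder_def euclidean_manifold_def)
  ultimately show "continuous_map (subtopology (spacetime euclidean_manifold)
      (cylinder (euclidean_manifold :: (real^'n, 'n) manifold) \<infinity>)) euclideanreal (Gp p)"
    by (simp add: euclidean_manifold_def)
  fix c :: "(real^'n, 'n) chart" and y :: "real^'n" and t :: real
  assume c: "c \<in> atlas euclidean_manifold" and t: "0 < t"
  have "chart_inv c = (\<lambda>y. y)"
    using c by (simp add: euclidean_manifold_def chart_inv_def inv_f_eq fun_eq_iff)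
  then have "in_chart c (Gp p) = Gp p" by (simp add: in_chart_def fun_eq_iff)
  then show "classical_solution_at p (metric euclidean_manifold c) (in_chart c (Gp p)) y t"
    using Gp_classical[OF p t, of y] by (simp add: euclidean_manifold_def)
qed

lemma log_Gp_derivatives:
  fixes x :: "real^'n::finite"
  assumes p: "1 < p" and t: "t > 0"
  shows "\<exists>Dv vt. GDERIV (\<lambda>y. ln (Gp p (y, t))) x :> Dv \<and>
      ((\<lambda>s. ln (Gp p (x, s))) has_real_derivative vt) (at t) \<and>
      (p - 1) * (norm Dv)\<^sup>2 - vt = (real CARD('n) + p - 2) / (2 * (p - 1) * t)"
proof -
  define \<kappa> where "\<kappa> = p - 1"
  define a where "a = (real CARD('n) + p - 2) / (2 * \<kappa>)"
  have \<kappa>: "\<kappa> > 0" using p by (simp add: \<kappa>_def)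
  have ln: "ln (Gp p (y, s)) = - a * ln s - y \<bullet> y / (4 * \<kappa> * s)" if "s > 0" for y :: "real^'n" and s
    using that by (simp add: Gp_def a_def \<kappa>_def dot_square_norm ln_mult ln_powr)
  define Dv where "Dv = (- 1 / (2 * \<kappa> * t)) *\<^sub>R x"
  define vt where "vt = - a / t + x \<bullet> x / (4 * \<kappa> * t\<^sup>2)"
  have "((\<lambda>y. ln (Gp p (y, t))) has_derivative (\<lambda>h. h \<bullet> Dv)) (at x)"
    unfolding ln[OF t] Dv_def using \<kappa> t
    by (auto intro!: derivative_eq_intros simp: fun_eq_iff inner_commute field_simps)
  moreover have "((\<lambda>s. ln (Gp p (x, s))) has_real_derivative vt) (at t)"
  proof (rule has_field_derivative_transform_within_open[of "\<lambda>s. - a * ln s - x \<bullet> x / (4 * \<kappa> * s)" _ _ "{0<..}"])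
    show "((\<lambda>s. - a * ln s - x \<bullet> x / (4 * \<kappa> * s)) has_real_derivative vt) (at t)"
      unfolding vt_def using \<kappa> t
      by (auto intro!: derivative_eq_intros simp: field_simps power2_eq_square)
  qed (use t ln in auto)
  moreover have "\<kappa> * (norm Dv)\<^sup>2 - vt = a / t"
    using \<kappa> t by (simp add: Dv_def vt_def power_mult_distrib dot_square_norm) (simp add: field_simps power2_eq_square)
  ultimately show ?thesis
    unfolding gderiv_def by (intro exI[of _ Dv] exI[of _ vt]) (simp add: \<kappa>_def a_def)
qed


section \<open>Decay of the Jacobi death chain\<close>

text \<open>
  Variation of constants: \<open>y(t) = e\<^bsup>-lt\<^esup> (F(t) - F(0))\<close> for an antiderivative \<open>F\<close> of \<open>e\<^bsup>lt\<^esup> g(t)\<close>.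
\<close>
lemma linear_ode_solution:
  fixes g :: "real \<Rightarrow> real"
  assumes g: "continuous_on UNIV g" "\<forall>t\<ge>0. g t \<ge> 0"
  shows "\<exists>y. (\<forall>t. (y has_real_derivative g t - l * y t) (at t)) \<and> y 0 = 0 \<and> (\<forall>t\<ge>0. y t \<ge> 0)"
proof -
  have "\<exists>F. \<forall>x :: real. - \<infinity> < ereal x \<longrightarrow> ereal x < \<infinity> \<longrightarrow> (F has_vector_derivative exp (l * x) * g x) (at x)"
    using g(1) by (intro einterval_antiderivative)
      (auto intro!: continuous_intros simp: continuous_on_eq_continuous_at)
  then obtain F where F: "\<And>x. (F has_real_derivative exp (l * x) * g x) (at x)"
    by (auto simp: has_real_derivative_iff_has_vector_derivative)
  define y where "y t = exp (- l * t) * (F t - F 0)" for t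
  show ?thesis
  proof (intro exI[of _ y] conjI allI impI)
    show "(y has_real_derivative g t - l * y t) (at t)" for t
      unfolding y_def
      by (auto intro!: derivative_eq_intros F simp: algebra_simps simp flip: mult_exp_exp exp_add)
    show "y 0 = 0" by (simp add: y_def)
    show "y t \<ge> 0" if "t \<ge> 0" for t
    proof -
      have "F 0 \<le> F t"
        by (rule DERIV_nonneg_imp_nondecreasing[OF that]) (use F g in \<open>auto intro!: exI mult_nonneg_nonneg\<close>)
      then show ?thesis by (simp add: y_def)
    qed
  qed
qed

text \<open>
  The coefficients of \<open>\<Sum>k\<le>m. c\<^sub>k(t) s\<^sup>k\<close> when this polynomial solves \<open>u\<^sub>t = L u\<close> with initial value \<open>s\<^sup>m\<close>
  and \<open>L s\<^sup>k = r\<^sub>k s\<^bsup>k-1\<^esup> - l\<^sub>k s\<^sup>k\<close>.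
\<close>
definition death_chain :: "(nat \<Rightarrow> real) \<Rightarrow> (nat \<Rightarrow> real) \<Rightarrow> nat \<Rightarrow> (nat \<Rightarrow> real \<Rightarrow> real) \<Rightarrow> bool" where
  "death_chain l r m c \<longleftrightarrow>
     (\<forall>k t. (c k has_real_derivative r (Suc k) * c (Suc k) t - l k * c k t) (at t)) \<and>
     (\<forall>k. c k 0 = of_bool (k = m)) \<and> (\<forall>k. \<forall>t\<ge>0. c k t \<ge> 0) \<and> (\<forall>k>m. \<forall>t. c k t = 0)"

text \<open>
  The system is triangular. Removing the lowest component leaves a chain with shifted rates, and the
  lowest component then solves a scalar equation with a nonnegative source.
\<close>
lemma death_chain_exists:
  assumes "\<And>k. r k \<ge> 0"
  shows "\<exists>c. death_chain l r m c"
  using assms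
proof (induction m arbitrary: l r)
  case 0
  have "death_chain l r 0 (\<lambda>k t. if k = 0 then exp (- l 0 * t) else 0)"
    unfolding death_chain_def
  proof (intro conjI allI impI)
    show "((\<lambda>t. if k = 0 then exp (- l 0 * t) else 0) has_real_derivative
        r (Suc k) * (if Suc k = 0 then exp (- l 0 * t) else 0) - l k * (if k = 0 then exp (- l 0 * t) else 0)) (at t)" for k t
      using DERIV_fun_exp[OF DERIV_cmult_Id[of "- l 0" t UNIV]] by (cases "k = 0") (simp_all add: mult.commute)
  qed simp_all
  then show ?case by blast
next
  case (Suc m)
  obtain c where c: "death_chain (\<lambda>k. l (Suc k)) (\<lambda>k. r (Suc k)) m c"
    using Suc.IH[of "\<lambda>k. r (Suc k)" "\<lambda>k. l (Suc k)", OF Suc.prems] by (elim exE)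
  then have c0: "\<And>t. (c 0 has_real_derivative r 2 * c 1 t - l 1 * c 0 t) (at t)" "\<And>t. t \<ge> 0 \<Longrightarrow> c 0 t \<ge> 0"
    unfolding death_chain_def by (simp_all add: numeral_2_eq_2)
  have "continuous_on UNIV (\<lambda>t. r 1 * c 0 t)"
    by (intro continuous_on_mult_left DERIV_continuous_on[OF has_field_derivative_at_within[OF c0(1)]])
  moreover have "\<forall>t\<ge>0. r 1 * c 0 t \<ge> 0"
    using c0(2) Suc.prems by simp
  ultimately obtain y where y: "\<And>t. (y has_real_derivative r 1 * c 0 t - l 0 * y t) (at t)" "y 0 = 0"
    "\<And>t. t \<ge> 0 \<Longrightarrow> y t \<ge> 0"
    using linear_ode_solution[where l = "l 0"] by metis
  have "death_chain l r (Suc m) (\<lambda>k. case k of 0 \<Rightarrow> y | Suc k \<Rightarrow> c k)"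
    unfolding death_chain_def
  proof (intro conjI allI impI)
    show "((case k of 0 \<Rightarrow> y | Suc k \<Rightarrow> c k) has_real_derivative
        r (Suc k) * (case Suc k of 0 \<Rightarrow> y | Suc k \<Rightarrow> c k) t - l k * (case k of 0 \<Rightarrow> y | Suc k \<Rightarrow> c k) t) (at t)" for k t
      using c y(1) by (cases k) (simp_all add: death_chain_def)
    show "(case k of 0 \<Rightarrow> y | Suc k \<Rightarrow> c k) 0 = of_bool (k = Suc m)" for k
      using c y(2) by (cases k) (simp_all add: death_chain_def)
    show "0 \<le> (case k of 0 \<Rightarrow> y | Suc k \<Rightarrow> c k) t" if "t \<ge> 0" for k t
      using c y(3) that by (cases k) (simp_all add: death_chain_def)
    show "(case k of 0 \<Rightarrow> y | Suc k \<Rightarrow> c k) t = 0" if "k > Suc m" for k t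
      using c that by (cases k) (simp_all add: death_chain_def)
  qed
  then show ?case by blast
qed

text \<open>
  Summation by parts. The weights \<open>w\<^sub>k = 1\<close> give the value at the pole, \<open>w\<^sub>k = s\<^sup>k\<close> the solution itself,
  and the moments \<open>w\<^sub>k = mu k\<close> the total mass.
\<close>
lemma death_chain_duality:
  assumes c: "death_chain l r m c" and r0: "r 0 = 0"
  shows "((\<lambda>t. \<Sum>k\<le>m. w k * c k t) has_real_derivative (\<Sum>k\<le>m. c k t * (r k * w (k - 1) - l k * w k))) (at t)"
proof -
  have "((\<lambda>t. \<Sum>k\<le>m. w k * c k t) has_real_derivative (\<Sum>k\<le>m. w k * (r (Suc k) * c (Suc k) t - l k * c k t))) (at t)"
    using c unfolding death_chain_def by (intro DERIV_sum DERIV_cmult) blast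
  moreover have "(\<Sum>k\<le>m. w k * (r (Suc k) * c (Suc k) t)) = (\<Sum>k\<le>m. c k t * (r k * w (k - 1)))"
  proof -
    let ?h = "\<lambda>k. c k t * (r k * w (k - 1))"
    have "(\<Sum>k\<le>m. w k * (r (Suc k) * c (Suc k) t)) = (\<Sum>k\<le>Suc m. ?h k)"
      unfolding sum.atMost_Suc_shift by (simp add: r0 ac_simps)
    also have "\<dots> = (\<Sum>k\<le>m. ?h k)" using c by (simp add: death_chain_def)
    finally show ?thesis .
  qed
  ultimately show ?thesis
    by (simp add: right_diff_distrib sum_subtractf ac_simps)
qed

text \<open>
  Gain and loss are the coefficients in \<open>L s\<^sup>k = gain\<^sub>k s\<^bsup>k-1\<^esup> - loss\<^sub>k s\<^sup>k\<close> for the Jacobi operator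
  \<open>L = \<kappa> (s (1 - s) d\<^sup>2/ds\<^sup>2 + a (1 - 2 s) d/ds)\<close>.
\<close>
definition jacobi_gain :: "real \<Rightarrow> real \<Rightarrow> nat \<Rightarrow> real" where
  "jacobi_gain \<kappa> a k = \<kappa> * k * (real k - 1 + a)"

definition jacobi_loss :: "real \<Rightarrow> real \<Rightarrow> nat \<Rightarrow> real" where
  "jacobi_loss \<kappa> a k = \<kappa> * k * (real k - 1 + 2 * a)"

context
  fixes a \<kappa> :: real
  assumes a: "a > 0" and \<kappa>: "\<kappa> > 0"
begin

text \<open>
  The moments of the symmetric beta distribution with parameters \<open>a\<close>, \<open>a\<close>, which is the reversible
  measure of \<open>L\<close>; for integral \<open>2 a\<close> it is the law of the height on the sphere of dimension \<open>2 a\<close>.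
\<close>
definition mu :: "nat \<Rightarrow> real" where "mu k = (\<Prod>j<k. (real j + a) / (real j + 2 * a))"

lemma mu_pos: "mu k > 0"
  unfolding mu_def using a by (intro prod_pos) (auto intro!: divide_pos_pos add_nonneg_pos)

lemma mu_antimono: "j \<le> k \<Longrightarrow> mu k \<le> mu j"
proof (induction k rule: dec_induct)
  case (step k)
  have "mu (Suc k) = mu k * ((k + a) / (k + 2 * a))" by (simp add: mu_def)
  also have "\<dots> \<le> mu k * 1"
    using a mu_pos[of k] by (intro mult_left_mono) (auto simp: divide_le_eq)
  finally show ?case using step by simp
qed simp

lemma mu_balance: "jacobi_gain \<kappa> a k * mu (k - 1) = jacobi_loss \<kappa> a k * mu k"
proof (cases k)
  case (Suc j)
  have "real j + 2 * a > 0" using a by simp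
  then show ?thesis by (simp add: Suc mu_def jacobi_gain_def jacobi_loss_def)
qed (simp add: jacobi_gain_def jacobi_loss_def)

text \<open>
  The factors are bounded by those of the telescoping product of \<open>(x / (x + 1))\<^sup>a\<close>, \<open>x = j + 2 a\<close>, as
  \<open>1 - a / x \<le> e\<^bsup>- a / x\<^esup> \<le> (x / (x + 1))\<^sup>a\<close>.
\<close>
lemma mu_le: "mu m \<le> (2 * a / (m + 2 * a)) powr a"
proof (induction m)
  case 0
  then show ?case using a by (simp add: mu_def)
next
  case (Suc m)
  define x where "x = m + 2 * a"
  have x: "x > 0" "real (Suc m) + 2 * a = x + 1" using a by (auto simp: x_def add_nonneg_pos)
  have "(m + a) / x = 1 + - (a / x)" using x by (simp add: x_def field_simps)
  also have "\<dots> \<le> exp (- (a / x))" by (rule exp_ge_add_one_self)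
  also have "\<dots> \<le> exp (- (a * ln (1 + 1 / x)))"
    using x a ln_add_one_self_le_self[of "1 / x"] mult_left_mono[of "ln (1 + 1 / x)" "1 / x" a] by simp
  also have "\<dots> = (x / (x + 1)) powr a"
  proof -
    have "ln (x / (x + 1)) = - ln (1 + 1 / x)"
      using x by (simp add: ln_div[symmetric] add_divide_distrib[symmetric] ln_inverse[symmetric] divide_simps flip: ln_inverse)
    then show ?thesis using x by (simp add: powr_def)
  qed
  finally have step: "(m + a) / x \<le> (x / (x + 1)) powr a" .
  have "mu (Suc m) = mu m * ((m + a) / x)" by (simp add: mu_def x_def)
  also have "\<dots> \<le> (2 * a / x) powr a * (x / (x + 1)) powr a"
    using Suc step a x by (intro mult_mono) (auto simp: x_def)
  also have "\<dots> = (2 * a / x * (x / (x + 1))) powr a"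
    by (rule powr_mult[symmetric])
  also have "2 * a / x * (x / (x + 1)) = 2 * a / (real (Suc m) + 2 * a)"
    using x by simp
  finally show ?case .
qed

text \<open>
  The assumed inequality acts twice. Integrated from \<open>1 / m\<close> to \<open>1\<close> it prevents \<open>S\<close> from decreasing by
  more than the factor \<open>m\<^bsup>-a'\<^esup>\<close>; at time \<open>1\<close> it bounds the mean of \<open>k\<close>, so that \<open>S(1)\<close> is controlled by
  the conserved mass \<open>mu m\<close>.
\<close>
theorem death_chain_decay:
  assumes c: "\<And>m. death_chain (jacobi_loss \<kappa> a) (jacobi_gain \<kappa> a) m (c m)" and a': "a' \<ge> 0"
    and decay: "\<And>m t. t > 0 \<Longrightarrow> \<kappa> * a * (\<Sum>k\<le>m. k * c m k t) \<le> a' / t * (\<Sum>k\<le>m. c m k t)"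
  shows "a \<le> a'"
proof (rule ccontr)
  assume "\<not> a \<le> a'"
  then have d: "a - a' > 0" by simp
  define S Q where "S m t = (\<Sum>k\<le>m. c m k t)" and "Q m t = (\<Sum>k\<le>m. k * c m k t)" for m t
  have nn: "c m k t \<ge> 0" if "t \<ge> 0" for m k t
    using c[of m] that by (simp add: death_chain_def)
  have gain0: "jacobi_gain \<kappa> a 0 = 0" by (simp add: jacobi_gain_def)
  have S': "(S m has_real_derivative - (\<kappa> * a * Q m t)) (at t)" for m t
  proof -
    have "(\<Sum>k\<le>m. c m k t * (jacobi_gain \<kappa> a k * 1 - jacobi_loss \<kappa> a k * 1)) = - (\<kappa> * a * Q m t)"
      unfolding Q_def by (simp add: jacobi_gain_def jacobi_loss_def sum_distrib_left algebra_simps flip: sum_negf)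
    then show ?thesis
      using death_chain_duality[OF c gain0, where w = "\<lambda>_. 1", of m t] by (simp add: S_def[abs_def])
  qed
  have S0: "S m 0 = 1" for m
    using c[of m] by (simp add: S_def death_chain_def)
  have S_lower: "exp (- (\<kappa> * a * m * t)) \<le> S m t" if t: "t \<ge> 0" for m t
  proof -
    define f where "f t = S m t * exp (\<kappa> * a * m * t)" for t
    have "f 0 \<le> f t"
    proof (rule DERIV_nonneg_imp_nondecreasing[OF t])
      fix s :: real assume s: "0 \<le> s" "s \<le> t"
      have "Q m s \<le> m * S m s"
        unfolding Q_def S_def sum_distrib_left using nn[OF s(1)] by (intro sum_mono mult_right_mono) auto
      then have "0 \<le> \<kappa> * a * (m * S m s - Q m s) * exp (\<kappa> * a * m * s)"
        using a \<kappa> by (intro mult_nonneg_nonneg) auto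
      moreover have "(f has_real_derivative \<kappa> * a * (m * S m s - Q m s) * exp (\<kappa> * a * m * s)) (at s)"
        unfolding f_def by (auto intro!: derivative_eq_intros S' simp: algebra_simps)
      ultimately show "\<exists>y. (f has_real_derivative y) (at s) \<and> 0 \<le> y" by blast
    qed
    then have "1 \<le> S m t * exp (\<kappa> * a * m * t)" by (simp add: f_def S0)
    then show ?thesis by (simp add: exp_minus field_simps)
  qed
  have S_growth: "S m s * s powr a' \<le> S m t * t powr a'" if st: "0 < s" "s \<le> t" for m s t
  proof (rule DERIV_nonneg_imp_nondecreasing[OF st(2)])
    fix q assume q: "s \<le> q" "q \<le> t"
    then have q0: "q > 0" using st by simp
    have "((\<lambda>t. S m t * t powr a') has_real_derivative q powr a' * (a' / q * S m q - \<kappa> * a * Q m q)) (at q)"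
      using q0 by (auto intro!: derivative_eq_intros S' simp: powr_diff algebra_simps)
    moreover have "0 \<le> q powr a' * (a' / q * S m q - \<kappa> * a * Q m q)"
      using decay[OF q0, of m] by (intro mult_nonneg_nonneg) (auto simp: S_def Q_def)
    ultimately show "\<exists>y. ((\<lambda>t. S m t * t powr a') has_real_derivative y) (at q) \<and> 0 \<le> y" by blast
  qed
  have mass: "(\<Sum>k\<le>m. mu k * c m k 1) = mu m" for m
  proof -
    let ?M = "\<lambda>t. \<Sum>k\<le>m. mu k * c m k t"
    have "(?M has_real_derivative 0) (at t)" for t
      using death_chain_duality[OF c gain0, where w = mu, of m t] unfolding mu_balance by simp
    then have "?M 1 = ?M 0" using DERIV_isconst_all by blast
    then show ?thesis using c[of m] by (simp add: death_chain_def if_distrib cong: if_cong)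
  qed
  \<comment> \<open>with this threshold, \<open>Q \<le> (K / 2) S\<close> at time \<open>1\<close>\<close>
  obtain K\<^sub>0 :: nat where "2 * a' / (\<kappa> * a) \<le> K\<^sub>0" using real_arch_simple by blast
  then obtain K :: nat where K: "K > 0" "2 * a' / (\<kappa> * a) \<le> K"
    using that[of "Suc K\<^sub>0"] by simp
  have main: "exp (- (\<kappa> * a)) * m powr (- a') \<le> 2 / mu K * (2 * a) powr a * m powr (- a)" if m: "m > 0" for m :: nat
  proof -
    have "exp (- (\<kappa> * a)) \<le> S m (1 / m)" using S_lower[of "1 / m" m] m by simp
    then have "exp (- (\<kappa> * a)) * (1 / m) powr a' \<le> S m (1 / m) * (1 / m) powr a'"
      by (intro mult_right_mono) auto
    also have "\<dots> \<le> S m 1 * 1 powr a'" using m by (intro S_growth) auto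
    finally have 1: "exp (- (\<kappa> * a)) * (1 / m) powr a' \<le> S m 1" by simp
    have "2 * Q m 1 \<le> 2 * a' / (\<kappa> * a) * S m 1"
      using decay[of 1 m] a \<kappa> by (simp add: S_def Q_def field_simps)
    also have "\<dots> \<le> K * S m 1"
      using K nn by (intro mult_right_mono) (auto simp: S_def intro!: sum_nonneg)
    finally have 2: "Q m 1 / K \<le> S m 1 / 2" using K by (simp add: field_simps)
    have "mu K * (S m 1 / 2) \<le> mu K * (S m 1 - Q m 1 / K)"
      using 2 mu_pos[of K] by (intro mult_left_mono) auto
    also have "\<dots> = (\<Sum>k\<le>m. mu K * (1 - k / K) * c m k 1)"
      by (simp add: S_def Q_def sum_distrib_left sum_subtractf sum_divide_distrib algebra_simps)
    also have "\<dots> \<le> (\<Sum>k\<le>m. mu k * c m k 1)"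
    proof (intro sum_mono mult_right_mono nn)
      fix k
      \<comment> \<open>Markov's inequality in the form of a linear minorant of the decreasing sequence \<open>mu\<close>\<close>
      show "mu K * (1 - k / K) \<le> mu k"
      proof (cases "k \<le> K")
        case True
        then have "mu K * (1 - k / K) \<le> mu K * 1"
          using mu_pos[of K] by (intro mult_left_mono) auto
        then show ?thesis using mu_antimono[OF True] by simp
      next
        case False
        then have "mu K * (1 - k / K) \<le> 0"
          using mu_pos[of K] K by (intro mult_nonneg_nonpos) (auto simp: le_divide_eq)
        then show ?thesis using mu_pos[of k] by simp
      qed
    qed simp
    also have "\<dots> = mu m" by (rule mass)
    also have "\<dots> \<le> (2 * a / m) powr a"
      using mu_le[of m] a m powr_mono2[of a "2 * a / (m + 2 * a)" "2 * a / m"] by (simp add: frac_le)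
    finally have "S m 1 \<le> 2 / mu K * (2 * a / m) powr a" using mu_pos[of K] by (simp add: field_simps)
    with 1 have "exp (- (\<kappa> * a)) * (1 / m) powr a' \<le> 2 / mu K * (2 * a / m) powr a" by linarith
    then show ?thesis using m a by (simp add: powr_divide powr_minus_divide)
  qed
  define C where "C = 2 / mu K * (2 * a) powr a * exp (\<kappa> * a)"
  have C: "C > 0" using mu_pos[of K] a by (simp add: C_def)
  have bound: "real m powr (a - a') \<le> C" if "m > 0" for m
    using main[of m] that mu_pos[of K] by (simp add: C_def powr_diff powr_minus exp_minus field_simps)
  obtain m :: nat where m: "C powr (1 / (a - a')) < m" using reals_Archimedean2 by blast
  then have "real m > 0" by (rule le_less_trans[OF powr_ge_zero])
  then have m0: "m > 0" by simp
  have "C = (C powr (1 / (a - a'))) powr (a - a')" using C d by (simp add: powr_powr)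
  also have "\<dots> < m powr (a - a')" using m d by (intro powr_less_mono2) auto
  finally show False using bound[OF m0] by simp
qed

end

section \<open>Closure properties of \<open>C\<^sup>k\<close> functions\<close>

lemma Ck_on_cong:
  fixes f g :: "'a::real_normed_vector \<Rightarrow> 'b::real_normed_vector"
  assumes "open S" "\<And>x. x \<in> S \<Longrightarrow> f x = g x"
  shows "Ck_on k f S = Ck_on k g S"
  using assms(2)
proof (induction k arbitrary: f g)
  case 0
  then show ?case by (simp cong: continuous_on_cong)
next
  case (Suc k)
  have imp: "Ck_on (Suc k) g S" if fg: "\<And>x. x \<in> S \<Longrightarrow> f x = g x" and f: "Ck_on (Suc k) f S" for f g :: "'a \<Rightarrow> 'b"
  proof -
    have d: "(g has_derivative frechet_derivative f (at x)) (at x)" if "x \<in> S" for x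
      using f that frechet_derivative_works[of f "at x"]
      by (auto intro!: has_derivative_transform_within_open[OF _ \<open>open S\<close> that fg])
    then have "frechet_derivative f (at x) v = frechet_derivative g (at x) v" if "x \<in> S" for x v
      using frechet_derivative_at[OF d[OF that]] by simp
    then have "Ck_on k (\<lambda>x. frechet_derivative g (at x) v) S" for v
      using Suc.IH[of "\<lambda>x. frechet_derivative f (at x) v" "\<lambda>x. frechet_derivative g (at x) v"] f by simp
    then show ?thesis using d by (auto simp: differentiable_def)
  qed
  show ?case using imp[of f g] imp[of g f] Suc.prems by metis
qed

lemma Ck_on_SucI:
  assumes "open S" "\<And>x. x \<in> S \<Longrightarrow> (f has_derivative D x) (at x)" "\<And>v. Ck_on k (\<lambda>x. D x v) S"
  shows "Ck_on (Suc k) f S"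
proof -
  have "D x v = frechet_derivative f (at x) v" if "x \<in> S" for x v
    using frechet_derivative_at[OF assms(2)[OF that]] by simp
  then have "Ck_on k (\<lambda>x. frechet_derivative f (at x) v) S" for v
    by (rule iffD1[OF Ck_on_cong[OF assms(1)] assms(3)])
  then show ?thesis using assms(2) by (auto simp: differentiable_def)
qed

lemma Ck_on_SucD:
  assumes "Ck_on (Suc k) f S"
  shows "x \<in> S \<Longrightarrow> (f has_derivative frechet_derivative f (at x)) (at x)"
    and "Ck_on k (\<lambda>x. frechet_derivative f (at x) v) S"
  using assms frechet_derivative_works by auto

lemma Ck_on_Suc_imp: "Ck_on (Suc k) f S \<Longrightarrow> Ck_on k f S"
proof (induction k arbitrary: f)
  case 0
  then show ?case
    by (auto intro!: continuous_at_imp_continuous_on differentiable_imp_continuous_within)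
next
  case (Suc k)
  then show ?case by (metis Ck_on.simps(2))
qed

lemma Ck_on_subset: "Ck_on k f S \<Longrightarrow> T \<subseteq> S \<Longrightarrow> Ck_on k f T"
  by (induction k arbitrary: f) (auto intro: continuous_on_subset)

lemma Ck_on_const: "Ck_on k (\<lambda>_. c) S"
  using smooth_on_const[of c S] by (simp add: smooth_on_def)

lemma Ck_on_bounded_linear:
  assumes "bounded_linear h" "open S"
  shows "Ck_on k h S"
proof (cases k)
  case 0
  then show ?thesis using assms by (simp add: linear_continuous_on)
next
  case (Suc j)
  then show ?thesis
    using Ck_on_SucI[OF assms(2) bounded_linear_imp_has_derivative[OF assms(1)] Ck_on_const] by simp
qed

lemma Ck_on_add:
  assumes "open S" "Ck_on k f S" "Ck_on k g S"
  shows "Ck_on k (\<lambda>x. f x + g x) S"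
  using assms(2,3)
proof (induction k arbitrary: f g)
  case 0
  then show ?case by (simp add: continuous_on_add)
next
  case (Suc k)
  show ?case
    by (rule Ck_on_SucI[OF assms(1) has_derivative_add[OF Ck_on_SucD(1)[OF Suc.prems(1)] Ck_on_SucD(1)[OF Suc.prems(2)]]])
       (use Suc.IH Suc.prems Ck_on_SucD(2) in blast)+
qed

lemma (in bounded_bilinear) Ck_on:
  assumes "open S" "Ck_on k f S" "Ck_on k g S"
  shows "Ck_on k (\<lambda>x. prod (f x) (g x)) S"
  using assms(2,3)
proof (induction k arbitrary: f g)
  case 0
  then show ?case by (simp add: continuous_on)
next
  case (Suc k)
  show ?case
  proof (rule Ck_on_SucI[OF assms(1)])
    show "((\<lambda>x. prod (f x) (g x)) has_derivative
        (\<lambda>v. prod (f x) (frechet_derivative g (at x) v) + prod (frechet_derivative f (at x) v) (g x))) (at x)"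
      if "x \<in> S" for x
      by (rule FDERIV[OF Ck_on_SucD(1)[OF Suc.prems(1) that] Ck_on_SucD(1)[OF Suc.prems(2) that]])
    show "Ck_on k (\<lambda>x. prod (f x) (frechet_derivative g (at x) v) + prod (frechet_derivative f (at x) v) (g x)) S" for v
      by (intro Ck_on_add[OF assms(1)] Suc.IH Ck_on_Suc_imp[OF Suc.prems(1)] Ck_on_Suc_imp[OF Suc.prems(2)]
          Ck_on_SucD(2)[OF Suc.prems(1)] Ck_on_SucD(2)[OF Suc.prems(2)])
  qed
qed

lemmas Ck_on_mult = bounded_bilinear.Ck_on[OF bounded_bilinear_mult]
lemmas Ck_on_scaleR = bounded_bilinear.Ck_on[OF bounded_bilinear_scaleR]
lemmas Ck_on_inner = bounded_bilinear.Ck_on[OF bounded_bilinear_inner]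

lemma Ck_on_inverse:
  fixes f :: "'a::real_normed_vector \<Rightarrow> real"
  assumes "open S" and f: "Ck_on k f S" and nz: "\<And>x. x \<in> S \<Longrightarrow> f x \<noteq> 0"
  shows "Ck_on k (\<lambda>x. inverse (f x)) S"
  using f
proof (induction k)
  case 0
  then show ?case using nz by (auto intro!: continuous_on_inverse)
next
  case (Suc k)
  show ?case
  proof (rule Ck_on_SucI[OF assms(1)])
    show "((\<lambda>x. inverse (f x)) has_derivative
        (\<lambda>v. - 1 * (inverse (f x) * frechet_derivative f (at x) v * inverse (f x)))) (at x)" if "x \<in> S" for x
      using Deriv.has_derivative_inverse[OF nz[OF that] Ck_on_SucD(1)[OF Suc.prems that]] by simp
    show "Ck_on k (\<lambda>x. - 1 * (inverse (f x) * frechet_derivative f (at x) v * inverse (f x))) S" for v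
      by (intro Ck_on_mult[OF assms(1)] Ck_on_const Suc.IH Ck_on_Suc_imp[OF Suc.prems] Ck_on_SucD(2)[OF Suc.prems])
  qed
qed

lemma Ck_on_power:
  fixes f :: "'a::real_normed_vector \<Rightarrow> real"
  assumes "open S" "Ck_on k f S"
  shows "Ck_on k (\<lambda>x. f x ^ m) S"
  by (induction m) (auto intro: Ck_on_mult assms Ck_on_const)

lemma Ck_on_sum:
  assumes "open S" "\<And>i. i \<in> A \<Longrightarrow> Ck_on k (f i) S"
  shows "Ck_on k (\<lambda>x. \<Sum>i\<in>A. f i x) S"
  using assms(2)
  by (induction A rule: infinite_finite_induct) (auto intro: Ck_on_add assms(1) Ck_on_const)

lemma Ck_on_ln:
  fixes f :: "'a::real_normed_vector \<Rightarrow> real"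
  assumes "open S" and f: "Ck_on k f S" and pos: "\<And>x. x \<in> S \<Longrightarrow> f x > 0"
  shows "Ck_on k (\<lambda>x. ln (f x)) S"
proof (cases k)
  case 0
  then show ?thesis using f pos by (auto intro!: continuous_on_ln simp: less_imp_neq[symmetric])
next
  case (Suc j)
  have f': "Ck_on (Suc j) f S" using f Suc by simp
  have nz: "\<And>x. x \<in> S \<Longrightarrow> f x \<noteq> 0" using pos by force
  have "Ck_on (Suc j) (\<lambda>x. ln (f x)) S"
  proof (rule Ck_on_SucI[OF assms(1)])
    show "((\<lambda>x. ln (f x)) has_derivative (\<lambda>v. frechet_derivative f (at x) v * inverse (f x))) (at x)" if "x \<in> S" for x
      by (rule has_derivative_ln[OF pos[OF that] Ck_on_SucD(1)[OF f' that]])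
    show "Ck_on j (\<lambda>x. frechet_derivative f (at x) v * inverse (f x)) S" for v
      by (intro Ck_on_mult Ck_on_inverse assms(1) nz Ck_on_SucD(2)[OF f'] Ck_on_Suc_imp[OF f'])
  qed
  then show ?thesis by (simp add: Suc)
qed

text \<open>
  For the time dependent coefficients of a function on space-time.
\<close>
lemma C1_compose_snd:
  fixes g :: "real \<Rightarrow> real" and S :: "('a::real_normed_vector \<times> real) set"
  assumes "open S" "\<And>t. (g has_real_derivative g' t) (at t)" "continuous_on UNIV g'"
  shows "Ck_on 1 (\<lambda>z. g (snd z)) S"
proof -
  have "Ck_on (Suc 0) (\<lambda>z. g (snd z)) S"
  proof (rule Ck_on_SucI[OF assms(1)])
    show "((\<lambda>z. g (snd z)) has_derivative (\<lambda>v. g' (snd z) * snd v)) (at z)" for z :: "'a \<times> real"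
      using has_derivative_compose[OF has_derivative_snd[OF has_derivative_ident] assms(2)[unfolded has_field_derivative_def]] .
    show "Ck_on 0 (\<lambda>z::'a \<times> real. g' (snd z) * snd v) S" for v :: "'a \<times> real"
      using continuous_on_compose2[OF assms(3) continuous_on_snd[OF continuous_on_id]]
      by (auto intro!: continuous_intros)
  qed
  then show ?thesis by simp
qed

section \<open>The round sphere\<close>

text \<open>
  Projection from the pole \<open>(0, - \<sigma>)\<close>, for \<open>\<sigma> = 1\<close> or \<open>\<sigma> = - 1\<close>; the pole \<open>(0, \<sigma>)\<close> is sent to \<open>0\<close>.
\<close>
definition stereo :: "real \<Rightarrow> (real^'n::finite) \<times> real \<Rightarrow> real^'n" where
  "stereo \<sigma> w = fst w /\<^sub>R (1 + \<sigma> * snd w)"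

definition stereo_inv :: "real \<Rightarrow> real^'n::finite \<Rightarrow> (real^'n) \<times> real" where
  "stereo_inv \<sigma> y = ((2 / (1 + y \<bullet> y)) *\<^sub>R y, \<sigma> * (1 - y \<bullet> y) / (1 + y \<bullet> y))"

text \<open>
  The sphere lives in \<open>\<real>\<^sup>n \<times> \<real>\<close>, and its points are relabelled along an injection \<open>e\<close> into the type
  that serves as the carrier.
\<close>
definition sphere_chart :: "((real^'n::finite) \<times> real \<Rightarrow> 'a) \<Rightarrow> real \<Rightarrow> ('a, 'n) chart" where
  "sphere_chart e \<sigma> = (e ` (sphere 0 1 - {(0, - \<sigma>)}), stereo \<sigma> \<circ> inv e)"

definition sphere_manifold :: "((real^'n::finite) \<times> real \<Rightarrow> 'a) \<Rightarrow> ('a, 'n) manifold" where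
  "sphere_manifold e = \<lparr>top_of = pullback_topology (e ` sphere 0 1) (inv e) euclidean,
     atlas = sphere_chart e ` {1, -1}, metric = (\<lambda>c y. mat (4 / (1 + y \<bullet> y)\<^sup>2))\<rparr>"

lemma in_sphere_iff: "w \<in> sphere 0 1 \<longleftrightarrow> fst w \<bullet> fst w + (snd w)\<^sup>2 = 1" for w :: "(real^'n::finite) \<times> real"
  by (simp add: norm_prod_def dot_square_norm)

lemma one_plus_inner_pos: "1 + y \<bullet> y > 0" for y :: "'a::real_inner"
  by (simp add: add_pos_nonneg)

lemma one_plus_inner_neq_0: "1 + y \<bullet> y \<noteq> 0" for y :: "'a::real_inner"
  using one_plus_inner_pos[of y] by linarith

lemma one_plus_height_neq_0:
  fixes w :: "(real^'n::finite) \<times> real"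
  assumes "\<sigma> \<in> {1, -1}" "w \<in> sphere 0 1 - {(0, - \<sigma>)}"
  shows "1 + \<sigma> * snd w \<noteq> 0"
proof
  assume 0: "1 + \<sigma> * snd w = 0"
  have "\<sigma> * \<sigma> = 1" using assms(1) by auto
  with 0 have z: "snd w = - \<sigma>" by algebra
  then have "fst w \<bullet> fst w = 0" using assms in_sphere_iff[of w] by auto
  then have "w = (0, - \<sigma>)" using z by (cases w) simp
  then show False using assms(2) by simp
qed

lemma stereo_inv_in_sphere:
  assumes "\<sigma> \<in> {1, -1}"
  shows "stereo_inv \<sigma> y \<in> sphere 0 1 - {(0, - \<sigma>)}"
proof -
  define q where "q = y \<bullet> y"
  have q: "1 + q > 0" using one_plus_inner_pos[of y] by (simp add: q_def)
  have "(2 / (1 + q)) * ((2 / (1 + q)) * q) + (\<sigma> * (1 - q) / (1 + q))\<^sup>2 = 1"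
    using q assms by (auto simp: divide_simps power2_eq_square) (simp_all add: algebra_simps)
  then have "stereo_inv \<sigma> y \<in> sphere 0 1"
    unfolding in_sphere_iff stereo_inv_def by (simp add: q_def)
  moreover have "\<sigma> * (1 - q) / (1 + q) \<noteq> - \<sigma>"
    using q assms by (auto simp: divide_simps)
  ultimately show ?thesis by (simp add: stereo_inv_def q_def)
qed

lemma stereo_stereo_inv:
  assumes "\<sigma> \<in> {1, -1}"
  shows "stereo \<sigma> (stereo_inv \<sigma> y) = y"
proof -
  have "1 + \<sigma> * (\<sigma> * (1 - y \<bullet> y) / (1 + y \<bullet> y)) = 2 / (1 + y \<bullet> y)"
    using assms one_plus_inner_pos[of y] by (auto simp: divide_simps)
  moreover have "inverse (2 / (1 + y \<bullet> y)) * (2 / (1 + y \<bullet> y)) = 1"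
    using one_plus_inner_pos[of y] by (intro left_inverse) simp
  ultimately show ?thesis
    unfolding stereo_def stereo_inv_def fst_conv snd_conv by (simp only: scaleR_scaleR scaleR_one)
qed

text \<open>
  The two projections are related by the inversion in the unit sphere of \<open>\<real>\<^sup>n\<close>; at \<open>y = 0\<close> both sides
  are \<open>0\<close> by the convention for division.
\<close>
lemma stereo_stereo_inv_opposite:
  assumes "\<sigma> \<in> {1, -1}"
  shows "stereo (- \<sigma>) (stereo_inv \<sigma> y) = inverse (y \<bullet> y) *\<^sub>R y"
proof -
  have "1 + - \<sigma> * (\<sigma> * (1 - y \<bullet> y) / (1 + y \<bullet> y)) = 2 * (y \<bullet> y) / (1 + y \<bullet> y)"
    using assms one_plus_inner_pos[of y] by (auto simp: divide_simps)
  moreover have "inverse (2 * (y \<bullet> y) / (1 + y \<bullet> y)) * (2 / (1 + y \<bullet> y)) = inverse (y \<bullet> y)"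
    using one_plus_inner_pos[of y] by (cases "y = 0") (simp_all add: divide_simps)
  ultimately show ?thesis
    unfolding stereo_def stereo_inv_def fst_conv snd_conv by (simp only: scaleR_scaleR)
qed

lemma stereo_inv_stereo:
  assumes \<sigma>: "\<sigma> \<in> {1, -1}" and w: "w \<in> sphere 0 1 - {(0, - \<sigma>)}"
  shows "stereo_inv \<sigma> (stereo \<sigma> w) = w"
proof -
  obtain x z where xz: "w = (x, z)" by (cases w)
  have nz: "1 + \<sigma> * z \<noteq> 0" using one_plus_height_neq_0[OF assms] xz by simp
  have eq: "x \<bullet> x = 1 - z\<^sup>2" using w in_sphere_iff[of w] xz by simp
  have \<sigma>2: "\<sigma> * \<sigma> = 1" using \<sigma> by auto
  have "stereo \<sigma> w \<bullet> stereo \<sigma> w = (1 - z\<^sup>2) / (1 + \<sigma> * z)\<^sup>2"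
    by (simp add: stereo_def xz eq power2_eq_square divide_inverse)
  also have "1 - z\<^sup>2 = (1 - \<sigma> * z) * (1 + \<sigma> * z)"
    using \<sigma>2 by (simp add: algebra_simps power2_eq_square)
  finally have q: "stereo \<sigma> w \<bullet> stereo \<sigma> w = (1 - \<sigma> * z) / (1 + \<sigma> * z)"
    using nz by (simp add: power2_eq_square)
  have q1: "1 + stereo \<sigma> w \<bullet> stereo \<sigma> w = 2 / (1 + \<sigma> * z)"
    using nz by (simp add: q divide_simps)
  have q2: "1 - stereo \<sigma> w \<bullet> stereo \<sigma> w = 2 * \<sigma> * z / (1 + \<sigma> * z)"
    using nz by (simp add: q divide_simps)
  have "(2 / (2 / (1 + \<sigma> * z))) *\<^sub>R stereo \<sigma> w = x"
  proof -
    have "2 / (2 / (1 + \<sigma> * z)) * inverse (1 + \<sigma> * z) = 1" using nz by (simp add: divide_simps)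
    then show ?thesis unfolding stereo_def xz fst_conv snd_conv by (simp only: scaleR_scaleR scaleR_one)
  qed
  moreover have "\<sigma> * (2 * \<sigma> * z / (1 + \<sigma> * z)) / (2 / (1 + \<sigma> * z)) = z"
    using nz \<sigma>2 by (simp add: divide_simps mult.assoc[symmetric]) (simp add: algebra_simps)?
  ultimately show ?thesis
    unfolding stereo_inv_def q1 q2 by (simp only: times_divide_eq_right xz)
qed

locale sphere_embedding =
  fixes e :: "(real^'n::finite) \<times> real \<Rightarrow> 'a"
  assumes inj: "inj e"
begin

abbreviation "M \<equiv> sphere_manifold e"

lemma inv_e [simp]: "inv e (e w) = w"
  using inj by simp

lemma points_M: "points M = e ` sphere 0 1"
  by (auto simp: sphere_manifold_def topspace_pullback_topology)

lemma continuous_inv_e: "continuous_map (top_of M) euclidean (inv e)"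
  using continuous_map_pullback[of euclidean euclidean id "e ` sphere 0 1" "inv e"]
  by (simp add: sphere_manifold_def)

lemma homeomorphic_maps_sphere: "homeomorphic_maps (top_of M) (top_of_set (sphere 0 1)) (inv e) e"
proof -
  have "continuous_map (top_of M) (top_of_set (sphere 0 1)) (inv e)"
    by (rule continuous_map_into_subtopology[OF continuous_inv_e]) (auto simp: points_M)
  moreover have "continuous_map (top_of_set (sphere 0 1)) (top_of M) e"
    unfolding sphere_manifold_def by (simp, rule continuous_map_pullback') (auto simp: o_def)
  ultimately show ?thesis
    unfolding homeomorphic_maps_def by (auto simp: points_M)
qed

lemma
  shows Hausdorff_M: "Hausdorff_space (top_of M)"
    and second_countable_M: "second_countable (top_of M)"
    and compact_M: "compact_space (top_of M)"
proof -
  have hs: "top_of M homeomorphic_space top_of_set (sphere 0 1 :: ((real^'n) \<times> real) set)"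
    using homeomorphic_maps_sphere homeomorphic_space_def by blast
  have "second_countable (euclidean :: ((real^'n) \<times> real) topology)"
    unfolding second_countable_def using ex_countable_basis topological_basis_def
    by (metis open_openin topological_basisE topological_basis_open)
  then have "second_countable (top_of_set (sphere 0 1 :: ((real^'n) \<times> real) set))"
    by (rule second_countable_subtopology)
  then show "second_countable (top_of M)" using homeomorphic_space_second_countability[OF hs] by simp
  show "Hausdorff_space (top_of M)"
    using homeomorphic_Hausdorff_space[OF hs] Hausdorff_space_subtopology[OF Hausdorff_space_euclidean] by simp
  show "compact_space (top_of M)"
    using homeomorphic_compact_space[OF hs] compact_space_subtopology[of euclidean "sphere 0 1 :: ((real^'n) \<times> real) set"]
    by (simp add: compactin_euclidean_iff)
qed

lemma atlas_cases:
  assumes "c \<in> atlas M"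
  obtains \<sigma> where "\<sigma> \<in> {1, -1}" "c = sphere_chart e \<sigma>"
  using assms by (auto simp: sphere_manifold_def)

lemma chart_range:
  assumes "\<sigma> \<in> {1, -1}"
  shows "snd (sphere_chart e \<sigma>) ` fst (sphere_chart e \<sigma>) = UNIV"
proof -
  have "y \<in> stereo \<sigma> ` (sphere 0 1 - {(0, - \<sigma>)})" for y :: "real^'n"
    using stereo_stereo_inv[OF assms, of y] stereo_inv_in_sphere[OF assms, of y] by (metis imageI)
  then show ?thesis by (auto simp: sphere_chart_def image_image)
qed

lemma chart_inv_sphere_chart:
  assumes "\<sigma> \<in> {1, -1}"
  shows "chart_inv (sphere_chart e \<sigma>) y = e (stereo_inv \<sigma> y)"
  unfolding chart_inv_def sphere_chart_def fst_conv snd_conv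
proof (rule inv_into_f_eq)
  show "inj_on (stereo \<sigma> \<circ> inv e) (e ` (sphere 0 1 - {(0, - \<sigma>)}))"
  proof (rule inj_on_inverseI)
    fix x assume "x \<in> e ` (sphere 0 1 - {(0, - \<sigma>)})"
    then obtain w where "w \<in> sphere 0 1 - {(0, - \<sigma>)}" "x = e w" by blast
    moreover from this have "stereo_inv \<sigma> (stereo \<sigma> w) = w" by (intro stereo_inv_stereo[OF assms])
    ultimately show "(e \<circ> stereo_inv \<sigma>) ((stereo \<sigma> \<circ> inv e) x) = x" by (simp only: o_apply inv_e)
  qed
  show "e (stereo_inv \<sigma> y) \<in> e ` (sphere 0 1 - {(0, - \<sigma>)})"
    by (intro imageI stereo_inv_in_sphere[OF assms])
  show "(stereo \<sigma> \<circ> inv e) (e (stereo_inv \<sigma> y)) = y"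
    by (simp add: stereo_stereo_inv[OF assms])
qed

lemma openin_chart_domain: "openin (top_of M) (fst (sphere_chart e \<sigma>))"
proof -
  have "openin (top_of M) {x \<in> points M. inv e x \<in> - {(0, - \<sigma>)}}"
    by (rule openin_continuous_map_preimage[OF continuous_inv_e]) (simp add: open_Compl)
  moreover have "{x \<in> points M. inv e x \<in> - {(0, - \<sigma>)}} = fst (sphere_chart e \<sigma>)"
    by (auto simp: points_M sphere_chart_def)
  ultimately show ?thesis by simp
qed

lemma homeomorphic_map_chart:
  assumes \<sigma>: "\<sigma> \<in> {1, -1}"
  shows "homeomorphic_map (subtopology (top_of M) (fst (sphere_chart e \<sigma>))) euclidean (snd (sphere_chart e \<sigma>))"
proof -
  let ?U = "sphere 0 1 - {(0, - \<sigma>)} :: ((real^'n) \<times> real) set"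
  have "continuous_map (subtopology (top_of M) (e ` ?U)) (top_of_set ?U) (inv e)"
    by (rule continuous_map_into_subtopology[OF continuous_map_from_subtopology[OF continuous_inv_e]]) (auto simp: points_M)
  moreover have "continuous_map (top_of_set ?U) euclidean (stereo \<sigma>)"
    unfolding continuous_map_iff_continuous stereo_def
    by (intro continuous_intros ballI one_plus_height_neq_0[OF \<sigma>])
  ultimately have 1: "continuous_map (subtopology (top_of M) (e ` ?U)) euclidean (stereo \<sigma> \<circ> inv e)"
    by (rule continuous_map_compose)
  have "continuous_map euclidean (top_of_set (sphere 0 1)) (stereo_inv \<sigma> :: real^'n \<Rightarrow> _)"
  proof (rule continuous_map_into_subtopology)
    have "continuous_on UNIV (stereo_inv \<sigma> :: real^'n \<Rightarrow> _)"
      unfolding stereo_inv_def by (intro continuous_intros) (auto simp: one_plus_inner_neq_0)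
    then show "continuous_map euclidean euclidean (stereo_inv \<sigma> :: real^'n \<Rightarrow> _)" by simp
  qed (use stereo_inv_in_sphere[OF \<sigma>] in blast)
  then have "continuous_map euclidean (top_of M) (e \<circ> stereo_inv \<sigma>)"
    by (rule continuous_map_compose) (use homeomorphic_maps_sphere in \<open>simp add: homeomorphic_maps_def\<close>)
  then have 2: "continuous_map euclidean (subtopology (top_of M) (e ` ?U)) (e \<circ> stereo_inv \<sigma>)"
    by (rule continuous_map_into_subtopology)
      (intro funcsetI, unfold o_apply, intro imageI stereo_inv_in_sphere[OF \<sigma>])
  have "homeomorphic_maps (subtopology (top_of M) (e ` ?U)) euclidean (stereo \<sigma> \<circ> inv e) (e \<circ> stereo_inv \<sigma>)"
    unfolding homeomorphic_maps_def
  proof (intro conjI 1 2 ballI)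
    fix x assume "x \<in> topspace (subtopology (top_of M) (e ` ?U))"
    then have "x \<in> e ` ?U" by simp
    then obtain w where "w \<in> ?U" "x = e w" by blast
    moreover from this have "stereo_inv \<sigma> (stereo \<sigma> w) = w" by (intro stereo_inv_stereo[OF \<sigma>])
    ultimately show "(e \<circ> stereo_inv \<sigma>) ((stereo \<sigma> \<circ> inv e) x) = x" by (simp only: o_apply inv_e)
  qed (simp add: stereo_stereo_inv[OF \<sigma>])
  then show ?thesis
    unfolding homeomorphic_map_maps by (auto simp: sphere_chart_def)
qed

lemma transition_sphere_chart:
  assumes "\<sigma> \<in> {1, -1}"
  shows "transition (sphere_chart e \<sigma>) (sphere_chart e \<sigma>) = (\<lambda>y. y)"
    and "transition (sphere_chart e \<sigma>) (sphere_chart e (- \<sigma>)) = (\<lambda>y. inverse (y \<bullet> y) *\<^sub>R y)"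
    and "snd (sphere_chart e \<sigma>) ` (fst (sphere_chart e \<sigma>) \<inter> fst (sphere_chart e (- \<sigma>))) \<subseteq> - {0}"
proof -
  show "transition (sphere_chart e \<sigma>) (sphere_chart e \<sigma>) = (\<lambda>y. y)"
    "transition (sphere_chart e \<sigma>) (sphere_chart e (- \<sigma>)) = (\<lambda>y. inverse (y \<bullet> y) *\<^sub>R y)"
    by (simp_all add: transition_def chart_inv_sphere_chart[OF assms] fun_eq_iff)
       (simp_all add: sphere_chart_def stereo_stereo_inv[OF assms] stereo_stereo_inv_opposite[OF assms])
  have nz: "stereo \<sigma> w \<noteq> 0" if w: "w \<in> sphere 0 1 - {(0, - \<sigma>)}" "w \<noteq> (0, \<sigma>)" for w :: "(real^'n) \<times> real"
  proof
    assume "stereo \<sigma> w = 0"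
    then have "stereo_inv \<sigma> (stereo \<sigma> w) = (0, \<sigma>)" by (simp add: stereo_inv_def)
    then show False using stereo_inv_stereo[OF assms w(1)] w(2) by simp
  qed
  show "snd (sphere_chart e \<sigma>) ` (fst (sphere_chart e \<sigma>) \<inter> fst (sphere_chart e (- \<sigma>))) \<subseteq> - {0}"
  proof clarify
    fix x assume x: "x \<in> fst (sphere_chart e \<sigma>)" "x \<in> fst (sphere_chart e (- \<sigma>))"
      and 0: "snd (sphere_chart e \<sigma>) x = 0"
    obtain w where w: "w \<in> sphere 0 1 - {(0, - \<sigma>)}" "x = e w"
      using x(1) unfolding sphere_chart_def fst_conv by (rule imageE)
    obtain w' where w': "w' \<in> sphere 0 1 - {(0, - (- \<sigma>))}" "x = e w'"
      using x(2) unfolding sphere_chart_def fst_conv by (rule imageE)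
    have "w \<noteq> (0, \<sigma>)" using w' injD[OF inj, of w w'] w(2) by auto
    then show False using nz[OF w(1)] 0 w(2) by (simp add: sphere_chart_def)
  qed
qed

lemma inversion_derivative:
  fixes y :: "real^'n"
  assumes "y \<noteq> 0"
  shows "frechet_derivative (\<lambda>y. inverse (y \<bullet> y) *\<^sub>R y) (at y) \<xi>
    = inverse (y \<bullet> y) *\<^sub>R \<xi> - (2 * (y \<bullet> \<xi>) / (y \<bullet> y)\<^sup>2) *\<^sub>R y"
proof -
  have "((\<lambda>y. inverse (y \<bullet> y) *\<^sub>R y) has_derivative
      (\<lambda>\<xi>. inverse (y \<bullet> y) *\<^sub>R \<xi> - (2 * (y \<bullet> \<xi>) / (y \<bullet> y)\<^sup>2) *\<^sub>R y)) (at y)"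
    using assms
    by (auto intro!: derivative_eq_intros simp: fun_eq_iff inner_commute power2_eq_square divide_inverse scaleR_left_distrib)
  from fun_cong[OF frechet_derivative_at[OF this], of \<xi>] show ?thesis by (rule sym)
qed

text \<open>
  The differential of the inversion is \<open>1 / |y|\<^sup>2\<close> times a reflection, and \<open>|y|\<^sup>2 (1 + 1 / |y|\<^sup>2) = 1 + |y|\<^sup>2\<close>.
\<close>
lemma inversion_conformal:
  fixes y \<xi> \<eta> :: "real^'n"
  assumes "y \<noteq> 0"
  defines "I \<equiv> \<lambda>y::real^'n. inverse (y \<bullet> y) *\<^sub>R y"
  shows "\<xi> \<bullet> (mat (4 / (1 + y \<bullet> y)\<^sup>2) *v \<eta>) =
    frechet_derivative I (at y) \<xi> \<bullet> (mat (4 / (1 + I y \<bullet> I y)\<^sup>2) *v frechet_derivative I (at y) \<eta>)"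
proof -
  define q where "q = y \<bullet> y"
  have q: "q > 0" using assms by (simp add: q_def)
  have DD: "frechet_derivative I (at y) \<xi> \<bullet> frechet_derivative I (at y) \<eta> = (\<xi> \<bullet> \<eta>) / q\<^sup>2"
    unfolding I_def inversion_derivative[OF assms(1)]
    using q by (simp add: inner_diff_left inner_diff_right inner_commute field_simps power2_eq_square flip: q_def)
  have I: "I y \<bullet> I y = 1 / q"
    using q by (simp add: I_def field_simps flip: q_def)
  show ?thesis
    unfolding mat_vector_mult inner_scaleR_right DD I q_def[symmetric]
    using q by (simp add: field_simps power2_eq_square)
qed

lemma smooth_transition:
  assumes "c \<in> atlas M" "d \<in> atlas M"
  shows "smooth_on (transition c d) (snd c ` (fst c \<inter> fst d))"
proof -
  obtain \<sigma> where \<sigma>: "\<sigma> \<in> {1, -1}" "c = sphere_chart e \<sigma>" using assms(1) by (rule atlas_cases)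
  obtain \<tau> where \<tau>: "\<tau> \<in> {1, -1}" "d = sphere_chart e \<tau>" using assms(2) by (rule atlas_cases)
  show ?thesis
  proof (cases "\<tau> = \<sigma>")
    case True
    then show ?thesis using transition_sphere_chart(1)[OF \<sigma>(1)] \<sigma>(2) \<tau>(2) smooth_on_ident by simp
  next
    case False
    then have "\<tau> = - \<sigma>" using \<sigma> \<tau> by auto
    have "Ck_on k (\<lambda>y::real^'n. inverse (y \<bullet> y) *\<^sub>R y) (- {0})" for k
      by (intro Ck_on_scaleR Ck_on_inverse Ck_on_inner Ck_on_bounded_linear bounded_linear_ident) auto
    then show ?thesis
      unfolding smooth_on_def \<sigma> \<tau> \<open>\<tau> = - \<sigma>\<close> transition_sphere_chart(2)[OF \<sigma>(1)]
      using transition_sphere_chart(3)[OF \<sigma>(1)] Ck_on_subset by blast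
  qed
qed

lemma metric_compatible:
  assumes "c \<in> atlas M" "d \<in> atlas M" "y \<in> snd c ` (fst c \<inter> fst d)"
  shows "\<xi> \<bullet> (metric M c y *v \<eta>) =
        frechet_derivative (transition c d) (at y) \<xi> \<bullet>
          (metric M d (transition c d y) *v frechet_derivative (transition c d) (at y) \<eta>)"
proof -
  obtain \<sigma> where \<sigma>: "\<sigma> \<in> {1, -1}" "c = sphere_chart e \<sigma>" using assms(1) by (rule atlas_cases)
  obtain \<tau> where \<tau>: "\<tau> \<in> {1, -1}" "d = sphere_chart e \<tau>" using assms(2) by (rule atlas_cases)
  show ?thesis
  proof (cases "\<tau> = \<sigma>")
    case True
    then show ?thesis using transition_sphere_chart(1)[OF \<sigma>(1)] \<sigma>(2) \<tau>(2) by (simp add: sphere_manifold_def)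
  next
    case False
    then have "\<tau> = - \<sigma>" using \<sigma> \<tau> by auto
    then have "y \<noteq> 0" using assms(3) transition_sphere_chart(3)[OF \<sigma>(1)] \<sigma>(2) \<tau>(2) by auto
    from inversion_conformal[OF this, of \<xi> \<eta>]
    show ?thesis
      unfolding \<sigma>(2) \<tau>(2) \<open>\<tau> = - \<sigma>\<close> transition_sphere_chart(2)[OF \<sigma>(1)] by (simp add: sphere_manifold_def)
  qed
qed

lemma smooth_metric: "smooth_on (\<lambda>y::real^'n. mat (4 / (1 + y \<bullet> y)\<^sup>2) $ i $ j) UNIV"
proof -
  have "Ck_on k (\<lambda>y::real^'n. 4 * inverse ((1 + y \<bullet> y) ^ 2)) UNIV" for k
    by (intro Ck_on_mult Ck_on_const Ck_on_inverse Ck_on_power Ck_on_add Ck_on_inner Ck_on_bounded_linear bounded_linear_ident)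
       (auto simp: one_plus_inner_neq_0)
  then show ?thesis
    by (cases "i = j") (simp_all add: smooth_on_def mat_def divide_inverse Ck_on_const)
qed

theorem riemannian_manifold_sphere: "riemannian_manifold M"
proof -
  have cov: "\<Union>(fst ` atlas M) = points M"
  proof -
    have "\<Union>(fst ` atlas M) = e ` ((sphere 0 1 - {(0, - 1)}) \<union> (sphere 0 1 - {(0, 1)}))"
      by (simp add: sphere_manifold_def sphere_chart_def image_Un)
    also have "(sphere 0 1 - {(0, - 1)}) \<union> (sphere 0 1 - {(0, 1)}) = (sphere 0 1 :: ((real^'n) \<times> real) set)"
      by auto
    finally show ?thesis by (simp add: points_M)
  qed
  have charts: "\<forall>(U, h)\<in>atlas M. openin (top_of M) U \<and> open (h ` U) \<and>
        homeomorphic_map (subtopology (top_of M) U) (top_of_set (h ` U)) h"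
  proof clarify
    fix U h assume "(U, h) \<in> atlas M"
    then obtain \<sigma> where \<sigma>: "\<sigma> \<in> {1, -1}" "(U, h) = sphere_chart e \<sigma>" by (rule atlas_cases)
    then have U: "U = fst (sphere_chart e \<sigma>)" "h = snd (sphere_chart e \<sigma>)" by (metis fst_conv snd_conv)+
    show "openin (top_of M) U \<and> open (h ` U) \<and> homeomorphic_map (subtopology (top_of M) U) (top_of_set (h ` U)) h"
      unfolding U chart_range[OF \<sigma>(1)] using openin_chart_domain homeomorphic_map_chart[OF \<sigma>(1)] by simp
  qed
  have rng: "snd c ` fst c = UNIV" if "c \<in> atlas M" for c
    using that by (rule atlas_cases) (simp add: chart_range)
  have met: "\<forall>c\<in>atlas M. (\<forall>i j. smooth_on (\<lambda>y. metric M c y $ i $ j) (snd c ` fst c)) \<and>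
        (\<forall>y\<in>snd c ` fst c. transpose (metric M c y) = metric M c y \<and>
           (\<forall>\<xi>. \<xi> \<noteq> 0 \<longrightarrow> \<xi> \<bullet> (metric M c y *v \<xi>) > 0))"
    using rng smooth_metric
    by (auto simp: sphere_manifold_def mat_vector_mult one_plus_inner_neq_0 intro!: divide_pos_pos)
  show ?thesis
    unfolding riemannian_manifold_def
    by (intro conjI ballI allI Hausdorff_M second_countable_M cov charts smooth_transition met metric_compatible)
qed

lemma nonneg_ricci_sphere: "nonneg_ricci M"
proof -
  have "(\<Sum>j\<in>UNIV. \<Sum>k\<in>UNIV. ricci (\<lambda>z. mat (4 / (1 + z \<bullet> z)\<^sup>2)) j k y * \<xi> $ j * \<xi> $ k) \<ge> 0" for y \<xi> :: "real^'n"
  proof -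
    have "(\<Sum>j\<in>UNIV. \<Sum>k\<in>UNIV. ricci (\<lambda>z. mat (4 / (1 + z \<bullet> z)\<^sup>2)) j k y * \<xi> $ j * \<xi> $ k)
        = (\<Sum>j\<in>UNIV. (real CARD('n) - 1) * 4 / (1 + y \<bullet> y)\<^sup>2 * \<xi> $ j * \<xi> $ j)"
      unfolding ricci_stereographic by (simp add: if_zero_mult)
    also have "\<dots> \<ge> 0"
    proof (rule sum_nonneg)
      have "real CARD('n) \<ge> 1" by (simp add: Suc_le_eq)
      then show "0 \<le> (real CARD('n) - 1) * 4 / (1 + y \<bullet> y)\<^sup>2 * \<xi> $ j * \<xi> $ j" for j
        by (simp add: mult.assoc)
    qed
    finally show ?thesis .
  qed
  then show ?thesis by (simp add: nonneg_ricci_def sphere_manifold_def)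
qed

end

section \<open>Zonal solutions on the sphere\<close>

lemma jacobi_generator_power:
  fixes h :: real
  shows "jacobi_gain \<kappa> a k * h ^ (k - 1) - jacobi_loss \<kappa> a k * h ^ k
    = \<kappa> * (h * (1 - h) * (k * (real k - 1) * h ^ (k - 2)) + a * (1 - 2 * h) * (k * h ^ (k - 1)))"
proof -
  consider "k = 0" | "k = 1" | j where "k = Suc (Suc j)"
    by (metis One_nat_def not0_implies_Suc)
  then show ?thesis
    by cases (simp_all add: jacobi_gain_def jacobi_loss_def algebra_simps)
qed

definition chart_height :: "real \<Rightarrow> real \<Rightarrow> real" where
  "chart_height \<sigma> r = (1 - \<sigma>) / 2 + \<sigma> / (1 + r)"

text \<open>
  This identifies the right-hand side of the radial equation in a stereographic chart with the Jacobi
  operator in the height \<open>h\<close>, which is \<open>1 / (1 + \<rho>)\<close> or \<open>\<rho> / (1 + \<rho>)\<close>. The two charts differ by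
  \<open>h \<mapsto> 1 - h\<close>, a symmetry of the operator. The dimension enters through \<open>n - 1 = \<kappa> (2 a - 1)\<close>.
\<close>
lemma jacobi_operator_in_chart:
  fixes n :: real
  assumes \<sigma>: "\<sigma> \<in> {1, -1}" and \<rho>: "\<rho> \<ge> 0" and n: "n - 1 = \<kappa> * (2 * a - 1)"
    and F1: "F1 = P1 * (- \<sigma> / (1 + \<rho>)\<^sup>2)"
    and F2: "F2 = P2 * (- \<sigma> / (1 + \<rho>)\<^sup>2)\<^sup>2 + P1 * (2 * \<sigma> / (1 + \<rho>) ^ 3)"
    and \<beta>: "\<beta> = - 2 / (1 + \<rho>)" and h: "h = chart_height \<sigma> \<rho>"
  shows "(\<kappa> * (4 * \<rho> * F2 + 2 * F1 - 2 * \<beta> * \<rho> * F1) + (n - 1) * (2 * F1 + 2 * \<beta> * \<rho> * F1)) / (4 / (1 + \<rho>)\<^sup>2)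
    = \<kappa> * (h * (1 - h) * P2 + a * (1 - 2 * h) * P1)"
proof -
  define w where "w = 1 + \<rho>"
  have w: "w > 0" "\<rho> = w - 1" using \<rho> by (auto simp: w_def)
  have hh: "h * (1 - h) = (w - 1) / w\<^sup>2" "1 - 2 * h = \<sigma> * (w - 2) / w"
    using \<sigma> w(1) unfolding h chart_height_def w_def[symmetric]
    by (auto simp: field_simps power2_eq_square)
  show ?thesis
    unfolding F1 F2 \<beta> n w_def[symmetric] hh using w(1) \<sigma>
    unfolding w(2) by (auto simp: field_simps power2_eq_square power3_eq_cube)
qed

context sphere_embedding
begin

text \<open>
  The variable \<open>s = (1 + cos r) / 2\<close> with \<open>r\<close> the distance from the pole \<open>(0, 1)\<close>.
\<close>
definition height :: "'a \<Rightarrow> real" where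
  "height x = (1 + snd (inv e x)) / 2"

definition zonal :: "real \<Rightarrow> nat \<Rightarrow> (nat \<Rightarrow> real \<Rightarrow> real) \<Rightarrow> 'a \<times> real \<Rightarrow> real" where
  "zonal \<delta> m c z = \<delta> + (\<Sum>k\<le>m. height (fst z) ^ k * c k (snd z))"

lemma height_nonneg:
  assumes "x \<in> points M"
  shows "height x \<ge> 0"
proof -
  obtain w where w: "w \<in> sphere 0 1" "x = e w" using assms points_M by auto
  then have "\<bar>snd w\<bar> \<le> 1" using norm_snd_le[of "snd w" "fst w"] by simp
  then show ?thesis using w by (simp add: height_def)
qed

lemma height_in_chart:
  assumes "\<sigma> \<in> {1, -1}"
  shows "height (e (stereo_inv \<sigma> y)) = chart_height \<sigma> (y \<bullet> y)"
  using one_plus_inner_neq_0[of y]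
  by (simp add: height_def stereo_inv_def chart_height_def divide_simps) (simp add: algebra_simps)?

lemma zonal_in_chart:
  assumes "\<sigma> \<in> {1, -1}"
  shows "in_chart (sphere_chart e \<sigma>) (zonal \<delta> m c) = (\<lambda>z. \<delta> + (\<Sum>k\<le>m. chart_height \<sigma> (fst z \<bullet> fst z) ^ k * c k (snd z)))"
  by (simp add: fun_eq_iff in_chart_def chart_inv_sphere_chart[OF assms] zonal_def height_in_chart[OF assms])

lemma chart_height_derivatives:
  assumes "r \<ge> 0"
  shows "(chart_height \<sigma> has_real_derivative - \<sigma> / (1 + r)\<^sup>2) (at r)"
    and "((\<lambda>r. - \<sigma> / (1 + r)\<^sup>2) has_real_derivative 2 * \<sigma> / (1 + r) ^ 3) (at r)"
proof -
  show "(chart_height \<sigma> has_real_derivative - \<sigma> / (1 + r)\<^sup>2) (at r)"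
    using assms unfolding chart_height_def by (auto intro!: derivative_eq_intros simp: power2_eq_square)
  show "((\<lambda>r. - \<sigma> / (1 + r)\<^sup>2) has_real_derivative 2 * \<sigma> / (1 + r) ^ 3) (at r)"
    using assms by (auto intro!: derivative_eq_intros simp: divide_simps power2_eq_square power3_eq_cube)
qed

text \<open>
  By duality the time derivative of the polynomial is its image under the Jacobi operator, and in each
  stereographic chart that is the right-hand side of the equation in radial form.
\<close>
lemma zonal_classical:
  assumes p: "1 < p" and a: "a = (real CARD('n) + p - 2) / (2 * (p - 1))"
    and c: "death_chain (jacobi_loss (p - 1) a) (jacobi_gain (p - 1) a) m c" and \<sigma>: "\<sigma> \<in> {1, -1}"
  shows "classical_solution_at p (\<lambda>y. mat (4 / (1 + y \<bullet> y)\<^sup>2)) (in_chart (sphere_chart e \<sigma>) (zonal \<delta> m c)) y t"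
proof -
  define \<rho> where "\<rho> = y \<bullet> y"
  define P1 P2 where "P1 h = (\<Sum>k\<le>m. c k t * (k * h ^ (k - 1)))"
    and "P2 h = (\<Sum>k\<le>m. c k t * (k * (real k - 1) * h ^ (k - 2)))" for h :: real
  let ?h = "chart_height \<sigma>"
  let ?h1 = "\<lambda>r. - \<sigma> / (1 + r)\<^sup>2"
  let ?F = "\<lambda>r. \<delta> + (\<Sum>k\<le>m. ?h r ^ k * c k t)"
  let ?F1 = "\<lambda>r. P1 (?h r) * ?h1 r"
  let ?F2 = "P2 (?h \<rho>) * (?h1 \<rho>)\<^sup>2 + P1 (?h \<rho>) * (2 * \<sigma> / (1 + \<rho>) ^ 3)"
  let ?\<beta> = "- 2 / (1 + \<rho>)"
  have \<rho>: "\<rho> \<ge> 0" by (simp add: \<rho>_def)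
  have P: "((\<lambda>h. \<delta> + (\<Sum>k\<le>m. h ^ k * c k t)) has_real_derivative P1 h) (at h)" for h
    unfolding P1_def by (auto intro!: derivative_eq_intros DERIV_sum sum.cong)
  have P1: "(P1 has_real_derivative P2 h) (at h)" for h
  proof -
    have "((\<lambda>h. c k t * (k * h ^ (k - 1))) has_real_derivative c k t * (k * (real k - 1) * h ^ (k - 2))) (at h)" for k
      by (cases k) (auto intro!: derivative_eq_intros simp: numeral_2_eq_2)
    then show ?thesis unfolding P1_def[abs_def] P2_def by (intro DERIV_sum)
  qed
  have F: "(?F has_real_derivative ?F1 r) (at r)" if "r \<ge> 0" for r
    using DERIV_chain2[OF P chart_height_derivatives(1)[OF that]] .
  have F1: "(?F1 has_real_derivative ?F2) (at \<rho>)"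
    using DERIV_mult[OF DERIV_chain2[OF P1 chart_height_derivatives(1)[OF \<rho>]] chart_height_derivatives(2)[OF \<rho>], of \<sigma> \<sigma>]
    by (simp add: power2_eq_square algebra_simps)
  have n: "real CARD('n) - 1 = (p - 1) * (2 * a - 1)" using p by (simp add: a field_simps)
  have gain0: "jacobi_gain (p - 1) a 0 = 0" by (simp add: jacobi_gain_def)
  have "((\<lambda>s. \<delta> + (\<Sum>k\<le>m. ?h \<rho> ^ k * c k s)) has_real_derivative
      0 + (\<Sum>k\<le>m. c k t * (jacobi_gain (p - 1) a k * ?h \<rho> ^ (k - 1) - jacobi_loss (p - 1) a k * ?h \<rho> ^ k))) (at t)"
    by (intro DERIV_add DERIV_const death_chain_duality[OF c gain0])
  also have "0 + (\<Sum>k\<le>m. c k t * (jacobi_gain (p - 1) a k * ?h \<rho> ^ (k - 1) - jacobi_loss (p - 1) a k * ?h \<rho> ^ k))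
      = (p - 1) * (?h \<rho> * (1 - ?h \<rho>) * P2 (?h \<rho>) + a * (1 - 2 * ?h \<rho>) * P1 (?h \<rho>))"
    unfolding add_0 jacobi_generator_power P1_def P2_def sum_distrib_left sum.distrib[symmetric]
    by (intro sum.cong) (auto simp: algebra_simps)
  also have "\<dots> = ((p - 1) * (4 * \<rho> * ?F2 + 2 * ?F1 \<rho> - 2 * ?\<beta> * \<rho> * ?F1 \<rho>)
      + (real CARD('n) - 1) * (2 * ?F1 \<rho> + 2 * ?\<beta> * \<rho> * ?F1 \<rho>)) / (4 / (1 + \<rho>)\<^sup>2)"
    by (rule jacobi_operator_in_chart[OF \<sigma> \<rho> n refl refl refl refl, symmetric])
  finally have time: "((\<lambda>s. in_chart (sphere_chart e \<sigma>) (zonal \<delta> m c) (y, s)) has_real_derivative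
      ((p - 1) * (4 * \<rho> * ?F2 + 2 * ?F1 \<rho> - 2 * ?\<beta> * \<rho> * ?F1 \<rho>)
      + (real CARD('n) - 1) * (2 * ?F1 \<rho> + 2 * ?\<beta> * \<rho> * ?F1 \<rho>)) / (4 / (1 + \<rho>)\<^sup>2)) (at t)"
    by (simp add: zonal_in_chart[OF \<sigma>] \<rho>_def)
  show ?thesis
  proof (rule radial_classical_solution[where F = ?F and dF = ?F1 and ddF = ?F2 and \<rho> = \<rho> and \<beta> = ?\<beta>
        and L = "\<lambda>r. 4 / (1 + r)\<^sup>2" and d = "- 8 / (1 + \<rho>) ^ 3", OF _ F F1 \<rho>_def _ _ _ time])
    show "in_chart (sphere_chart e \<sigma>) (zonal \<delta> m c) (z, t) = ?F (z \<bullet> z)" for z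
      by (simp add: zonal_in_chart[OF \<sigma>])
    show "((\<lambda>r. 4 / (1 + r)\<^sup>2) has_real_derivative - 8 / (1 + \<rho>) ^ 3) (at \<rho>)"
      using \<rho> by (auto intro!: derivative_eq_intros simp: divide_simps power2_eq_square power3_eq_cube)
    show "4 / (1 + \<rho>)\<^sup>2 \<noteq> 0" using \<rho> by simp
    show "- 2 / (1 + \<rho>) = - 8 / (1 + \<rho>) ^ 3 / (4 / (1 + \<rho>)\<^sup>2)"
      using \<rho> by (simp add: divide_simps power2_eq_square power3_eq_cube)
  qed
qed

lemma smooth_chart_height:
  assumes "open S" "bounded_linear (\<pi> :: 'b::real_normed_vector \<Rightarrow> real^'n)"
  shows "Ck_on j (\<lambda>z. chart_height \<sigma> (\<pi> z \<bullet> \<pi> z)) S"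
  unfolding chart_height_def divide_inverse
  by (intro Ck_on_add Ck_on_mult Ck_on_const Ck_on_inverse Ck_on_inner Ck_on_bounded_linear assms one_plus_inner_neq_0)

lemma smooth_zonal_slice: "smooth_fun M (\<lambda>x. zonal \<delta> m c (x, t))"
  unfolding smooth_fun_def
proof
  fix d assume "d \<in> atlas M"
  then obtain \<sigma> where \<sigma>: "\<sigma> \<in> {1, -1}" "d = sphere_chart e \<sigma>" by (rule atlas_cases)
  have eq: "(\<lambda>x. zonal \<delta> m c (x, t)) \<circ> chart_inv d = (\<lambda>y. \<delta> + (\<Sum>k\<le>m. chart_height \<sigma> (y \<bullet> y) ^ k * c k t))"
    using zonal_in_chart[OF \<sigma>(1), of \<delta> m c] by (auto simp: fun_eq_iff in_chart_def \<sigma>(2))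
  show "smooth_on ((\<lambda>x. zonal \<delta> m c (x, t)) \<circ> chart_inv d) (snd d ` fst d)"
    unfolding eq unfolding \<sigma>(2) chart_range[OF \<sigma>(1)] smooth_on_def
    by (intro allI Ck_on_add Ck_on_const Ck_on_sum Ck_on_mult Ck_on_power smooth_chart_height open_UNIV bounded_linear_ident)
qed

lemma death_chain_C1:
  assumes "death_chain l r m c"
  shows "(c k has_real_derivative r (Suc k) * c (Suc k) t - l k * c k t) (at t)"
    and "continuous_on UNIV (c k)"
proof -
  show D: "(c k has_real_derivative r (Suc k) * c (Suc k) t - l k * c k t) (at t)" for k t
    using assms by (simp add: death_chain_def)
  show "continuous_on UNIV (c k)"
    by (rule DERIV_continuous_on[OF has_field_derivative_at_within[OF D]])
qed

lemma C1_zonal_in_chart: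
  assumes c: "death_chain l r m c" and \<sigma>: "\<sigma> \<in> {1, -1}" and S: "open S"
  shows "Ck_on 1 (in_chart (sphere_chart e \<sigma>) (zonal \<delta> m c)) S"
proof -
  have "Ck_on 1 (\<lambda>z :: (real^'n) \<times> real. c k (snd z)) S" for k
    by (rule C1_compose_snd[OF S death_chain_C1(1)[OF c]])
       (intro continuous_intros death_chain_C1(2)[OF c])
  then show ?thesis
    unfolding zonal_in_chart[OF \<sigma>]
    by (intro Ck_on_add Ck_on_const Ck_on_sum Ck_on_mult Ck_on_power smooth_chart_height S bounded_linear_fst)
qed

lemma continuous_zonal:
  assumes "death_chain l r m c"
  shows "continuous_map (spacetime M) euclideanreal (zonal \<delta> m c)"
proof -
  have "continuous_map euclidean euclideanreal (\<lambda>w :: (real^'n) \<times> real. (1 + snd w) / 2)"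
    by (simp, intro continuous_intros) auto
  from continuous_map_compose[OF continuous_inv_e this]
  have h: "continuous_map (top_of M) euclideanreal height"
    by (simp add: o_def height_def[abs_def])
  have c: "continuous_map euclideanreal euclideanreal (c k)" for k
    using death_chain_C1(2)[OF assms] by simp
  show ?thesis
    unfolding zonal_def[abs_def]
    by (intro continuous_map_add continuous_map_sum continuous_map_real_mult continuous_map_real_pow
        continuous_map_compose[OF continuous_map_fst h, unfolded o_def]
        continuous_map_compose[OF continuous_map_snd c, unfolded o_def]) auto
qed

lemma zonal_pos:
  assumes c: "death_chain l r m c" and "\<delta> > 0" "x \<in> points M" "t \<ge> 0"
  shows "zonal \<delta> m c (x, t) > 0"
proof -
  have "(\<Sum>k\<le>m. height x ^ k * c k t) \<ge> 0"
    using c assms height_nonneg by (intro sum_nonneg mult_nonneg_nonneg zero_le_power) (auto simp: death_chain_def)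
  then show ?thesis using assms by (simp add: zonal_def)
qed

theorem viscosity_solution_zonal:
  assumes p: "1 < p" and a: "a = (real CARD('n) + p - 2) / (2 * (p - 1))"
    and c: "death_chain (jacobi_loss (p - 1) a) (jacobi_gain (p - 1) a) m c"
  shows "viscosity_solution p M \<infinity> (zonal \<delta> m c)"
proof (rule viscosity_solution_if_classical[OF p riemannian_manifold_sphere])
  show "metric M d = (\<lambda>y. mat (4 / (1 + y \<bullet> y)\<^sup>2))" for d by (simp add: sphere_manifold_def)
  show "continuous_map (subtopology (spacetime M) (cylinder M \<infinity>)) euclideanreal (zonal \<delta> m c)"
    by (rule continuous_map_from_subtopology[OF continuous_zonal[OF c]])
  fix d and y :: "real^'n" and t :: real
  assume "d \<in> atlas M"
  then obtain \<sigma> where \<sigma>: "\<sigma> \<in> {1, -1}" "d = sphere_chart e \<sigma>" by (rule atlas_cases)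
  then show "classical_solution_at p (metric M d) (in_chart d (zonal \<delta> m c)) y t"
    using zonal_classical[OF p a c \<sigma>(1)] by (simp add: sphere_manifold_def)
qed

lemma C1_log_zonal:
  assumes c: "death_chain l r m c" and \<delta>: "\<delta> > 0"
  shows "C1_fun M (cylinder M \<infinity>) (\<lambda>z. ln (zonal \<delta> m c z))"
  unfolding C1_fun_def
proof
  fix d assume d: "d \<in> atlas M"
  then obtain \<sigma> where \<sigma>: "\<sigma> \<in> {1, -1}" "d = sphere_chart e \<sigma>" by (rule atlas_cases)
  let ?O = "chart_image d (cylinder M \<infinity>)"
  have "cylinder M \<infinity> = points M \<times> {0<..}" by (auto simp: cylinder_def)
  then have cyl: "openin (spacetime M) (cylinder M \<infinity>)" by (simp add: openin_prod_Times_iff)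
  have O: "open ?O" by (rule open_chart_image[OF riemannian_manifold_sphere d cyl])
  have "in_chart d (zonal \<delta> m c) z > 0" if "z \<in> ?O" for z
  proof -
    have "(chart_inv d (fst z), snd z) \<in> cylinder M \<infinity>"
      using that unfolding chart_image_eq[OF riemannian_manifold_sphere d] by simp
    then show ?thesis
      using zonal_pos[OF c \<delta>] by (simp add: in_chart_def cylinder_def case_prod_unfold)
  qed
  then have "Ck_on 1 (\<lambda>z. ln (in_chart d (zonal \<delta> m c) z)) ?O"
    using C1_zonal_in_chart[OF c \<sigma>(1) O] by (intro Ck_on_ln O) (simp_all add: \<sigma>(2))
  moreover have "in_chart d (\<lambda>z. ln (zonal \<delta> m c z)) = (\<lambda>z. ln (in_chart d (zonal \<delta> m c) z))"
    by (simp add: in_chart_def fun_eq_iff)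
  ultimately show "Ck_on 1 (in_chart d (\<lambda>z. ln (zonal \<delta> m c z))) ?O" by simp
qed

text \<open>
  The function \<open>log u\<close> is of class \<open>C\<^sup>1\<close>, so it is a test function for itself. At the pole, which the
  chart sends to \<open>0\<close>, its gradient vanishes because it is radial, and the inequality only concerns the
  logarithmic time derivative.
\<close>
lemma first_order_inequality_at_pole:
  assumes \<kappa>: "\<kappa> = p - 1" and c: "death_chain (jacobi_loss \<kappa> a) (jacobi_gain \<kappa> a) m c"
    and \<delta>: "\<delta> > 0" and t: "t > 0"
    and super: "first_order_supersolution p a' M (\<lambda>z. ln (zonal \<delta> m c z))"
  shows "\<kappa> * a * (\<Sum>k\<le>m. k * c k t) \<le> a' / t * (\<delta> + (\<Sum>k\<le>m. c k t))"
proof -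
  let ?c = "sphere_chart e 1" and ?v = "\<lambda>z. ln (zonal \<delta> m c z)"
  define x where "x = e (0, 1)"
  define u where "u = \<delta> + (\<Sum>k\<le>m. c k t)"
  define Q where "Q = (\<Sum>k\<le>m. k * c k t)"
  have c_at: "?c \<in> atlas M" by (simp add: sphere_manifold_def)
  have xU: "x \<in> fst ?c" by (auto simp: x_def sphere_chart_def norm_prod_def)
  have xM: "x \<in> points M" by (auto simp: x_def points_M norm_prod_def)
  have hx: "height x = 1" by (simp add: height_def x_def)
  have cyl: "cylinder M \<infinity> = points M \<times> {0<..}" by (auto simp: cylinder_def)
  have "touches_below M \<infinity> (cylinder M \<infinity>) ?v ?v (x, t)"
    using xM t by (simp add: touches_below_def cyl openin_prod_Times_iff)
  then have ineq: "time_deriv ?v x t - (p - 1) * grad_norm_sq M ?c ?v x t + a' / t \<ge> 0"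
    using super C1_log_zonal[OF c \<delta>] c_at xU unfolding first_order_supersolution_def by blast
  have u: "zonal \<delta> m c (x, t) = u" "u > 0"
    using zonal_pos[OF c \<delta> xM, of t] t by (simp_all add: zonal_def u_def hx)
  have gain0: "jacobi_gain \<kappa> a 0 = 0" by (simp add: jacobi_gain_def)
  have "((\<lambda>s. \<Sum>k\<le>m. 1 * c k s) has_real_derivative
      (\<Sum>k\<le>m. c k t * (jacobi_gain \<kappa> a k * 1 - jacobi_loss \<kappa> a k * 1))) (at t)"
    by (rule death_chain_duality[OF c gain0])
  also have "(\<Sum>k\<le>m. c k t * (jacobi_gain \<kappa> a k * 1 - jacobi_loss \<kappa> a k * 1)) = - (\<kappa> * a * Q)"
    by (simp add: Q_def jacobi_gain_def jacobi_loss_def sum_distrib_left algebra_simps flip: sum_negf)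
  finally have S': "((\<lambda>s. \<Sum>k\<le>m. 1 * c k s) has_real_derivative - (\<kappa> * a * Q)) (at t)" .
  have u': "((\<lambda>s. zonal \<delta> m c (x, s)) has_real_derivative - (\<kappa> * a * Q)) (at t)"
    using DERIV_add[OF DERIV_const[of \<delta>] S'] by (simp add: zonal_def hx)
  have "((\<lambda>s. ?v (x, s)) has_real_derivative - (\<kappa> * a * Q) / u) (at t)"
    using DERIV_chain2[OF _ u', of ln "1 / u"] DERIV_ln_divide[OF u(2)] u(1) by simp
  then have td: "time_deriv ?v x t = - (\<kappa> * a * Q) / u"
    unfolding time_deriv_def by (rule DERIV_imp_deriv)
  have sx: "snd ?c x = 0" by (simp add: sphere_chart_def x_def stereo_def)
  have "grad_at M ?c ?v x t = 0"
  proof -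
    let ?F = "\<lambda>r. ln (\<delta> + (\<Sum>k\<le>m. chart_height 1 r ^ k * c k t))"
    have F: "\<exists>d. (?F has_real_derivative d) (at 0)"
    proof -
      have "chart_height 1 0 = 1" by (simp add: chart_height_def)
      then show ?thesis
        using u(2) chart_height_derivatives(1)[of 0 1]
        by (intro exI) (auto intro!: derivative_eq_intros DERIV_sum simp: u_def)
    qed
    then obtain d where "(?F has_real_derivative d) (at ((0::real^'n) \<bullet> 0))" by auto
    from radial_partial(2)[OF this]
    have "partial i (\<lambda>y. in_chart ?c ?v (y, t)) 0 = 0" for i
      using zonal_in_chart[of 1 \<delta> m c] by (simp add: in_chart_def fun_eq_iff)
    then show ?thesis
      by (simp add: grad_at_def grad_def sx vec_eq_iff matrix_vector_mult_def)
  qed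
  then have "grad_norm_sq M ?c ?v x t = 0" by (simp add: grad_norm_sq_def)
  with ineq td have "\<kappa> * a * Q / u \<le> a' / t" by simp
  then show ?thesis using u(2) by (simp add: divide_le_eq flip: Q_def u_def)
qed

end


section \<open>Sharpness of the constant\<close>

theorem proposition4p13:
  fixes p a :: real
  assumes "1 < p"
    and "a = (real CARD('n::finite) + p - 2) / (2 * (p - 1))"
  shows
    "((\<forall>(x :: real^'n) t. t > 0 \<longrightarrow> Gp p (x, t) > 0) \<and>
      viscosity_solution p (euclidean_manifold :: (real^'n, 'n) manifold) \<infinity> (Gp p) \<and>
      (\<forall>(x :: real^'n) t. t > 0 \<longrightarrow>
         (\<exists>Dv vt. GDERIV (\<lambda>y. ln (Gp p (y, t))) x :> Dv \<and>
                  ((\<lambda>s. ln (Gp p (x, s))) has_real_derivative vt) (at t) \<and>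
                  (p - 1) * (norm Dv)\<^sup>2 - vt = (real CARD('n) + p - 2) / (2 * (p - 1) * t))))
     \<and>
     (\<forall>a'\<ge>0.
        (\<forall>(M :: (real, 'n) manifold) u.
           closed_riemannian_manifold M \<and> nonneg_ricci M \<and>
           (\<forall>z\<in>cylinder M \<infinity>. u z > 0) \<and>
           viscosity_solution p M \<infinity> u \<and>
           continuous_map (subtopology (spacetime M) (points M \<times> {0..})) euclideanreal u \<and>
           smooth_fun M (\<lambda>x. u (x, 0)) \<and>
           (\<forall>x\<in>points M. u (x, 0) > 0)
           \<longrightarrow> first_order_supersolution p a' M (\<lambda>z. ln (u z)))
        \<longrightarrow> a' \<ge> a)"
proof (intro conjI allI impI)
  show "Gp p (x, t) > 0" if "t > 0" for x :: "real^'n" and t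
    using that by (simp add: Gp_def)
  show "viscosity_solution p (euclidean_manifold :: (real^'n, 'n) manifold) \<infinity> (Gp p)"
    by (rule viscosity_solution_Gp[OF assms(1)])
  show "\<exists>Dv vt. GDERIV (\<lambda>y. ln (Gp p (y, t))) x :> Dv \<and>
                  ((\<lambda>s. ln (Gp p (x, s))) has_real_derivative vt) (at t) \<and>
                  (p - 1) * (norm Dv)\<^sup>2 - vt = (real CARD('n) + p - 2) / (2 * (p - 1) * t)"
    if "t > 0" for x :: "real^'n" and t
    by (rule log_Gp_derivatives[OF assms(1) that])
  fix a' :: real
  assume a': "a' \<ge> 0"
    and H: "\<forall>(M :: (real, 'n) manifold) u.
           closed_riemannian_manifold M \<and> nonneg_ricci M \<and>
           (\<forall>z\<in>cylinder M \<infinity>. u z > 0) \<and>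
           viscosity_solution p M \<infinity> u \<and>
           continuous_map (subtopology (spacetime M) (points M \<times> {0..})) euclideanreal u \<and>
           smooth_fun M (\<lambda>x. u (x, 0)) \<and>
           (\<forall>x\<in>points M. u (x, 0) > 0)
           \<longrightarrow> first_order_supersolution p a' M (\<lambda>z. ln (u z))"
  define \<kappa> where "\<kappa> = p - 1"
  have \<kappa>: "\<kappa> > 0" using assms(1) by (simp add: \<kappa>_def)
  have "real CARD('n) \<ge> 1" by (simp add: Suc_le_eq)
  then have a: "a > 0" unfolding assms(2) using assms(1) by (intro divide_pos_pos mult_pos_pos) linarith+
  obtain f :: "real^'n option \<Rightarrow> real" where f: "inj f"
    using riemannian_manifold_points_lepoll[OF riemannian_manifold_euclidean[where 'n = "'n option"]]
    by (auto simp: lepoll_def euclidean_manifold_def)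
  \<comment> \<open>Euclidean space of dimension \<open>n + 1\<close> embeds into \<open>\<real>\<close> as a set, which carries the sphere over to the type \<open>\<real>\<close>\<close>
  define e :: "(real^'n) \<times> real \<Rightarrow> real"
    where "e w = f (\<chi> i. case i of None \<Rightarrow> snd w | Some j \<Rightarrow> fst w $ j)" for w
  have "inj e"
  proof (rule injI)
    fix v w assume "e v = e w"
    then have eq: "(\<chi> i. case i of None \<Rightarrow> snd v | Some j \<Rightarrow> fst v $ j) = (\<chi> i. case i of None \<Rightarrow> snd w | Some j \<Rightarrow> fst w $ j)"
      unfolding e_def by (rule injD[OF f])
    have *: "(case i of None \<Rightarrow> snd v | Some j \<Rightarrow> fst v $ j) = (case i of None \<Rightarrow> snd w | Some j \<Rightarrow> fst w $ j)" for i
      using arg_cong[OF eq, of "\<lambda>z. z $ i"] by simp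
    show "v = w" using *[of None] *[of "Some _"] by (simp add: prod_eq_iff vec_eq_iff)
  qed
  then interpret sphere_embedding e by unfold_locales
  have "jacobi_gain \<kappa> a k \<ge> 0" for k
    using \<kappa> a by (cases k) (auto simp: jacobi_gain_def)
  then obtain c where c: "\<And>m. death_chain (jacobi_loss \<kappa> a) (jacobi_gain \<kappa> a) m (c m)"
    using death_chain_exists[of "jacobi_gain \<kappa> a" "jacobi_loss \<kappa> a"] by metis
  have super: "first_order_supersolution p a' M (\<lambda>z. ln (zonal \<delta> m (c m) z))" if \<delta>: "\<delta> > 0" for \<delta> m
  proof (rule H[rule_format], intro conjI ballI)
    show "closed_riemannian_manifold M"
      by (simp add: closed_riemannian_manifold_def riemannian_manifold_sphere compact_M)
    show "nonneg_ricci M" by (rule nonneg_ricci_sphere)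
    show "zonal \<delta> m (c m) z > 0" if "z \<in> cylinder M \<infinity>" for z
      using that zonal_pos[OF c \<delta>] by (auto simp: cylinder_def)
    show "viscosity_solution p M \<infinity> (zonal \<delta> m (c m))"
      by (rule viscosity_solution_zonal[OF assms c[unfolded \<kappa>_def]])
    show "continuous_map (subtopology (spacetime M) (points M \<times> {0..})) euclideanreal (zonal \<delta> m (c m))"
      by (rule continuous_map_from_subtopology[OF continuous_zonal[OF c]])
    show "smooth_fun M (\<lambda>x. zonal \<delta> m (c m) (x, 0))" by (rule smooth_zonal_slice)
    show "zonal \<delta> m (c m) (x, 0) > 0" if "x \<in> points M" for x
      using zonal_pos[OF c \<delta> that] by simp
  qed
  show "a' \<ge> a"
  proof (rule death_chain_decay[OF a \<kappa> c a'])
    fix m and t :: real assume t: "t > 0"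
    let ?Q = "\<Sum>k\<le>m. real k * c m k t" and ?S = "\<Sum>k\<le>m. c m k t"
    \<comment> \<open>the constant \<open>\<delta>\<close> that made the solutions positive is now removed\<close>
    have "((\<lambda>\<delta>. a' / t * (\<delta> + ?S)) \<longlongrightarrow> a' / t * (0 + ?S)) (at_right 0)"
      by (intro tendsto_intros)
    moreover have "\<forall>\<^sub>F \<delta> in at_right (0::real). \<kappa> * a * ?Q \<le> a' / t * (\<delta> + ?S)"
      using eventually_at_right_less[of "0::real"]
      by eventually_elim (rule first_order_inequality_at_pole[OF \<kappa>_def c _ t super])
    ultimately show "\<kappa> * a * ?Q \<le> a' / t * ?S"
      using tendsto_lowerbound[of _ _ "at_right (0::real)"] by force
  qed
qed

end
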